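(* Let $X$ be a Polish space, let $(\mu_n)$ be a sequence converging to $\mu$ in $\mathcal P(X)$, and define the empirical measure $\pi_n\colon X^n\to\mathcal P(X)$ as $$\pi_n(x_1,\dots,x_n):=\tfrac1n\sum_{i=1}^n\delta_{x_i}.$$ Then the law $\mathbb P_n:=\mu_n^{\otimes n}\circ\pi_n^{-1}$ of $\pi_n$ under the product measure $\mu_n^{\otimes n}$ satisfies a large deviations principle on $\mathcal P(X)$ with speed $(n)$ and rate $H(\cdot|\mu)$. Assume furthermore that $(\mu_n)$ satisfies a large deviations principle on $X$ with speed $(a_n)$, where $a_n>0$ and $\lim_na_n=+\infty$, and lower semicontinuous, coercive rate $I\colon X\to[0,+\infty]$. Then the law of $\pi_n$ satisfies a large deviations principle on $\mathcal P(X)$ with speed $(n\,a_n)$ and lower semicontinuous, coercive rate $\mathcal I\colon\mathcal P(X)\to[0,+\infty]$, $$\mathcal I(\nu):=\int_X\nu(dx)\,I(x).$$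
   Context: $\mathcal P(X)$ is the space of Borel probability measures on $X$ with the narrow (weak) topology, which is itself a Polish space; $\delta_x$ is the Dirac mass at $x$. The relative entropy is $H(\nu|\mu)=\sup_\varphi\{\nu(\varphi)-\log\mu(e^\varphi)\}$, the supremum being over bounded Borel functions $\varphi$ on $X$, where $\mu(f)$ denotes the integral of $f$ with respect to $\mu$. A sequence $(\mathbb Q_n)$ of Borel probability measures on a Polish space $Z$ satisfies a large deviations principle with speed $(b_n)$ and lower semicontinuous rate $F\colon Z\to[0,+\infty]$ iff $\varliminf_n\frac1{b_n}\log\mathbb Q_n(O)\ge-\inf_{z\in O}F(z)$ for each open $O\subset Z$ and $\varlimsup_n\frac1{b_n}\log\mathbb Q_n(C)\le-\inf_{z\in C}F(z)$ for each closed $C\subset Z$. A functional $F\colon Z\to[0,+\infty]$ is coercive iff for each $\ell\ge0$ the set $\{z\in Z: F(z)\le\ell\}$ is precompact. *)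

theory Defs
  imports "HOL-Probability.Probability"
begin

text \<open>The space of Borel probability measures with the narrow topology. It is a type, so that
  the library's \<open>open\<close>, \<open>closed\<close>, \<open>borel\<close> and sequence limits apply to it.\<close>

typedef (overloaded) ('a :: topological_space) borel_prob =
  "{M :: 'a measure. prob_space M \<and> sets M = sets borel}"
  morphisms meas_of prob_of
proof
  show "return borel undefined \<in> {M :: 'a measure. prob_space M \<and> sets M = sets borel}"
    by (simp add: prob_space_return)
qed

text \<open>The narrow topology is the coarsest one for which \<open>\<nu> \<mapsto> \<nu>(f)\<close> is continuous
  for every bounded continuous \<open>f\<close>.\<close>

instantiation borel_prob :: (topological_space) topological_space
begin

definition open_borel_prob :: "'a borel_prob set \<Rightarrow> bool" where
  "open_borel_prob = generate_topology
     {{\<nu>. (\<integral>x. f x \<partial>meas_of \<nu>) \<in> V} | (f :: 'a \<Rightarrow> real) V.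
       continuous_on UNIV f \<and> bounded (range f) \<and> open V}"

instance
proof
  show "open (UNIV :: 'a borel_prob set)"
    unfolding open_borel_prob_def by (rule generate_topology.UNIV)
  show "open (S \<inter> T)" if "open S" "open T" for S T :: "'a borel_prob set"
    using that unfolding open_borel_prob_def by (rule generate_topology.Int)
  show "open (\<Union>K)" if "\<forall>S\<in>K. open S" for K :: "'a borel_prob set set"
    using that unfolding open_borel_prob_def by (intro generate_topology.UN) auto
qed

end

definition relative_entropy ::
    "('a :: topological_space) borel_prob \<Rightarrow> 'a borel_prob \<Rightarrow> ereal" where
  "relative_entropy \<nu> \<mu> =
     (SUP \<phi> \<in> {\<phi> :: 'a \<Rightarrow> real. \<phi> \<in> borel_measurable borel \<and> bounded (range \<phi>)}.
        ereal ((\<integral>x. \<phi> x \<partial>meas_of \<nu>) - ln (\<integral>x. exp (\<phi> x) \<partial>meas_of \<mu>)))"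

lemma prob_space_meas_of: "prob_space (meas_of \<nu>)"
  using meas_of[of \<nu>] by simp

lemma sets_meas_of: "sets (meas_of \<nu>) = sets borel"
  using meas_of[of \<nu>] by simp

text \<open>Hence \<open>e2ennreal (relative_entropy \<nu> \<mu>)\<close> truncates nothing.\<close>

lemma relative_entropy_nonneg: "0 \<le> relative_entropy \<nu> \<mu>"
  unfolding relative_entropy_def
  by (rule SUP_upper2[of "\<lambda>_. 0"]) (simp_all add: prob_space.prob_space prob_space_meas_of)

text \<open>Rates take values in \<open>[0, +\<infinity>]\<close>, that is, in \<^typ>\<open>ennreal\<close>.\<close>

definition lower_semicontinuous :: "('z :: topological_space \<Rightarrow> ennreal) \<Rightarrow> bool" where
  "lower_semicontinuous F \<longleftrightarrow> (\<forall>c. open {z. c < F z})"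

definition coercive :: "('z :: topological_space \<Rightarrow> ennreal) \<Rightarrow> bool" where
  "coercive F \<longleftrightarrow> (\<forall>l::real. 0 \<le> l \<longrightarrow> compact (closure {z. F z \<le> ennreal l}))"

text \<open>The logarithm with \<open>log 0 = -\<infinity>\<close>; the library's \<^const>\<open>ln\<close> has \<open>ln 0 = 0\<close>.\<close>

definition ext_ln :: "real \<Rightarrow> ereal" where
  "ext_ln p = (if p \<le> 0 then -\<infinity> else ereal (ln p))"

definition large_deviations ::
    "(nat \<Rightarrow> ('z :: topological_space) measure) \<Rightarrow> (nat \<Rightarrow> real) \<Rightarrow> ('z \<Rightarrow> ennreal) \<Rightarrow> bool" where
  "large_deviations Q b F \<longleftrightarrow>
     (\<forall>n. prob_space (Q n) \<and> sets (Q n) = sets borel) \<and>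
     lower_semicontinuous F \<and>
     (\<forall>U. open U \<longrightarrow>
        - enn2ereal (INF z\<in>U. F z) \<le> liminf (\<lambda>n. ereal (1 / b n) * ext_ln (measure (Q n) U))) \<and>
     (\<forall>C. closed C \<longrightarrow>
        limsup (\<lambda>n. ereal (1 / b n) * ext_ln (measure (Q n) C)) \<le> - enn2ereal (INF z\<in>C. F z))"

text \<open>For \<open>n = 0\<close> the measure below is zero and \<open>empirical 0\<close> is an unspecified constant, so
  \<open>empirical_law 0\<close> is an unspecified Dirac mass, which does not affect limits in \<open>n\<close>.\<close>

definition empirical :: "nat \<Rightarrow> (nat \<Rightarrow> 'a :: topological_space) \<Rightarrow> 'a borel_prob" where
  "empirical n x = prob_of (measure_of UNIV (sets borel)
     (\<lambda>A. ennreal (1 / real n) * (\<Sum>i=1..n. emeasure (return borel (x i)) A)))"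

definition empirical_law :: "nat \<Rightarrow> ('a :: topological_space) borel_prob \<Rightarrow> 'a borel_prob measure" where
  "empirical_law n \<mu> = distr (\<Pi>\<^sub>M i\<in>{1..n}. meas_of \<mu>) borel (empirical n)"

lemma emeasure_empirical:
  assumes "n \<ge> 1" and "A \<in> sets borel"
  shows "emeasure (meas_of (empirical n x)) A
    = ennreal (1 / real n) * (\<Sum>i=1..n. emeasure (return borel (x i)) A)"
proof -
  define \<pi> where "\<pi> = (\<lambda>A. ennreal (1 / real n) * (\<Sum>i=1..n. emeasure (return borel (x i)) A))"
  define M where "M = measure_of UNIV (sets borel) \<pi>"
  have sets_M: "sets M = sets borel"
    unfolding M_def using sets.sigma_sets_eq[of borel] by (simp add: sets_measure_of_conv)
  have em: "emeasure M A = \<pi> A" if "A \<in> sets borel" for A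
  proof (rule emeasure_measure_of[OF M_def])
    show "positive (sets M) \<pi>" by (simp add: positive_def \<pi>_def)
    show "countably_additive (sets M) \<pi>"
    proof (rule countably_additiveI)
      fix B :: "nat \<Rightarrow> 'a set"
      assume B: "range B \<subseteq> sets M" "disjoint_family B" "\<Union>(range B) \<in> sets M"
      have "(\<Sum>k. \<pi> (B k)) = ennreal (1 / real n) *
          (\<Sum>i=1..n. \<Sum>k. emeasure (return borel (x i)) (B k))"
        by (simp add: \<pi>_def suminf_sum)
      also have "\<dots> = \<pi> (\<Union>(range B))"
      proof -
        have "(\<Sum>k. emeasure (return borel (x i)) (B k)) = emeasure (return borel (x i)) (\<Union>(range B))" for i
          by (rule suminf_emeasure) (use B sets_M in auto)
        then show ?thesis unfolding \<pi>_def by (simp only:)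
      qed
      finally show "(\<Sum>k. \<pi> (B k)) = \<pi> (\<Union>(range B))" .
    qed
  qed (use that sets_M in auto)
  have "\<pi> UNIV = ennreal (1 / real n) * ennreal (real n)"
    by (simp add: \<pi>_def ennreal_of_nat_eq_real_of_nat)
  also have "\<dots> = 1"
    using assms(1) by (simp flip: ennreal_mult)
  finally have "emeasure M (space M) = 1"
    using em[of UNIV] sets_eq_imp_space_eq[OF sets_M] by simp
  then have "prob_space M" by (rule prob_spaceI)
  then have "meas_of (empirical n x) = M"
    unfolding empirical_def M_def[unfolded \<pi>_def, symmetric]
    using sets_M by (simp add: prob_of_inverse)
  then show ?thesis using em[OF assms(2)] by (simp add: \<pi>_def)
qed

end

theory Submission
  imports Defs
begin

text \<open>The upper bounds rest on the exponential Chebyshev inequality: if \<open>\<nu>(g) \<ge> c\<close> on a set \<open>A\<close> of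
measures, the independence of the samples gives \<open>P\<^sub>n(A) \<le> (e\<^sup>-\<^sup>c \<mu>\<^sub>n(e\<^sup>g))\<^sup>n\<close>
(\<open>empirical_law_chernoff\<close>). A measure \<open>\<nu>\<close> whose rate exceeds \<open>c\<close> is detected by a bounded
continuous \<open>f\<close>, so the inequality bounds the probability of a neighbourhood of \<open>\<nu>\<close>. For Sanov's
theorem \<open>f\<close> comes from the variational formula of the relative entropy, in which continuous
functions suffice (\<open>relative_entropy_bcont\<close>). For the rate \<open>\<nu>(I)\<close> it is a continuous minorant of
\<open>I\<close>, applied with the factor \<open>a\<^sub>n\<close>; that \<open>\<mu>\<^sub>n(exp (a\<^sub>n f))\<close> grows at most
subexponentially in \<open>a\<^sub>n\<close> when \<open>f \<le> I\<close> is Varadhan's upper estimate (\<open>varadhan_upper\<close>). Local bounds become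
bounds on closed sets by compactness, once the laws are exponentially tight
(\<open>large_deviationsI\<close>, \<open>empirical_law_exponentially_tight\<close>). The compact sets of measures are those
of Prokhorov's theorem, which also gives the coercivity of \<open>\<nu> \<mapsto> \<nu>(I)\<close>. Its proof here
(\<open>compact_tight\<close>) takes a setwise limit along a filter, which is only finitely additive, and
extends its restriction to the sets with negligible boundary, where tightness makes it
countably additive.

The lower bound in Sanov's theorem cannot change \<open>\<mu>\<^sub>n\<close> into the target \<open>\<nu>\<close>, because \<open>\<nu>\<close> need not
have a density with respect to \<open>\<mu>\<^sub>n\<close>. But \<open>\<nu>\<close> can be replaced by a measure
\<open>e\<^sup>f \<mu> / \<mu>(e\<^sup>f)\<close> with \<open>f\<close> bounded and continuous that is narrowly close to it and has no larger
entropy (\<open>entropy_tilt_approx\<close>): \<open>f\<close> is a near optimiser of the variational formula, scaled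
optimally. The measures \<open>e\<^sup>f \<mu>\<^sub>n / \<mu>\<^sub>n(e\<^sup>f)\<close> converge to it, and the weak law of large numbers
holds for such arrays (\<open>empirical_law_weak_law\<close>).

For the second lower bound, the weak law and Markov's inequality yield finitely many points
whose empirical measure is close to \<open>\<nu>\<close> and whose average of \<open>I\<close> is hardly larger than
\<open>\<nu>(I)\<close> (\<open>sample_with_small_cost\<close>). Forcing the samples to follow these points cyclically costs
the corresponding product of probabilities of small neighbourhoods, each governed by the large
deviations of \<open>\<mu>\<^sub>n\<close> (\<open>empirical_lower\<close>).\<close>

section \<open>Integrals against Borel probability measures\<close>

definition bcont :: "('a :: topological_space \<Rightarrow> real) \<Rightarrow> bool" where
  "bcont f \<longleftrightarrow> continuous_on UNIV f \<and> bounded (range f)"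

abbreviation expect :: "('a :: topological_space) borel_prob \<Rightarrow> ('a \<Rightarrow> real) \<Rightarrow> real" where
  "expect \<nu> f \<equiv> integral\<^sup>L (meas_of \<nu>) f"

lemma bounded_rangeE:
  fixes f :: "'a \<Rightarrow> real"
  assumes "bounded (range f)"
  obtains M where "0 < M" "\<And>x. \<bar>f x\<bar> \<le> M"
  using assms unfolding bounded_pos by auto

lemma bounded_rangeI:
  fixes f :: "'a \<Rightarrow> real"
  assumes "\<And>x. \<bar>f x\<bar> \<le> M"
  shows "bounded (range f)"
  using assms by (auto simp: bounded_iff)

lemma bcontE:
  assumes "bcont f"
  obtains M where "0 < M" "\<And>x. \<bar>f x\<bar> \<le> M"
  using assms bounded_rangeE unfolding bcont_def by metis

lemma bcont_borel: "bcont f \<Longrightarrow> f \<in> borel_measurable borel"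
  unfolding bcont_def by (auto intro: borel_measurable_continuous_onI)

lemma bcont_const [simp]: "bcont (\<lambda>_. c)"
  by (simp add: bcont_def)

lemma bcont_scale: "bcont f \<Longrightarrow> bcont (\<lambda>x. c * f x)"
  unfolding bcont_def by (auto intro!: continuous_intros simp: bounded_iff abs_mult)
    (metis abs_ge_zero mult_left_mono)

lemma bcont_add: "bcont f \<Longrightarrow> bcont g \<Longrightarrow> bcont (\<lambda>x. f x + g x)"
  unfolding bcont_def by (auto intro!: continuous_intros bounded_plus_comp)

lemma bcont_mult: "bcont f \<Longrightarrow> bcont g \<Longrightarrow> bcont (\<lambda>x. f x * g x)"
proof -
  assume f: "bcont f" and g: "bcont g"
  obtain M N where "\<And>x. \<bar>f x\<bar> \<le> M" "\<And>x. \<bar>g x\<bar> \<le> N" using bcontE f g by metis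
  then have "\<bar>f x * g x\<bar> \<le> M * N" for x
    unfolding abs_mult using order_trans[OF abs_ge_zero] by (intro mult_mono) auto
  then show ?thesis using f g unfolding bcont_def by (auto intro!: continuous_intros bounded_rangeI)
qed

lemma bcont_exp: "bcont f \<Longrightarrow> bcont (\<lambda>x. exp (f x))"
proof -
  assume f: "bcont f"
  obtain M where "\<And>x. \<bar>f x\<bar> \<le> M" using bcontE f by metis
  then have "\<bar>exp (f x)\<bar> \<le> exp M" for x
    by (simp add: abs_le_D1)
  then show ?thesis
    using f unfolding bcont_def by (auto intro!: continuous_intros bounded_rangeI[of _ "exp M"])
qed

lemma space_meas_of [simp]: "space (meas_of \<nu>) = UNIV"
  using sets_eq_imp_space_eq[OF sets_meas_of[of \<nu>]] by simp

declare sets_meas_of [simp, measurable_cong]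

lemma measurable_meas_of [simp]: "measurable (meas_of \<nu>) N = measurable borel N"
  by (rule measurable_cong_sets) auto

interpretation meas_of: prob_space "meas_of \<nu>" for \<nu> :: "'a :: topological_space borel_prob"
  by (rule prob_space_meas_of)

lemma integrable_meas_of:
  fixes f :: "'a :: topological_space \<Rightarrow> real"
  assumes "f \<in> borel_measurable borel" "bounded (range f)"
  shows "integrable (meas_of \<nu>) f"
proof -
  obtain M where "\<And>x. \<bar>f x\<bar> \<le> M" using bounded_rangeE assms(2) by metis
  then show ?thesis using assms(1) by (intro meas_of.integrable_const_bound[where B = M]) auto
qed

lemma bcont_integrable [simp, intro]: "bcont f \<Longrightarrow> integrable (meas_of \<nu>) f"
  using integrable_meas_of bcont_borel unfolding bcont_def by metis

lemma measure_meas_of_UNIV [simp]: "measure (meas_of \<nu>) UNIV = 1"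
  using meas_of.prob_space[of \<nu>] by simp

lemma expect_mono_le:
  assumes "integrable (meas_of \<nu>) f" "\<And>x. f x \<le> c"
  shows "expect \<nu> f \<le> c"
  using integral_mono[of "meas_of \<nu>" f "\<lambda>_. c"] assms by simp

lemma expect_mono_ge:
  assumes "integrable (meas_of \<nu>) f" "\<And>x. c \<le> f x"
  shows "c \<le> expect \<nu> f"
  using integral_mono[of "meas_of \<nu>" "\<lambda>_. c" f] assms by simp

section \<open>The narrow topology\<close>

lemma open_expect_vimage:
  assumes "bcont f" "open V"
  shows "open {\<nu>. expect \<nu> f \<in> V}"
  unfolding open_borel_prob_def using assms
  by (intro generate_topology.Basis) (auto simp: bcont_def)

lemma open_expect_less: "bcont f \<Longrightarrow> open {\<nu>. expect \<nu> f < c}"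
  using open_expect_vimage[of f "{..<c}"] by simp

lemma open_expect_greater: "bcont f \<Longrightarrow> open {\<nu>. c < expect \<nu> f}"
  using open_expect_vimage[of f "{c<..}"] by simp

lemma closed_expect_ge: "bcont f \<Longrightarrow> closed {\<nu>. c \<le> expect \<nu> f}"
  using open_expect_less[of f c] by (simp add: closed_def Collect_neg_eq[symmetric] not_le)

text \<open>The subbasic sets involve one function each and arbitrary open sets of values; finitely many
functions and a common tolerance suffice because open sets of reals contain intervals.\<close>

lemma narrow_nbhd_basis:
  fixes \<nu> :: "'a :: topological_space borel_prob"
  assumes "open W" "\<nu> \<in> W"
  obtains F \<epsilon> where "finite F" "\<And>f. f \<in> F \<Longrightarrow> bcont f" "0 < \<epsilon>"
    "\<And>\<nu>'. (\<And>f. f \<in> F \<Longrightarrow> \<bar>expect \<nu>' f - expect \<nu> f\<bar> < \<epsilon>) \<Longrightarrow> \<nu>' \<in> W"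
proof -
  have "\<exists>F \<epsilon>. finite F \<and> (\<forall>f\<in>F. bcont f) \<and> 0 < \<epsilon> \<and>
      (\<forall>\<nu>'. (\<forall>f\<in>F. \<bar>expect \<nu>' f - expect \<nu> f\<bar> < \<epsilon>) \<longrightarrow> \<nu>' \<in> W)"
    using assms unfolding open_borel_prob_def
  proof (induction rule: generate_topology.induct)
    case UNIV
    then show ?case by (intro exI[of _ "{}"] exI[of _ 1]) auto
  next
    case (Int A B)
    then have "\<nu> \<in> A" "\<nu> \<in> B" by auto
    obtain F \<epsilon> where "finite F" "\<forall>f\<in>F. bcont f" "0 < \<epsilon>"
      "\<forall>\<nu>'. (\<forall>f\<in>F. \<bar>expect \<nu>' f - expect \<nu> f\<bar> < \<epsilon>) \<longrightarrow> \<nu>' \<in> A"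
      using Int.IH(1)[OF \<open>\<nu> \<in> A\<close>] by blast
    moreover obtain G \<delta> where "finite G" "\<forall>f\<in>G. bcont f" "0 < \<delta>"
      "\<forall>\<nu>'. (\<forall>f\<in>G. \<bar>expect \<nu>' f - expect \<nu> f\<bar> < \<delta>) \<longrightarrow> \<nu>' \<in> B"
      using Int.IH(2)[OF \<open>\<nu> \<in> B\<close>] by blast
    ultimately
    show ?case by (intro exI[of _ "F \<union> G"] exI[of _ "min \<epsilon> \<delta>"]) auto
  next
    case (UN K)
    then obtain S where S: "S \<in> K" "\<nu> \<in> S" by auto
    then show ?case using UN.IH[OF S] by (meson UnionI)
  next
    case (Basis S)
    then obtain f V where S: "S = {\<nu>. expect \<nu> f \<in> V}" "continuous_on UNIV f" "bounded (range f)" "open V"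
      by auto
    then obtain e where "e > 0" "\<And>y. \<bar>y - expect \<nu> f\<bar> < e \<Longrightarrow> y \<in> V"
      using Basis(2) unfolding open_dist dist_real_def by auto
    then show ?case using S by (intro exI[of _ "{f}"] exI[of _ e]) (auto simp: bcont_def)
  qed
  then obtain F \<epsilon> where *: "finite F" "\<forall>f\<in>F. bcont f" "0 < \<epsilon>"
    "\<forall>\<nu>'. (\<forall>f\<in>F. \<bar>expect \<nu>' f - expect \<nu> f\<bar> < \<epsilon>) \<longrightarrow> \<nu>' \<in> W" by (elim exE conjE)
  show ?thesis by (rule that[of F \<epsilon>]) (simp_all add: *)
qed

lemma tendsto_narrow_iff:
  fixes \<nu> :: "'a :: topological_space borel_prob"
  shows "(X \<longlongrightarrow> \<nu>) G \<longleftrightarrow> (\<forall>f. bcont f \<longrightarrow> ((\<lambda>n. expect (X n) f) \<longlongrightarrow> expect \<nu> f) G)"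
proof safe
  fix f :: "'a \<Rightarrow> real" assume X: "(X \<longlongrightarrow> \<nu>) G" and f: "bcont f"
  show "((\<lambda>n. expect (X n) f) \<longlongrightarrow> expect \<nu> f) G"
  proof (rule topological_tendstoI)
    fix V :: "real set" assume "open V" "expect \<nu> f \<in> V"
    then show "\<forall>\<^sub>F n in G. expect (X n) f \<in> V"
      using topological_tendstoD[OF X open_expect_vimage[OF f \<open>open V\<close>]] by simp
  qed
next
  assume *: "\<forall>f. bcont f \<longrightarrow> ((\<lambda>n. expect (X n) f) \<longlongrightarrow> expect \<nu> f) G"
  show "(X \<longlongrightarrow> \<nu>) G"
  proof (rule topological_tendstoI)
    fix W assume "open W" "\<nu> \<in> W"
    then obtain F \<epsilon> where F: "finite F" "\<And>f. f \<in> F \<Longrightarrow> bcont f" "0 < \<epsilon>"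
      and W: "\<And>\<nu>'. (\<And>f. f \<in> F \<Longrightarrow> \<bar>expect \<nu>' f - expect \<nu> f\<bar> < \<epsilon>) \<Longrightarrow> \<nu>' \<in> W"
      by (rule narrow_nbhd_basis) blast
    have "\<forall>\<^sub>F n in G. \<bar>expect (X n) f - expect \<nu> f\<bar> < \<epsilon>" if "f \<in> F" for f
      using tendstoD[OF *[rule_format, OF F(2)[OF that]] F(3)] by (simp add: dist_real_def)
    then have "\<forall>\<^sub>F n in G. \<forall>f\<in>F. \<bar>expect (X n) f - expect \<nu> f\<bar> < \<epsilon>"
      using F(1) by (simp add: eventually_ball_finite)
    then show "\<forall>\<^sub>F n in G. X n \<in> W" by (rule eventually_mono) (use W in auto)
  qed
qed

text \<open>The approximants are the Lipschitz regularisations \<open>g\<^sub>k(x) = inf\<^sub>y (min(I(y), k) + k d(x, y))\<close>.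
They are \<open>k\<close>-Lipschitz as infima of such functions, and lower semicontinuity makes them reach \<open>I\<close>.\<close>

lemma lower_semicontinuous_approx:
  fixes I :: "'a :: metric_space \<Rightarrow> ennreal"
  assumes "lower_semicontinuous I"
  obtains g :: "nat \<Rightarrow> 'a \<Rightarrow> real" where "\<And>k. bcont (g k)" "\<And>k x. 0 \<le> g k x"
    "\<And>x. incseq (\<lambda>k. g k x)" "\<And>x. (SUP k. ennreal (g k x)) = I x"
proof -
  define J where "J k y = enn2real (min (I y) (of_nat k))" for k y
  have J0: "0 \<le> J k y" "J k y \<le> real k" for k y
  proof -
    show "0 \<le> J k y" by (simp add: J_def)
    have "ennreal (J k y) = min (I y) (of_nat k)"
      unfolding J_def by (rule ennreal_enn2real) (simp add: min_less_iff_disj of_nat_less_top)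
    then have "ennreal (J k y) \<le> ennreal (real k)" by (simp add: ennreal_of_nat_eq_real_of_nat)
    then show "J k y \<le> real k" by (simp add: ennreal_le_iff)
  qed
  have eJ: "ennreal (J k y) = min (I y) (of_nat k)" for k y
    unfolding J_def by (rule ennreal_enn2real) (simp add: min_less_iff_disj of_nat_less_top)
  define g where "g k x = (INF y. J k y + real k * dist x y)" for k x
  have bdd: "bdd_below (range (\<lambda>y. J k y + real k * dist x y))" for k x
    by (intro bdd_belowI2[of _ 0]) (simp add: J0)
  have g_le: "g k x \<le> J k y + real k * dist x y" for k x y
    unfolding g_def by (rule cINF_lower[OF bdd]) simp
  have g_leJ: "g k x \<le> J k x" for k x using g_le[of k x x] by simp
  have g0: "0 \<le> g k x" for k x
    unfolding g_def by (rule cINF_greatest) (simp_all add: J0)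
  have Lip: "g k x \<le> g k x' + real k * dist x x'" for k x x'
  proof -
    have "g k x - real k * dist x x' \<le> J k y + real k * dist x' y" for y
    proof -
      have "real k * dist x y \<le> real k * (dist x x' + dist x' y)"
        by (intro mult_left_mono dist_triangle) simp
      then show ?thesis using g_le[of k x y] by (simp add: algebra_simps)
    qed
    then have "g k x - real k * dist x x' \<le> g k x'"
      unfolding g_def[of k x'] by (intro cINF_greatest) auto
    then show ?thesis by simp
  qed
  have "(real k)-lipschitz_on UNIV (g k)" for k
  proof (rule lipschitz_onI)
    show "dist (g k x) (g k y) \<le> real k * dist x y" for x y
      using Lip[of k x y] Lip[of k y x] by (simp add: dist_real_def dist_commute abs_le_iff)
  qed simp
  then have cont: "continuous_on UNIV (g k)" for k by (rule lipschitz_on_continuous_on)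
  have "\<bar>g k x\<bar> \<le> real k" for k x
    using g0[of k x] g_leJ[of k x] J0(2)[of k x] by simp
  then have b: "bcont (g k)" for k
    unfolding bcont_def by (intro conjI cont bounded_rangeI)
  have inc: "incseq (\<lambda>k. g k x)" for x
  proof (rule incseq_SucI)
    fix k
    have "g k x \<le> J (Suc k) y + real (Suc k) * dist x y" for y
    proof -
      have "ennreal (J k y) \<le> ennreal (J (Suc k) y)"
        unfolding eJ by (intro min.mono) (auto simp: ennreal_of_nat_eq_real_of_nat intro!: ennreal_leI)
      then have "J k y \<le> J (Suc k) y" by (simp add: ennreal_le_iff J0)
      moreover have "real k * dist x y \<le> real (Suc k) * dist x y"
        by (intro mult_right_mono) auto
      ultimately show ?thesis using g_le[of k x y] by linarith
    qed
    then show "g k x \<le> g (Suc k) x" unfolding g_def[of "Suc k"] by (intro cINF_greatest) auto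
  qed
  have "(SUP k. ennreal (g k x)) = I x" for x
  proof (rule antisym)
    show "(SUP k. ennreal (g k x)) \<le> I x"
    proof (rule SUP_least)
      fix k
      have "ennreal (g k x) \<le> ennreal (J k x)" by (intro ennreal_leI g_leJ)
      then show "ennreal (g k x) \<le> I x" by (simp add: eJ)
    qed
    show "I x \<le> (SUP k. ennreal (g k x))"
    proof (rule dense_le)
      fix c assume "c < I x"
      \<comment> \<open>Near \<open>x\<close> the function \<open>I\<close> exceeds \<open>c\<close>; away from \<open>x\<close> the penalty \<open>k * dist x y\<close> does.\<close>
      then obtain r where r: "r > 0" "\<And>y. dist y x < r \<Longrightarrow> c < I y"
        using assms unfolding lower_semicontinuous_def open_dist by blast
      define c' where "c' = enn2real c"
      have c': "ennreal c' = c" "0 \<le> c'"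
        using \<open>c < I x\<close> unfolding c'_def by (auto intro!: ennreal_enn2real simp: less_top[symmetric])
      obtain k :: nat where k: "real k > c' / r" "real k > c'"
        using reals_Archimedean2[of "max (c' / r) c'"] by auto
      have "c' \<le> J k y + real k * dist x y" for y
      proof (cases "dist y x < r")
        case True
        have "ennreal c' \<le> I y" using r(2)[OF True] c'(1) by simp
        moreover have "ennreal c' \<le> of_nat k"
          using k(2) by (simp add: ennreal_of_nat_eq_real_of_nat ennreal_leI)
        ultimately have "ennreal c' \<le> ennreal (J k y)" unfolding eJ by simp
        then have "c' \<le> J k y" by (simp add: ennreal_le_iff J0)
        then show ?thesis by (simp add: add_increasing2)
      next
        case False
        have "c' \<le> real k * r" using k(1) r(1) by (simp add: field_simps)
        also have "\<dots> \<le> real k * dist x y" using False by (intro mult_left_mono) (auto simp: dist_commute)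
        finally show ?thesis using J0(1)[of k y] by simp
      qed
      then have "c' \<le> g k x" unfolding g_def by (intro cINF_greatest) auto
      then have "c \<le> ennreal (g k x)" using c' ennreal_leI by metis
      then show "c \<le> (SUP k. ennreal (g k x))" by (rule SUP_upper2[rotated]) simp
    qed
  qed
  then show ?thesis using that b g0 inc by blast
qed

lemma nn_integral_approx:
  assumes "\<And>k. bcont (g k)" "\<And>k x. 0 \<le> g k x" "\<And>x. incseq (\<lambda>k. g k x)"
    "\<And>x. (SUP k. ennreal (g k x)) = I x"
  shows "(\<integral>\<^sup>+ x. I x \<partial>meas_of \<nu>) = (SUP k. ennreal (expect \<nu> (g k)))"
proof -
  have "(\<integral>\<^sup>+ x. I x \<partial>meas_of \<nu>) = (\<integral>\<^sup>+ x. (SUP k. ennreal (g k x)) \<partial>meas_of \<nu>)"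
    by (simp add: assms(4))
  also have "\<dots> = (SUP k. \<integral>\<^sup>+ x. ennreal (g k x) \<partial>meas_of \<nu>)"
  proof (rule nn_integral_monotone_convergence_SUP)
    show "incseq (\<lambda>k x. ennreal (g k x))"
      using assms(3) by (simp add: incseq_def le_fun_def ennreal_leI)
    show "(\<lambda>x. ennreal (g k x)) \<in> borel_measurable (meas_of \<nu>)" for k
      using bcont_borel[OF assms(1)[of k]] by simp
  qed
  also have "\<dots> = (SUP k. ennreal (expect \<nu> (g k)))"
    using assms(1,2) by (intro SUP_cong refl nn_integral_eq_integral) auto
  finally show ?thesis .
qed

lemma lower_semicontinuous_borel:
  assumes "lower_semicontinuous I"
  shows "I \<in> borel_measurable borel"
  using assms unfolding lower_semicontinuous_def
  by (intro borel_measurableI_greater) auto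

lemma lower_semicontinuous_nn_integral:
  fixes I :: "'a :: metric_space \<Rightarrow> ennreal"
  assumes "lower_semicontinuous I"
  shows "lower_semicontinuous (\<lambda>\<nu>. \<integral>\<^sup>+ x. I x \<partial>meas_of \<nu>)"
  unfolding lower_semicontinuous_def
proof
  fix c
  obtain g where g: "\<And>k :: nat. bcont (g k)" "\<And>k x. 0 \<le> g k x" "\<And>x. incseq (\<lambda>k. g k x)"
    "\<And>x. (SUP k. ennreal (g k x)) = I x"
    using lower_semicontinuous_approx[OF assms] by metis
  have eq: "{\<nu>. c < (\<integral>\<^sup>+ x. I x \<partial>meas_of \<nu>)} = (\<Union>k. {\<nu>. expect \<nu> (g k) \<in> {y. c < ennreal y}})"
    by (auto simp: nn_integral_approx[OF g] less_SUP_iff)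
  have "open {y :: real. c < ennreal y}"
    by (intro open_Collect_less continuous_intros) (auto intro!: continuous_on_ennreal continuous_intros)
  then show "open {\<nu>. c < (\<integral>\<^sup>+ x. I x \<partial>meas_of \<nu>)}"
    unfolding eq by (intro open_UN ballI open_expect_vimage g)
qed

text \<open>One half of the portmanteau theorem: the indicator of an open set is lower semicontinuous.\<close>

lemma open_measure_gt:
  fixes U :: "'a :: metric_space set"
  assumes "open U"
  shows "open {\<nu>. c < measure (meas_of \<nu>) U}"
proof (cases "c \<ge> 0")
  case True
  have "{x. d < (indicator U x :: ennreal)} = (if d < 1 then (if d < 0 then UNIV else U) else {})" for d
    by (auto simp: indicator_def split: if_splits)
  then have "lower_semicontinuous (\<lambda>x. indicator U x :: ennreal)"
    using assms unfolding lower_semicontinuous_def by simp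
  then have "open {\<nu>. ennreal c < (\<integral>\<^sup>+ x. indicator U x \<partial>meas_of \<nu>)}"
    using lower_semicontinuous_nn_integral unfolding lower_semicontinuous_def by blast
  moreover have "ennreal c < (\<integral>\<^sup>+ x. indicator U x \<partial>meas_of \<nu>) \<longleftrightarrow> c < measure (meas_of \<nu>) U" for \<nu>
    using assms True by (simp add: meas_of.emeasure_eq_measure ennreal_less_iff)
  ultimately show ?thesis by simp
next
  case False
  then have "{\<nu>. c < measure (meas_of \<nu>) U} = UNIV"
    by (auto intro: less_le_trans[OF _ measure_nonneg])
  then show ?thesis by simp
qed



section \<open>Prokhorov's theorem\<close>

text \<open>By Tychonoff's theorem any filter on measures has a finer one along which the masses of all
Borel sets converge. The limit \<open>m\<close> need not be countably additive, nor equal on every set to the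
narrow limit: Dirac masses that converge to a point which they avoid lose the mass of that point.\<close>

locale setwise_limit =
  fixes G :: "'a :: polish_space borel_prob filter" and m :: "'a set \<Rightarrow> real"
  assumes G: "G \<noteq> bot"
    and lim: "\<And>A. A \<in> sets borel \<Longrightarrow> ((\<lambda>\<nu>. measure (meas_of \<nu>) A) \<longlongrightarrow> m A) G"
    and tight: "\<And>\<epsilon>. 0 < \<epsilon> \<Longrightarrow> \<exists>K. compact K \<and> (\<forall>\<^sub>F \<nu> in G. measure (meas_of \<nu>) (- K) \<le> \<epsilon>)"
begin

lemma m_nonneg: "A \<in> sets borel \<Longrightarrow> 0 \<le> m A"
  by (rule tendsto_lowerbound[OF lim _ G]) auto

lemma m_UNIV: "m UNIV = 1"
  using lim[of UNIV] G by (simp add: tendsto_const_iff)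

lemma m_Un:
  assumes "A \<in> sets borel" "B \<in> sets borel" "A \<inter> B = {}"
  shows "m (A \<union> B) = m A + m B"
proof (rule tendsto_unique[OF G lim])
  have "measure (meas_of \<nu>) (A \<union> B) = measure (meas_of \<nu>) A + measure (meas_of \<nu>) B" for \<nu>
    using assms by (intro meas_of.finite_measure_Union) auto
  then show "((\<lambda>\<nu>. measure (meas_of \<nu>) (A \<union> B)) \<longlongrightarrow> m A + m B) G"
    using tendsto_add[OF lim lim] assms by simp
qed (use assms in auto)

lemma m_mono:
  assumes "A \<in> sets borel" "B \<in> sets borel" "A \<subseteq> B"
  shows "m A \<le> m B"
proof -
  have "m B = m A + m (B - A)"
    using m_Un[of A "B - A"] assms by (simp add: Un_absorb1 Un_Diff_cancel)
  then show ?thesis using m_nonneg[of "B - A"] assms by simp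
qed

lemma m_subadditive:
  assumes "A \<in> sets borel" "B \<in> sets borel"
  shows "m (A \<union> B) \<le> m A + m B"
  using m_Un[of A "B - A"] m_mono[of "B - A" B] assms by simp

lemma m_empty: "m {} = 0"
  using m_Un[of "{}" "{}"] by simp

lemma m_finite_subadditive:
  assumes "finite J" "\<And>i. i \<in> J \<Longrightarrow> A i \<in> sets borel"
  shows "m (\<Union>i\<in>J. A i) \<le> (\<Sum>i\<in>J. m (A i))"
  using assms
proof (induction J)
  case (insert j J)
  have "m (A j \<union> (\<Union>i\<in>J. A i)) \<le> m (A j) + m (\<Union>i\<in>J. A i)"
    using insert by (intro m_subadditive) auto
  then show ?case using insert by force
qed (simp add: m_empty)

text \<open>The sets whose boundary is negligible in a sense that also makes sense for the finitely additive
\<open>m\<close>. On them setwise and narrow limits agree.\<close>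

definition continuity_sets :: "'a set set" where
  "continuity_sets = {A \<in> sets borel.
     \<forall>\<epsilon>>0. \<exists>C U. closed C \<and> open U \<and> C \<subseteq> A \<and> A \<subseteq> U \<and> m (U - C) < \<epsilon>}"

lemma continuity_sets_borel: "A \<in> continuity_sets \<Longrightarrow> A \<in> sets borel"
  by (simp add: continuity_sets_def)

lemma algebra_continuity_sets: "algebra UNIV continuity_sets"
  unfolding algebra_iff_Un
proof (intro conjI ballI)
  show "{} \<in> continuity_sets"
    by (auto simp: continuity_sets_def m_empty intro!: exI[of _ "{}"])
next
  fix A assume A: "A \<in> continuity_sets"
  show "UNIV - A \<in> continuity_sets"
    unfolding continuity_sets_def
  proof (intro CollectI conjI allI impI)
    show "UNIV - A \<in> sets borel" using A continuity_sets_borel by auto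
    fix \<epsilon> :: real assume "\<epsilon> > 0"
    then obtain C U where "closed C" "open U" "C \<subseteq> A" "A \<subseteq> U" "m (U - C) < \<epsilon>"
      using A unfolding continuity_sets_def by blast
    moreover have "- C - - U = U - C" by auto
    ultimately show "\<exists>C U. closed C \<and> open U \<and> C \<subseteq> UNIV - A \<and> UNIV - A \<subseteq> U \<and> m (U - C) < \<epsilon>"
      by (intro exI[of _ "- U"] exI[of _ "- C"]) auto
  qed
next
  fix A B assume A: "A \<in> continuity_sets" and B: "B \<in> continuity_sets"
  show "A \<union> B \<in> continuity_sets"
    unfolding continuity_sets_def
  proof (intro CollectI conjI allI impI)
    show "A \<union> B \<in> sets borel" using A B continuity_sets_borel by auto
    fix \<epsilon> :: real assume "\<epsilon> > 0"
    then have "\<epsilon> / 2 > 0" by simp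
    obtain C U where CU: "closed C" "open U" "C \<subseteq> A" "A \<subseteq> U" "m (U - C) < \<epsilon> / 2"
      using A \<open>\<epsilon> / 2 > 0\<close> unfolding continuity_sets_def by blast
    obtain D V where DV: "closed D" "open V" "D \<subseteq> B" "B \<subseteq> V" "m (V - D) < \<epsilon> / 2"
      using B \<open>\<epsilon> / 2 > 0\<close> unfolding continuity_sets_def by blast
    have "m ((U \<union> V) - (C \<union> D)) \<le> m ((U - C) \<union> (V - D))"
      using CU DV by (intro m_mono) auto
    also have "\<dots> \<le> m (U - C) + m (V - D)" using CU DV by (intro m_subadditive) auto
    also have "\<dots> < \<epsilon>" using CU DV by simp
    finally show "\<exists>C U. closed C \<and> open U \<and> C \<subseteq> A \<union> B \<and> A \<union> B \<subseteq> U \<and> m (U - C) < \<epsilon>"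
      using CU DV by (intro exI[of _ "C \<union> D"] exI[of _ "U \<union> V"]) auto
  qed
qed auto

text \<open>The monotone function \<open>c \<mapsto> m {f < c}\<close> has at most countably many discontinuities, and its continuity
points provide the thresholds.\<close>

lemma sublevel_continuity_set:
  fixes f :: "'a \<Rightarrow> real"
  assumes f: "continuous_on UNIV f" and "a < b"
  obtains c where "a < c" "c < b" "{x. f x < c} \<in> continuity_sets"
proof -
  have op: "open {x. f x < c}" and cl: "closed {x. f x \<le> c}" for c
    using f by (auto intro!: open_Collect_less closed_Collect_le continuous_intros)
  define h where "h c = m {x. f x < c}" for c
  have "mono h"
    unfolding h_def by (intro monoI m_mono) (use op in auto)
  then have "countable {c. \<not> isCont h c}" by (rule mono_ctble_discont)
  then obtain c where c: "c \<in> {a<..<b}" "isCont h c"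
    using open_minus_countable[of "{c. \<not> isCont h c}" "{a<..<b}"] \<open>a < b\<close> by auto
  have "{x. f x < c} \<in> continuity_sets"
    unfolding continuity_sets_def
  proof (intro CollectI conjI allI impI)
    show "{x. f x < c} \<in> sets borel" using op by auto
    fix \<epsilon> :: real assume "\<epsilon> > 0"
    then obtain d where d: "d > 0" "\<And>t. \<bar>t - c\<bar> < d \<Longrightarrow> \<bar>h t - h c\<bar> < \<epsilon> / 2"
      using c(2) unfolding continuous_at_real_range by (metis half_gt_zero real_norm_def)
    have "{x. f x < c + d/2} = {x. f x < c - d/2} \<union> ({x. f x < c + d/2} - {x. f x < c - d/2})"
      using d(1) by auto
    then have "h (c + d/2) = h (c - d/2) + m ({x. f x < c + d/2} - {x. f x < c - d/2})"
      unfolding h_def using m_Un[of "{x. f x < c - d/2}" "{x. f x < c + d/2} - {x. f x < c - d/2}"] op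
      by (metis Diff_disjoint borel_open sets.Diff)
    moreover have "m ({x. f x < c + d/2} - {x. f x \<le> c - d/2}) \<le> m ({x. f x < c + d/2} - {x. f x < c - d/2})"
      using op cl by (intro m_mono) auto
    moreover have "\<bar>h (c + d/2) - h c\<bar> < \<epsilon> / 2" "\<bar>h (c - d/2) - h c\<bar> < \<epsilon> / 2"
      using d by (auto intro!: d(2))
    ultimately have "m ({x. f x < c + d/2} - {x. f x \<le> c - d/2}) < \<epsilon>" by linarith
    then show "\<exists>C U. closed C \<and> open U \<and> C \<subseteq> {x. f x < c} \<and> {x. f x < c} \<subseteq> U \<and> m (U - C) < \<epsilon>"
      using op cl d(1) by (intro exI[of _ "{x. f x \<le> c - d/2}"] exI[of _ "{x. f x < c + d/2}"]) auto
  qed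
  then show ?thesis using that c(1) by auto
qed

text \<open>Around each point of an open set there is a ball in the algebra, a sublevel set of
the distance to the point, and countably many of these balls cover the open set.\<close>

lemma sigma_continuity_sets: "sigma_sets UNIV continuity_sets = sets borel"
proof
  show "sigma_sets UNIV continuity_sets \<subseteq> sets borel"
    using sets.sigma_sets_subset[of continuity_sets borel] continuity_sets_borel by auto
  have "W \<in> sigma_sets UNIV continuity_sets" if "open W" for W
  proof -
    define F where "F = {B \<in> continuity_sets. open B \<and> B \<subseteq> W}"
    have "\<exists>B\<in>F. x \<in> B" if "x \<in> W" for x
    proof -
      obtain e where e: "e > 0" "\<And>y. dist x y < e \<Longrightarrow> y \<in> W"
        using \<open>open W\<close> \<open>x \<in> W\<close> unfolding open_dist by (metis dist_commute)
      obtain c where c: "0 < c" "c < e" "{y. dist x y < c} \<in> continuity_sets"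
      proof (rule sublevel_continuity_set[OF _ e(1)])
        show "continuous_on UNIV (dist x)" by (intro continuous_intros)
      qed
      have "open {y. dist x y < c}" by (intro open_Collect_less continuous_intros)
      then have "{y. dist x y < c} \<in> F" using c e(2) by (auto simp: F_def)
      then show ?thesis using c by (intro bexI[of _ "{y. dist x y < c}"]) auto
    qed
    then have UF: "\<Union>F = W" by (auto simp: F_def)
    obtain F' where F': "F' \<subseteq> F" "countable F'" "\<Union>F' = \<Union>F"
      using Lindelof[of F] by (auto simp: F_def)
    have "\<Union>F' \<in> sigma_sets UNIV continuity_sets"
      using F' by (intro sigma_sets_UNION) (auto simp: F_def)
    then show ?thesis using F' UF by simp
  qed
  then show "sets borel \<subseteq> sigma_sets UNIV continuity_sets"
    unfolding borel_def by (auto intro!: sigma_sets_mono simp: sets_measure_of_conv)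
qed

text \<open>Each \<open>A\<^sub>i\<close> is replaced by a closed subset of almost the same mass. Within a compact set that carries
almost all mass, closed sets with empty intersection already have finitely many with empty
intersection, so some \<open>A\<^sub>n\<close> is covered by the small remainders.\<close>

lemma m_empty_continuous:
  assumes A: "range A \<subseteq> continuity_sets" and dec: "decseq A" and "(\<Inter>i. A i) = {}"
  shows "(\<lambda>i. m (A i)) \<longlonglongrightarrow> 0"
proof (rule LIMSEQ_I)
  fix r :: real assume "0 < r"
  define \<epsilon> where "\<epsilon> = r / 4"
  have "\<epsilon> > 0" using \<open>0 < r\<close> by (simp add: \<epsilon>_def)
  obtain K where K: "compact K" "\<forall>\<^sub>F \<nu> in G. measure (meas_of \<nu>) (- K) \<le> \<epsilon>"
    using tight[OF \<open>\<epsilon> > 0\<close>] by blast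
  have Kb: "- K \<in> sets borel" using K(1) by (simp add: compact_imp_closed borel_comp)
  have mK: "m (- K) \<le> \<epsilon>" using tendsto_upperbound[OF lim[OF Kb] K(2) G] .
  have Ab: "A i \<in> sets borel" for i using A continuity_sets_borel by auto
  have "\<exists>C. closed C \<and> C \<subseteq> A i \<and> m (A i - C) < \<epsilon> * (1/2) ^ Suc i" for i
  proof -
    have "A i \<in> continuity_sets" "\<epsilon> * (1/2) ^ Suc i > 0" using A \<open>\<epsilon> > 0\<close> by auto
    then obtain C U where *: "closed C" "open U" "C \<subseteq> A i" "A i \<subseteq> U" "m (U - C) < \<epsilon> * (1/2) ^ Suc i"
      unfolding continuity_sets_def by blast
    moreover have "m (A i - C) \<le> m (U - C)" using * Ab by (intro m_mono) auto
    ultimately show ?thesis by force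
  qed
  then have "\<forall>i. \<exists>C. closed C \<and> C \<subseteq> A i \<and> m (A i - C) < \<epsilon> * (1/2) ^ Suc i" by (rule allI)
  from choice[OF this] obtain C where C: "\<And>i. closed (C i)" "\<And>i. C i \<subseteq> A i"
    "\<And>i. m (A i - C i) < \<epsilon> * (1/2) ^ Suc i" by (elim exE) blast
  have "K \<inter> (\<Inter>i\<in>UNIV. C i) = {}" using C(2) assms(3)
    by (metis INT_iff UNIV_I disjoint_iff empty_iff subsetD)
  have "\<exists>J. finite J \<and> K \<inter> (\<Inter>i\<in>J. C i) = {}"
  proof (rule ccontr)
    assume "\<not> ?thesis"
    then have *: "finite J \<Longrightarrow> K \<inter> (\<Inter>i\<in>J. C i) \<noteq> {}" for J by auto
    have "K \<inter> (\<Inter>i\<in>UNIV. C i) \<noteq> {}" by (rule compact_imp_fip_image[OF K(1) C(1)]) (rule *)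
    then show False using \<open>K \<inter> (\<Inter>i\<in>UNIV. C i) = {}\<close> by (rule notE)
  qed
  then obtain J where J: "finite J" "K \<inter> (\<Inter>i\<in>J. C i) = {}" by blast
  obtain N where N: "\<And>i. i \<in> J \<Longrightarrow> i \<le> N" using J(1) finite_nat_set_iff_bounded_le by auto
  have "m (A n) < r" if "n \<ge> N" for n
  proof -
    have "A n \<subseteq> - K \<union> (\<Union>i\<in>J. A i - C i)"
    proof
      fix x assume "x \<in> A n"
      then have "x \<in> A i" if "i \<in> J" for i
        using decseqD[OF dec, of i n] N[OF that] \<open>n \<ge> N\<close> by auto
      then show "x \<in> - K \<union> (\<Union>i\<in>J. A i - C i)" using J(2) by blast
    qed
    moreover have Jb: "(\<Union>i\<in>J. A i - C i) \<in> sets borel" using J(1) Ab C(1) by (intro sets.finite_UN) auto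
    ultimately have "m (A n) \<le> m (- K \<union> (\<Union>i\<in>J. A i - C i))"
      using Kb Ab by (intro m_mono) auto
    also have "\<dots> \<le> m (- K) + m (\<Union>i\<in>J. A i - C i)"
      using Kb Jb by (rule m_subadditive)
    also have "m (\<Union>i\<in>J. A i - C i) \<le> (\<Sum>i\<in>J. m (A i - C i))"
      using J(1) Ab C(1) by (intro m_finite_subadditive) auto
    also have "\<dots> \<le> (\<Sum>i\<in>J. \<epsilon> * (1/2) ^ Suc i)"
      by (intro sum_mono less_imp_le C(3))
    also have "\<dots> \<le> (\<Sum>i. \<epsilon> * (1/2) ^ Suc i)"
      using power_half_series \<open>\<epsilon> > 0\<close> J(1) by (intro sum_le_suminf) (auto intro!: summable_mult dest: sums_summable)
    also have "\<dots> = \<epsilon>"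
      using sums_unique[OF sums_mult[OF power_half_series, of \<epsilon>]] by simp
    finally show ?thesis using mK \<open>0 < r\<close> by (simp add: \<epsilon>_def)
  qed
  then show "\<exists>N. \<forall>n\<ge>N. norm (m (A n) - 0) < r"
    using m_nonneg[OF Ab] by (intro exI[of _ N]) auto
qed

lemma limit_measure_exists:
  obtains \<nu> where "\<And>A. A \<in> continuity_sets \<Longrightarrow> measure (meas_of \<nu>) A = m A"
proof -
  interpret algebra UNIV continuity_sets by (rule algebra_continuity_sets)
  have "\<exists>\<mu>'. (\<forall>A\<in>continuity_sets. \<mu>' A = ennreal (m A)) \<and>
      measure_space UNIV (sigma_sets UNIV continuity_sets) \<mu>'"
  proof (rule caratheodory_empty_continuous)
    show "positive continuity_sets (\<lambda>A. ennreal (m A))" by (simp add: positive_def m_empty)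
    show "additive continuity_sets (\<lambda>A. ennreal (m A))"
      by (simp add: additive_def m_Un m_nonneg continuity_sets_borel ennreal_plus[symmetric] del: ennreal_plus)
    show "(\<lambda>i. ennreal (m (A i))) \<longlonglongrightarrow> 0"
      if "range A \<subseteq> continuity_sets" "decseq A" "(\<Inter>i. A i) = {}" for A
      using tendsto_ennrealI[OF m_empty_continuous[OF that]] by simp
  qed simp
  then obtain \<mu>' where \<mu>': "\<And>A. A \<in> continuity_sets \<Longrightarrow> \<mu>' A = ennreal (m A)"
    "measure_space UNIV (sets borel) \<mu>'"
    unfolding sigma_continuity_sets by blast
  define M where "M = measure_of UNIV (sets borel) \<mu>'"
  have sM: "sets M = sets borel"
    unfolding M_def using sets.sigma_sets_eq[of borel] by (simp add: sets_measure_of_conv)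
  have eM: "emeasure M A = \<mu>' A" if "A \<in> sets borel" for A
    using \<mu>'(2) that sM unfolding measure_space_def by (intro emeasure_measure_of[OF M_def]) auto
  have "emeasure M (space M) = 1"
    using eM[of UNIV] \<mu>'(1)[OF top] sets_eq_imp_space_eq[OF sM] by (simp add: m_UNIV)
  then have "meas_of (prob_of M) = M"
    using sM by (intro prob_of_inverse) (auto intro: prob_spaceI)
  then have "measure (meas_of (prob_of M)) A = m A" if "A \<in> continuity_sets" for A
    using that eM[OF continuity_sets_borel[OF that]] \<mu>'(1)[OF that] m_nonneg[OF continuity_sets_borel[OF that]]
    by (simp add: measure_def)
  then show ?thesis using that by blast
qed

text \<open>A bounded continuous function is a uniform limit of step functions whose level sets are
continuity sets, and the integrals of the latter converge by definition of \<open>m\<close>.\<close>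

lemma limit_exists: "\<exists>\<nu>. ((\<lambda>\<nu>. \<nu>) \<longlongrightarrow> \<nu>) G"
proof -
  obtain \<nu> where \<nu>: "\<And>A. A \<in> continuity_sets \<Longrightarrow> measure (meas_of \<nu>) A = m A"
    by (rule limit_measure_exists) blast
  have "((\<lambda>\<nu>'. expect \<nu>' f) \<longlongrightarrow> expect \<nu> f) G" if f: "bcont f" for f
  proof (rule tendstoI)
    fix r :: real assume "0 < r"
    obtain M where M: "0 < M" "\<And>x. \<bar>f x\<bar> \<le> M" using bcontE f by metis
    define \<epsilon> where "\<epsilon> = r / 6"
    have "\<epsilon> > 0" using \<open>0 < r\<close> by (simp add: \<epsilon>_def)
    \<comment> \<open>Levels \<open>c i\<close>, one in each cell of a grid of mesh \<open>\<epsilon>\<close>, that start below \<open>- M\<close>.\<close>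
    define a where "a = - M - \<epsilon>"
    have "\<exists>c. a + real i * \<epsilon> < c \<and> c < a + real (Suc i) * \<epsilon> \<and> {x. f x < c} \<in> continuity_sets" for i
      by (rule sublevel_continuity_set[of f "a + real i * \<epsilon>" "a + real (Suc i) * \<epsilon>"])
        (use f \<open>\<epsilon> > 0\<close> in \<open>auto simp: bcont_def\<close>)
    then have "\<forall>i. \<exists>c. a + real i * \<epsilon> < c \<and> c < a + real (Suc i) * \<epsilon> \<and> {x. f x < c} \<in> continuity_sets"
      by (rule allI)
    from choice[OF this] obtain c where c: "\<And>i. a + real i * \<epsilon> < c i"
      "\<And>i. c i < a + real (Suc i) * \<epsilon>" "\<And>i. {x. f x < c i} \<in> continuity_sets" by (elim exE) blast
    have c_inc: "c i < c (Suc i)" "c (Suc i) - c i \<le> 2 * \<epsilon>" for i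
      using c(1)[of i] c(2)[of i] c(1)[of "Suc i"] c(2)[of "Suc i"] by (simp_all add: algebra_simps)
    \<comment> \<open>Rounds \<open>f\<close> down to the highest level that it has reached.\<close>
    define s where "s N x = c 0 + (\<Sum>i<N. (c (Suc i) - c i) * indicator {x. c (Suc i) \<le> f x} x)" for N x
    have s: "(f x < c N \<longrightarrow> \<bar>f x - s N x\<bar> \<le> 2 * \<epsilon>) \<and> (c N \<le> f x \<longrightarrow> s N x = c N)" for N x
    proof (induction N)
      case 0
      have "c 0 \<le> f x" using c(2)[of 0] M(2)[of x] by (simp add: a_def abs_le_iff)
      then show ?case by (simp add: s_def)
    next
      case (Suc N)
      have "s (Suc N) x = s N x + (c (Suc N) - c N) * indicator {x. c (Suc N) \<le> f x} x"
        by (simp add: s_def)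
      then show ?case using Suc c_inc[of N] by (cases "c (Suc N) \<le> f x"; cases "c N \<le> f x") auto
    qed
    obtain N :: nat where "real N > (2 * M + \<epsilon>) / \<epsilon>" using reals_Archimedean2 by blast
    then have "real N * \<epsilon> > 2 * M + \<epsilon>" using \<open>\<epsilon> > 0\<close> by (simp add: field_simps)
    then have "f x < c N" for x using c(1)[of N] M(2)[of x] by (simp add: a_def abs_le_iff)
    then have s_close: "\<bar>f x - s N x\<bar> \<le> 2 * \<epsilon>" for x using s by blast
    have cb: "{x. c (Suc i) \<le> f x} \<in> continuity_sets" for i
    proof -
      interpret algebra UNIV continuity_sets by (rule algebra_continuity_sets)
      have "UNIV - {x. f x < c (Suc i)} \<in> continuity_sets" using c(3) by (rule compl_sets)
      moreover have "UNIV - {x. f x < c (Suc i)} = {x. c (Suc i) \<le> f x}" by auto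
      ultimately show ?thesis by simp
    qed
    have int: "integrable (meas_of \<nu>') (\<lambda>x. (c (Suc i) - c i) * indicator {x. c (Suc i) \<le> f x} x)" for \<nu>' i
      using continuity_sets_borel[OF cb]
      by (intro integrable_mult_right integrable_real_indicator) (auto simp: meas_of.emeasure_eq_measure)
    have int_s: "integrable (meas_of \<nu>') (s N)" for \<nu>'
      unfolding s_def using int by (intro Bochner_Integration.integrable_add Bochner_Integration.integrable_sum) auto
    have Es: "expect \<nu>' (s N) = c 0 + (\<Sum>i<N. (c (Suc i) - c i) * measure (meas_of \<nu>') {x. c (Suc i) \<le> f x})" for \<nu>'
    proof -
      have "expect \<nu>' (s N) = expect \<nu>' (\<lambda>_. c 0)
          + expect \<nu>' (\<lambda>x. \<Sum>i<N. (c (Suc i) - c i) * indicator {x. c (Suc i) \<le> f x} x)"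
        unfolding s_def
        by (intro Bochner_Integration.integral_add Bochner_Integration.integrable_sum int) simp
      also have "expect \<nu>' (\<lambda>x. \<Sum>i<N. (c (Suc i) - c i) * indicator {x. c (Suc i) \<le> f x} x)
          = (\<Sum>i<N. expect \<nu>' (\<lambda>x. (c (Suc i) - c i) * indicator {x. c (Suc i) \<le> f x} x))"
        by (intro Bochner_Integration.integral_sum int)
      finally show ?thesis by simp
    qed
    have close: "\<bar>expect \<nu>' f - expect \<nu>' (s N)\<bar> \<le> 2 * \<epsilon>" for \<nu>'
    proof -
      have "\<bar>expect \<nu>' f - expect \<nu>' (s N)\<bar> = \<bar>expect \<nu>' (\<lambda>x. f x - s N x)\<bar>"
        using f int_s by simp
      also have "\<dots> \<le> expect \<nu>' (\<lambda>x. \<bar>f x - s N x\<bar>)" by (rule integral_abs_bound)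
      also have "\<dots> \<le> 2 * \<epsilon>" using f int_s s_close by (intro expect_mono_le integrable_abs) auto
      finally show ?thesis .
    qed
    have "((\<lambda>\<nu>'. expect \<nu>' (s N)) \<longlongrightarrow> expect \<nu> (s N)) G"
      unfolding Es using continuity_sets_borel[OF cb] \<nu>[OF cb]
      by (auto intro!: tendsto_intros lim)
    then have "\<forall>\<^sub>F \<nu>' in G. dist (expect \<nu>' (s N)) (expect \<nu> (s N)) < \<epsilon>"
      using \<open>\<epsilon> > 0\<close> by (rule tendstoD)
    then show "\<forall>\<^sub>F \<nu>' in G. dist (expect \<nu>' f) (expect \<nu> f) < r"
    proof (rule eventually_mono)
      fix \<nu>' assume "dist (expect \<nu>' (s N)) (expect \<nu> (s N)) < \<epsilon>"
      then show "dist (expect \<nu>' f) (expect \<nu> f) < r"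
        using close[of \<nu>] close[of \<nu>'] \<open>\<epsilon> > 0\<close> \<epsilon>_def unfolding dist_real_def by linarith
    qed
  qed
  then show ?thesis using tendsto_narrow_iff by blast
qed

end

lemma closed_measure_compl_le:
  fixes K :: "'a :: metric_space set"
  assumes "closed K"
  shows "closed {\<nu>. measure (meas_of \<nu>) (- K) \<le> r}"
proof -
  have "- {\<nu>. measure (meas_of \<nu>) (- K) \<le> r} = {\<nu>. r < measure (meas_of \<nu>) (- K)}" by auto
  then show ?thesis using open_measure_gt[of "- K" r] assms by (simp add: closed_def)
qed

text \<open>The substantial half of Prokhorov's theorem, for a prescribed rate of tightness. With non-strict
bounds on the open complements the family is closed, so it is compact and not only precompact.\<close>

theorem compact_tight:
  fixes K :: "nat \<Rightarrow> 'a :: polish_space set"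
  assumes K: "\<And>k. compact (K k)" and r: "r \<longlonglongrightarrow> 0"
  shows "compact {\<nu>. \<forall>k. measure (meas_of \<nu>) (- K k) \<le> r k}" (is "compact ?T")
  unfolding compact_filter
proof (intro allI impI)
  fix F :: "'a borel_prob filter"
  assume F: "F \<noteq> bot" "\<forall>\<^sub>F \<nu> in F. \<nu> \<in> ?T"
  have "closed ?T"
    unfolding Collect_all_eq by (intro closed_INT ballI closed_measure_compl_le compact_imp_closed K)
  define \<Phi> where "\<Phi> \<nu> = measure (meas_of \<nu>)" for \<nu> :: "'a borel_prob"
  define S :: "('a set \<Rightarrow> real) set" where "S = PiE UNIV (\<lambda>_. {0..1})"
  \<comment> \<open>Tychonoff: the set functions with values in the unit interval form a compact space.\<close>
  have "compactin (product_topology (\<lambda>_. euclidean) UNIV) S"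
    unfolding S_def by (simp add: compactin_PiE)
  then have "compact S" by (simp add: euclidean_product_topology)
  have "\<Phi> \<nu> \<in> S" for \<nu> by (auto simp: S_def \<Phi>_def)
  then have "\<forall>\<^sub>F y in filtermap \<Phi> F. y \<in> S" by (simp add: eventually_filtermap)
  then obtain m where m: "inf (nhds m) (filtermap \<Phi> F) \<noteq> bot"
    using \<open>compact S\<close> F(1) unfolding compact_filter by (metis filtermap_bot_iff)
  \<comment> \<open>A finer filter along which the masses of all sets converge.\<close>
  define G where "G = inf F (filtercomap \<Phi> (nhds m))"
  have "G \<noteq> bot"
  proof
    assume "G = bot"
    then have "\<forall>\<^sub>F x in G. False" by simp
    then obtain P Q where PQ: "eventually P F" "eventually Q (filtercomap \<Phi> (nhds m))"
      "\<And>x. P x \<and> Q x \<Longrightarrow> False"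
      unfolding G_def eventually_inf by blast
    obtain R where R: "eventually R (nhds m)" "\<And>x. R (\<Phi> x) \<Longrightarrow> Q x"
      using PQ(2) unfolding eventually_filtercomap by blast
    have "eventually (\<lambda>y. \<exists>x. P x \<and> y = \<Phi> x) (filtermap \<Phi> F)"
      unfolding eventually_filtermap using PQ(1) by (rule eventually_mono) auto
    then have "eventually (\<lambda>y. False) (inf (nhds m) (filtermap \<Phi> F))"
      unfolding eventually_inf using R PQ(3) by blast
    then show False using m by (simp add: eventually_False)
  qed
  have "G \<le> F" by (simp add: G_def)
  have \<Phi>m: "(\<Phi> \<longlongrightarrow> m) G"
    unfolding G_def filterlim_def
    by (rule order_trans[OF filtermap_mono[OF inf_le2] filtermap_filtercomap])
  have "((\<lambda>\<nu>. \<Phi> \<nu> A) \<longlongrightarrow> m A) G" for A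
  proof (rule continuous_on_tendsto_compose[OF _ \<Phi>m])
    show "continuous_on UNIV (\<lambda>y :: 'a set \<Rightarrow> real. y A)" by simp
  qed auto
  moreover have GT: "\<forall>\<^sub>F \<nu> in G. \<nu> \<in> ?T" using F(2) \<open>G \<le> F\<close> by (rule filter_leD[rotated])
  ultimately interpret setwise_limit G m
  proof (unfold_locales, goal_cases)
    case (3 \<epsilon>)
    have "\<forall>\<^sub>F k in sequentially. r k < \<epsilon>" using order_tendstoD(2)[OF r] 3(3) by blast
    then obtain k where k: "r k < \<epsilon>" using eventually_happens'[OF sequentially_bot] by blast
    have "\<forall>\<^sub>F \<nu> in G. measure (meas_of \<nu>) (- K k) \<le> \<epsilon>"
      using 3(2)
    proof (rule eventually_mono)
      fix \<nu> assume "\<nu> \<in> ?T"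
      then have "measure (meas_of \<nu>) (- K k) \<le> r k" by blast
      then show "measure (meas_of \<nu>) (- K k) \<le> \<epsilon>" using k by linarith
    qed
    then show ?case using K[of k] by (intro exI[of _ "K k"] conjI)
  qed (use \<open>G \<noteq> bot\<close> in \<open>auto simp: \<Phi>_def\<close>)
  obtain \<nu> where \<nu>: "((\<lambda>\<nu>. \<nu>) \<longlongrightarrow> \<nu>) G" using limit_exists by (elim exE)
  have "\<nu> \<in> ?T" by (rule Lim_in_closed_set[OF \<open>closed ?T\<close> GT \<open>G \<noteq> bot\<close> \<nu>])
  have "G \<le> inf (nhds \<nu>) F" using \<nu> \<open>G \<le> F\<close> by (simp add: filterlim_def)
  then have "inf (nhds \<nu>) F \<noteq> bot" using \<open>G \<noteq> bot\<close> bot.extremum_uniqueI by force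
  then show "\<exists>\<nu>\<in>?T. inf (nhds \<nu>) F \<noteq> bot" using \<open>\<nu> \<in> ?T\<close> by (rule bexI)
qed



section \<open>Laws of empirical measures\<close>

definition iid :: "nat \<Rightarrow> 'a :: topological_space borel_prob \<Rightarrow> (nat \<Rightarrow> 'a) measure" where
  "iid n \<mu> = (\<Pi>\<^sub>M i\<in>{1..n}. meas_of \<mu>)"

interpretation coord: product_sigma_finite "\<lambda>_ :: nat. meas_of \<mu>"
  for \<mu> :: "'a :: topological_space borel_prob"
  by unfold_locales

interpretation iid: prob_space "iid n \<mu>"
  for \<mu> :: "'a :: topological_space borel_prob" and n :: nat
  unfolding iid_def by (rule prob_space_PiM) (rule prob_space_meas_of)

lemma empirical_law_eq: "empirical_law n \<mu> = distr (iid n \<mu>) borel (empirical n)"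
  by (simp only: empirical_law_def iid_def)

lemma measurable_iid_component:
  assumes "i \<in> {1..n}"
  shows "(\<lambda>x. x i) \<in> measurable (iid n \<mu>) borel"
proof -
  have "(\<lambda>x. x i) \<in> measurable (iid n \<mu>) (meas_of \<mu>)"
    unfolding iid_def using assms by (rule measurable_component_singleton)
  then show ?thesis by (simp cong: measurable_cong_sets)
qed

lemma meas_of_empirical:
  assumes "n \<ge> 1"
  shows "meas_of (empirical n x) = distr (uniform_count_measure {1..n}) borel x"
proof (rule measure_eqI)
  fix A assume "A \<in> sets (meas_of (empirical n x))"
  then have A: "A \<in> sets borel" by simp
  have "(\<Sum>i=1..n. emeasure (return borel (x i)) A) = (\<Sum>i=1..n. indicator (x -` A) i)"
    using A by (intro sum.cong) (auto simp: indicator_def)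
  also have "\<dots> = of_nat (card (x -` A \<inter> {1..n}))"
    by (simp add: indicator_def sum.If_cases Int_def conj_commute)
  finally have "emeasure (meas_of (empirical n x)) A = ennreal (1 / real n) * of_nat (card (x -` A \<inter> {1..n}))"
    using emeasure_empirical[OF assms A] by simp
  also have "\<dots> = ennreal (card (x -` A \<inter> {1..n}) / real n)"
    by (simp add: ennreal_of_nat_eq_real_of_nat ennreal_mult[symmetric])
  also have "\<dots> = emeasure (distr (uniform_count_measure {1..n}) borel x) A"
    using A by (subst emeasure_distr)
      (auto simp: emeasure_uniform_count_measure space_uniform_count_measure sets_uniform_count_measure measurable_def)
  finally show "emeasure (meas_of (empirical n x)) A = emeasure (distr (uniform_count_measure {1..n}) borel x) A" .
qed simp

lemma expect_empirical:
  assumes "n \<ge> 1" "f \<in> borel_measurable borel"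
  shows "expect (empirical n x) f = (\<Sum>i=1..n. f (x i)) / real n"
  unfolding meas_of_empirical[OF assms(1)] using assms
  by (subst integral_distr)
    (auto simp: integral_uniform_count_measure measurable_def space_uniform_count_measure sets_uniform_count_measure)

text \<open>Continuity on the full product, with all coordinates from \<open>\<nat>\<close>, is what yields measurability below:
the Borel sets of a countable power of a second countable space are the product ones, while the
Borel sets of the space of measures have no handy description.\<close>

lemma continuous_empirical:
  assumes "n \<ge> 1"
  shows "continuous_on UNIV (empirical n :: (nat \<Rightarrow> 'a :: polish_space) \<Rightarrow> _)"
  unfolding continuous_on_def
proof
  fix x :: "nat \<Rightarrow> 'a"
  show "(empirical n \<longlongrightarrow> empirical n x) (at x)"
    unfolding tendsto_narrow_iff
  proof (intro allI impI)
    fix f :: "'a \<Rightarrow> real" assume f: "bcont f"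
    have "continuous_on UNIV (\<lambda>y :: nat \<Rightarrow> 'a. f (y i))" for i
      by (rule continuous_on_compose2[of UNIV f _ "\<lambda>y. y i"]) (use f in \<open>simp_all add: bcont_def\<close>)
    then have "continuous_on UNIV (\<lambda>y :: nat \<Rightarrow> 'a. (\<Sum>i=1..n. f (y i)) / real n)"
      using assms by (intro continuous_intros) auto
    then show "((\<lambda>y. expect (empirical n y) f) \<longlongrightarrow> expect (empirical n x) f) (at x)"
      unfolding expect_empirical[OF assms bcont_borel[OF f]] continuous_on_def by auto
  qed
qed

lemma measurable_empirical [measurable]:
  fixes \<mu> :: "'a :: polish_space borel_prob"
  shows "empirical n \<in> measurable (iid n \<mu>) borel"
proof (cases "n \<ge> 1")
  case True
  \<comment> \<open>Coordinates outside the index set are constantly \<open>undefined\<close> on the product space.\<close>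
  have "(\<lambda>x. x i) \<in> measurable (iid n \<mu>) borel" for i
  proof (cases "i \<in> {1..n}")
    case False
    then have "(\<lambda>x. x i) \<in> measurable (iid n \<mu>) borel \<longleftrightarrow> (\<lambda>x. undefined :: 'a) \<in> measurable (iid n \<mu>) borel"
      by (intro measurable_cong) (auto simp: iid_def space_PiM PiE_def extensional_def)
    then show ?thesis by simp
  next
    case True
    then show ?thesis by (rule measurable_iid_component)
  qed
  then have "(\<lambda>x i. x i) \<in> measurable (iid n \<mu>) (Pi\<^sub>M UNIV (\<lambda>_. borel))"
    by (intro measurable_PiM_single') auto
  then have "(\<lambda>x. x) \<in> measurable (iid n \<mu>) borel"
    by (simp add: sets_PiM_equal_borel cong: measurable_cong_sets)
  from measurable_compose[OF this borel_measurable_continuous_onI[OF continuous_empirical[OF True]]]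
  show ?thesis by simp
next
  case False
  then have "empirical n = (\<lambda>_ :: nat \<Rightarrow> 'a. empirical n undefined)" by (auto simp: empirical_def)
  moreover have "(\<lambda>_. empirical n undefined) \<in> measurable (iid n \<mu>) (borel :: 'a borel_prob measure)" by simp
  ultimately show ?thesis by argo
qed

lemma prob_space_empirical_law:
  fixes \<mu> :: "'a :: polish_space borel_prob"
  shows "prob_space (empirical_law n \<mu>)"
  unfolding empirical_law_eq by (rule iid.prob_space_distr) simp

lemma sets_empirical_law [simp]: "sets (empirical_law n \<mu>) = sets borel"
  by (simp add: empirical_law_eq)

lemma space_empirical_law [simp]: "space (empirical_law n \<mu>) = UNIV"
  by (simp add: empirical_law_eq)

lemma measure_empirical_law:
  fixes \<mu> :: "'a :: polish_space borel_prob"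
  assumes "A \<in> sets borel"
  shows "measure (empirical_law n \<mu>) A = measure (iid n \<mu>) (empirical n -` A \<inter> space (iid n \<mu>))"
  unfolding empirical_law_eq using assms by (intro measure_distr) auto

text \<open>The exponential Chebyshev inequality; independence turns the exponential moment of
\<open>n (\<pi>\<^sub>n(g) - c)\<close> into a power.\<close>

lemma empirical_law_chernoff:
  fixes \<mu> :: "'a :: polish_space borel_prob"
  assumes n: "n \<ge> 1" and A: "A \<in> sets borel" and g: "g \<in> borel_measurable borel" "bounded (range g)"
    and c: "\<And>\<nu>. \<nu> \<in> A \<Longrightarrow> c \<le> expect \<nu> g"
  shows "measure (empirical_law n \<mu>) A \<le> (exp (- c) * expect \<mu> (\<lambda>x. exp (g x))) ^ n"
proof -
  define B where "B = empirical n -` A \<inter> space (iid n \<mu>)"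
  have B: "B \<in> sets (iid n \<mu>)" unfolding B_def using A by measurable
  obtain M where M: "\<And>x. \<bar>g x\<bar> \<le> M" using bounded_rangeE[OF g(2)] by metis
  have int: "integrable (meas_of \<mu>) (\<lambda>x. exp (- c) * exp (g x))"
    using g(1) M by (intro integrable_mult_right integrable_meas_of bounded_rangeI[of _ "exp M"])
      (auto simp: abs_le_iff)
  have "measure (iid n \<mu>) B = (\<integral>x. indicator B x \<partial>iid n \<mu>)" using B by simp
  also have "\<dots> \<le> (\<integral>x. (\<Prod>i\<in>{1..n}. exp (- c) * exp (g (x i))) \<partial>iid n \<mu>)"
  proof (rule integral_mono)
    show "integrable (iid n \<mu>) (indicator B :: _ \<Rightarrow> real)"
      using B by (intro integrable_real_indicator) (auto simp: iid.emeasure_eq_measure less_top[symmetric])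
    show "integrable (iid n \<mu>) (\<lambda>x. \<Prod>i\<in>{1..n}. exp (- c) * exp (g (x i)))"
      using int unfolding iid_def by (intro coord.product_integrable_prod) auto
    fix x
    show "indicator B x \<le> (\<Prod>i\<in>{1..n}. exp (- c) * exp (g (x i)))"
    proof (cases "x \<in> B")
      case True
      then have "c \<le> (\<Sum>i=1..n. g (x i)) / real n"
        using c[of "empirical n x"] expect_empirical[OF n g(1)] by (simp add: B_def)
      then have "0 \<le> (\<Sum>i=1..n. - c + g (x i))"
        using n by (simp add: sum.distrib field_simps sum_subtractf)
      then show ?thesis using True by (simp add: mult_exp_exp exp_sum[symmetric])
    qed (simp add: prod_nonneg)
  qed
  also have "\<dots> = (\<Prod>i\<in>{1..n}. expect \<mu> (\<lambda>x. exp (- c) * exp (g x)))"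
    using int unfolding iid_def by (intro coord.product_integral_prod) auto
  finally show ?thesis using measure_empirical_law[OF A, of n \<mu>] by (simp add: B_def)
qed

lemma exp_le_quadratic:
  fixes x :: real
  assumes "\<bar>x\<bar> \<le> 1"
  shows "exp x \<le> 1 + x + x\<^sup>2"
proof (cases "0 \<le> x")
  case True
  then show ?thesis using assms exp_bound[of x] by simp
next
  case False
  define y where "y = - x"
  have y: "0 \<le> y" "y \<le> 1" using False assms by (auto simp: y_def)
  have "1 + y + y\<^sup>2 / 2 \<le> exp y" using exp_lower_Taylor_quadratic[OF y(1)] .
  then have "(1 - y + y\<^sup>2) * (1 + y + y\<^sup>2 / 2) \<le> (1 - y + y\<^sup>2) * exp y"
    using y by (intro mult_left_mono) auto
  moreover have "(1 - y + y\<^sup>2) * (1 + y + y\<^sup>2 / 2) = 1 + (y\<^sup>2 + y * y\<^sup>2 + y\<^sup>2 * y\<^sup>2) / 2"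
    by (simp add: power2_eq_square field_simps)
  moreover have "0 \<le> (y\<^sup>2 + y * y\<^sup>2 + y\<^sup>2 * y\<^sup>2) / 2" using y by simp
  ultimately have "1 \<le> (1 - y + y\<^sup>2) * exp y" by linarith
  then have "exp (- y) \<le> 1 - y + y\<^sup>2" by (simp add: exp_minus field_simps)
  then show ?thesis by (simp add: y_def)
qed

text \<open>The quadratic bound on the cumulant generating function near the origin, in a crude form that
replaces the variance by the square of a bound on \<open>f\<close>.\<close>

lemma expect_exp_le:
  assumes f: "bcont f" and M: "\<And>x. \<bar>f x\<bar> \<le> M" and t: "0 \<le> t" "t * M \<le> 1"
  shows "expect \<nu> (\<lambda>x. exp (t * f x)) \<le> exp (t * expect \<nu> f + t\<^sup>2 * M\<^sup>2)"
proof -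
  have "exp (t * f x) \<le> 1 + t * f x + t\<^sup>2 * M\<^sup>2" for x
  proof -
    have "\<bar>t * f x\<bar> \<le> t * M" using M[of x] t(1) by (simp add: abs_mult mult_left_mono)
    then have "exp (t * f x) \<le> 1 + t * f x + (t * f x)\<^sup>2" using t(2) by (intro exp_le_quadratic) simp
    moreover have "(t * f x)\<^sup>2 \<le> (t * M)\<^sup>2"
      using \<open>\<bar>t * f x\<bar> \<le> t * M\<close> by (meson abs_le_square_iff abs_ge_self order_trans)
    ultimately show ?thesis by (simp add: power_mult_distrib)
  qed
  then have "expect \<nu> (\<lambda>x. exp (t * f x)) \<le> expect \<nu> (\<lambda>x. 1 + t * f x + t\<^sup>2 * M\<^sup>2)"
    using f by (intro integral_mono bcont_integrable bcont_exp bcont_scale bcont_add bcont_const) auto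
  also have "\<dots> = 1 + (t * expect \<nu> f + t\<^sup>2 * M\<^sup>2)"
    using f by (simp add: bcont_scale)
  also have "\<dots> \<le> exp (t * expect \<nu> f + t\<^sup>2 * M\<^sup>2)" by (rule exp_ge_add_one_self)
  finally show ?thesis .
qed

text \<open>The exponential Chebyshev inequality for \<open>t f\<close> with small \<open>t > 0\<close>: the gain \<open>t \<epsilon> / 2\<close>
dominates the quadratic error \<open>t\<^sup>2 M\<^sup>2\<close>.\<close>

lemma empirical_law_deviation_tendsto_0:
  fixes \<nu> :: "'a :: polish_space borel_prob"
  assumes X: "X \<longlonglongrightarrow> \<nu>" and f: "bcont f" and "\<epsilon> > 0"
  shows "(\<lambda>n. measure (empirical_law n (X n)) {\<nu>'. expect \<nu> f + \<epsilon> \<le> expect \<nu>' f}) \<longlonglongrightarrow> 0"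
proof -
  obtain M where M: "0 < M" "\<And>x. \<bar>f x\<bar> \<le> M" using bcontE[OF f] by metis
  define t where "t = min (1 / M) (\<epsilon> / (4 * M\<^sup>2))"
  have t: "0 < t" "t * M \<le> 1" "t * M\<^sup>2 \<le> \<epsilon> / 4"
    using M(1) \<open>\<epsilon> > 0\<close> by (auto simp: t_def min_def field_simps power2_eq_square)
  define q where "q = exp (- (t * \<epsilon> / 4))"
  have q: "0 \<le> q" "q < 1" using t(1) \<open>\<epsilon> > 0\<close> by (simp_all add: q_def)
  have cl: "closed {\<nu>'. expect \<nu> f + \<epsilon> \<le> expect \<nu>' f}" using f by (rule closed_expect_ge)
  have "(\<lambda>n. expect (X n) f) \<longlonglongrightarrow> expect \<nu> f" using X[unfolded tendsto_narrow_iff] f by simp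
  then have "\<forall>\<^sub>F n in sequentially. expect (X n) f < expect \<nu> f + \<epsilon> / 2"
    using \<open>\<epsilon> > 0\<close> by (intro order_tendstoD) auto
  then have "\<forall>\<^sub>F n in sequentially. measure (empirical_law n (X n)) {\<nu>'. expect \<nu> f + \<epsilon> \<le> expect \<nu>' f} \<le> q ^ n"
    using eventually_ge_at_top[of 1]
  proof eventually_elim
    case (elim n)
    have "measure (empirical_law n (X n)) {\<nu>'. expect \<nu> f + \<epsilon> \<le> expect \<nu>' f}
        \<le> (exp (- (t * (expect \<nu> f + \<epsilon>))) * expect (X n) (\<lambda>x. exp (t * f x))) ^ n"
      using cl f t(1) elim(2)
      by (intro empirical_law_chernoff bcont_borel bcont_scale) (auto simp: bcont_scale[unfolded bcont_def] bcont_def)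
    also have "\<dots> \<le> q ^ n"
    proof (intro power_mono mult_nonneg_nonneg expect_mono_ge)
      have "exp (- (t * (expect \<nu> f + \<epsilon>))) * expect (X n) (\<lambda>x. exp (t * f x))
        \<le> exp (- (t * (expect \<nu> f + \<epsilon>))) * exp (t * expect (X n) f + t\<^sup>2 * M\<^sup>2)"
        using t f M by (intro mult_left_mono expect_exp_le) auto
      also have "\<dots> = exp (t * (expect (X n) f - expect \<nu> f - \<epsilon> + t * M\<^sup>2))"
        by (simp add: mult_exp_exp algebra_simps power2_eq_square)
      also have "\<dots> \<le> exp (t * (- (\<epsilon> / 4)))"
        using elim(1) t by (intro exp_le_cancel_iff[THEN iffD2] mult_left_mono) auto
      finally show "exp (- (t * (expect \<nu> f + \<epsilon>))) * expect (X n) (\<lambda>x. exp (t * f x)) \<le> q"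
        by (simp add: q_def)
    qed (use f in \<open>auto intro!: bcont_exp bcont_scale\<close>)
    finally show ?case .
  qed
  moreover have "(\<lambda>n. q ^ n) \<longlonglongrightarrow> 0" using q by (intro LIMSEQ_realpow_zero) auto
  ultimately show ?thesis
    by (rule tendsto_sandwich[OF always_eventually _ tendsto_const[of 0], rotated]) simp
qed

text \<open>The weak law of large numbers for triangular arrays. It suffices to control the finitely many
functions that define a basic neighbourhood, from above and from below.\<close>

lemma empirical_law_weak_law:
  fixes \<nu> :: "'a :: polish_space borel_prob"
  assumes X: "X \<longlonglongrightarrow> \<nu>" and W: "open W" "\<nu> \<in> W"
  shows "(\<lambda>n. measure (empirical_law n (X n)) W) \<longlonglongrightarrow> 1"
proof -
  obtain F \<epsilon> where F: "finite F" "\<And>f. f \<in> F \<Longrightarrow> bcont f" "0 < \<epsilon>"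
    and FW: "\<And>\<nu>'. (\<And>f. f \<in> F \<Longrightarrow> \<bar>expect \<nu>' f - expect \<nu> f\<bar> < \<epsilon>) \<Longrightarrow> \<nu>' \<in> W"
    using W by (rule narrow_nbhd_basis) blast
  define D where "D f = {\<nu>'. expect \<nu> f + \<epsilon> \<le> expect \<nu>' f}" for f
  have D: "D f \<in> sets borel" if "bcont f" for f
    using closed_expect_ge[OF that] by (simp add: D_def)
  have neg: "bcont (\<lambda>x. - f x)" if "f \<in> F" for f using bcont_scale[OF F(2)[OF that], of "-1"] by simp
  define bound where "bound n = (\<Sum>f\<in>F. measure (empirical_law n (X n)) (D f)
      + measure (empirical_law n (X n)) (D (\<lambda>x. - f x)))" for n
  have "bound \<longlonglongrightarrow> (\<Sum>f\<in>F. 0 + 0)"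
    unfolding bound_def D_def using F neg X
    by (intro tendsto_sum tendsto_add empirical_law_deviation_tendsto_0) auto
  then have "(\<lambda>n. 1 - bound n) \<longlonglongrightarrow> 1" using tendsto_diff[OF tendsto_const[of 1]] by fastforce
  moreover have "1 - bound n \<le> measure (empirical_law n (X n)) W" for n
  proof -
    interpret P: prob_space "empirical_law n (X n)" by (rule prob_space_empirical_law)
    have "- W \<subseteq> (\<Union>f\<in>F. D f \<union> D (\<lambda>x. - f x))"
    proof
      fix \<nu>' assume "\<nu>' \<in> - W"
      then obtain f where "f \<in> F" "\<not> \<bar>expect \<nu>' f - expect \<nu> f\<bar> < \<epsilon>" using FW by blast
      moreover from this have "\<nu>' \<in> D f \<union> D (\<lambda>x. - f x)" by (auto simp: D_def)
      ultimately show "\<nu>' \<in> (\<Union>f\<in>F. D f \<union> D (\<lambda>x. - f x))" by blast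
    qed
    then have "P.prob (- W) \<le> P.prob (\<Union>f\<in>F. D f \<union> D (\<lambda>x. - f x))"
      using F D neg by (intro P.finite_measure_mono) auto
    also have "\<dots> \<le> (\<Sum>f\<in>F. P.prob (D f \<union> D (\<lambda>x. - f x)))"
      using F D neg by (intro P.finite_measure_subadditive_finite) auto
    also have "\<dots> \<le> bound n"
      unfolding bound_def using F D neg by (intro sum_mono measure_Un_le) auto
    finally show ?thesis using P.prob_compl[of W] W(1) by (simp add: Compl_eq_Diff_UNIV)
  qed
  moreover have "measure (empirical_law n (X n)) W \<le> 1" for n
    using prob_space.prob_le_1[OF prob_space_empirical_law] .
  ultimately show ?thesis
    using tendsto_sandwich[OF always_eventually always_eventually _ tendsto_const[of 1],
        of "\<lambda>n. 1 - bound n" "\<lambda>n. measure (empirical_law n (X n)) W" sequentially] by simp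
qed

section \<open>Exponential tilting\<close>

text \<open>The Gibbs measure \<open>e\<^sup>f \<mu> / \<mu>(e\<^sup>f)\<close>.\<close>

definition tilt :: "('a :: topological_space) borel_prob \<Rightarrow> ('a \<Rightarrow> real) \<Rightarrow> 'a borel_prob" where
  "tilt \<mu> f = prob_of (density (meas_of \<mu>) (\<lambda>x. ennreal (exp (f x) / expect \<mu> (\<lambda>x. exp (f x)))))"

lemma expect_exp_pos: "bcont f \<Longrightarrow> 0 < expect \<mu> (\<lambda>x. exp (f x))"
proof -
  assume f: "bcont f"
  obtain M where "\<And>x. \<bar>f x\<bar> \<le> M" using bcontE[OF f] by metis
  then have "exp (- M) \<le> expect \<mu> (\<lambda>x. exp (f x))"
    using f by (intro expect_mono_ge) (auto intro!: bcont_exp simp: abs_le_iff minus_le_iff)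
  then show ?thesis using exp_gt_zero[of "- M"] by linarith
qed

lemma meas_of_tilt:
  assumes f: "bcont f"
  shows "meas_of (tilt \<mu> f) =
    density (meas_of \<mu>) (\<lambda>x. ennreal (exp (f x) / expect \<mu> (\<lambda>x. exp (f x))))"
  unfolding tilt_def
proof (rule prob_of_inverse, intro CollectI conjI)
  let ?Z = "expect \<mu> (\<lambda>x. exp (f x))"
  let ?D = "density (meas_of \<mu>) (\<lambda>x. ennreal (exp (f x) / ?Z))"
  have Z: "0 < ?Z" using expect_exp_pos[OF f] .
  have [measurable]: "f \<in> borel_measurable borel" using bcont_borel[OF f] .
  have "emeasure ?D (space ?D) = (\<integral>\<^sup>+ x. ennreal (exp (f x) / ?Z) \<partial>meas_of \<mu>)"
    by (simp add: emeasure_density)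
  also have "\<dots> = ennreal (expect \<mu> (\<lambda>x. exp (f x) / ?Z))"
    using Z f by (intro nn_integral_eq_integral) (auto intro!: integrable_divide_zero bcont_exp)
  finally show "prob_space ?D" using Z by (intro prob_spaceI) simp
qed simp

lemma expect_tilt:
  assumes f: "bcont f" and g: "bcont g"
  shows "expect (tilt \<mu> f) g = expect \<mu> (\<lambda>x. exp (f x) * g x) / expect \<mu> (\<lambda>x. exp (f x))"
proof -
  have [measurable]: "f \<in> borel_measurable borel" "g \<in> borel_measurable borel"
    using bcont_borel f g by auto
  have "expect (tilt \<mu> f) g = expect \<mu> (\<lambda>x. (exp (f x) / expect \<mu> (\<lambda>x. exp (f x))) *\<^sub>R g x)"
    unfolding meas_of_tilt[OF f] using expect_exp_pos[OF f, of \<mu>]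
    by (intro integral_density) auto
  then show ?thesis by simp
qed

text \<open>Tilting by a continuous function is continuous in the measure. This is why the tilts, unlike
general measures with a density, can be transported from \<open>\<mu>\<close> to the approximating sequence.\<close>

lemma tilt_tendsto:
  fixes \<mu> :: "'a :: topological_space borel_prob"
  assumes "(X \<longlongrightarrow> \<mu>) G" "bcont f"
  shows "((\<lambda>n. tilt (X n) f) \<longlongrightarrow> tilt \<mu> f) G"
  unfolding tendsto_narrow_iff
proof (intro allI impI)
  fix g :: "'a \<Rightarrow> real" assume g: "bcont g"
  have *: "((\<lambda>n. expect (X n) h) \<longlongrightarrow> expect \<mu> h) G" if "bcont h" for h
    using assms(1)[unfolded tendsto_narrow_iff] that by simp
  show "((\<lambda>n. expect (tilt (X n) f) g) \<longlongrightarrow> expect (tilt \<mu> f) g) G"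
    unfolding expect_tilt[OF assms(2) g] using expect_exp_pos[OF assms(2), of \<mu>]
    by (intro tendsto_divide * bcont_mult bcont_exp assms g) auto
qed

lemma iid_tilt:
  assumes f: "bcont f"
  shows "iid n (tilt \<mu> f) = density (iid n \<mu>)
    (\<lambda>x. \<Prod>i\<in>{1..n}. ennreal (exp (f (x i)) / expect \<mu> (\<lambda>x. exp (f x))))"
proof -
  define h where "h x = ennreal (exp (f x) / expect \<mu> (\<lambda>x. exp (f x)))" for x
  have [measurable]: "f \<in> borel_measurable borel" using bcont_borel f by auto
  then have [measurable]: "h \<in> borel_measurable borel" unfolding h_def by measurable
  have h_prod [measurable]: "(\<lambda>x. \<Prod>i\<in>{1..n}. h (x i)) \<in> borel_measurable (iid n \<mu>)"
    by (intro borel_measurable_prod_ennreal measurable_compose[OF measurable_iid_component]) auto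
  have "density (iid n \<mu>) (\<lambda>x. \<Prod>i\<in>{1..n}. h (x i)) = (\<Pi>\<^sub>M i\<in>{1..n}. meas_of (tilt \<mu> f))"
  proof (rule coord.PiM_eqI)
    show "sets (density (iid n \<mu>) (\<lambda>x. \<Prod>i\<in>{1..n}. h (x i))) = sets (\<Pi>\<^sub>M i\<in>{1..n}. meas_of (tilt \<mu> f))"
      unfolding iid_def by (simp cong: sets_PiM_cong)
    fix A assume "\<And>i. i \<in> {1..n} \<Longrightarrow> A i \<in> sets (meas_of (tilt \<mu> f))"
    then have A [measurable]: "\<And>i. i \<in> {1..n} \<Longrightarrow> A i \<in> sets borel" by simp
    have PA: "Pi\<^sub>E {1..n} A \<in> sets (iid n \<mu>)" unfolding iid_def using A by (intro sets_PiM_I_finite) auto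
    have "emeasure (density (iid n \<mu>) (\<lambda>x. \<Prod>i\<in>{1..n}. h (x i))) (Pi\<^sub>E {1..n} A)
      = (\<integral>\<^sup>+ x. (\<Prod>i\<in>{1..n}. h (x i)) * indicator (Pi\<^sub>E {1..n} A) x \<partial>iid n \<mu>)"
      by (rule emeasure_density[OF h_prod PA])
    also have "\<dots> = (\<integral>\<^sup>+ x. (\<Prod>i\<in>{1..n}. h (x i) * indicator (A i) (x i)) \<partial>iid n \<mu>)"
    proof (rule nn_integral_cong)
      fix x assume "x \<in> space (iid n \<mu>)"
      then have "x \<in> extensional {1..n}" by (auto simp: iid_def space_PiM PiE_def)
      then have "(indicator (Pi\<^sub>E {1..n} A) x :: ennreal) = (\<Prod>i\<in>{1..n}. indicator (A i) (x i))"
        by (auto simp: indicator_def PiE_def Pi_def prod_zero_iff)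
      then show "(\<Prod>i\<in>{1..n}. h (x i)) * indicator (Pi\<^sub>E {1..n} A) x = (\<Prod>i\<in>{1..n}. h (x i) * indicator (A i) (x i))"
        by (simp add: prod.distrib)
    qed
    also have "\<dots> = (\<Prod>i\<in>{1..n}. \<integral>\<^sup>+ x. h x * indicator (A i) x \<partial>meas_of \<mu>)"
      unfolding iid_def by (intro coord.product_nn_integral_prod) auto
    also have "\<dots> = (\<Prod>i\<in>{1..n}. emeasure (meas_of (tilt \<mu> f)) (A i))"
      using A unfolding meas_of_tilt[OF f] h_def[symmetric]
      by (intro prod.cong refl emeasure_density[symmetric]) auto
    finally show "emeasure (density (iid n \<mu>) (\<lambda>x. \<Prod>i\<in>{1..n}. h (x i))) (Pi\<^sub>E {1..n} A)
      = (\<Prod>i\<in>{1..n}. emeasure (meas_of (tilt \<mu> f)) (A i))" .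
  qed simp
  then show ?thesis by (simp add: h_def iid_def[of n "tilt \<mu> f"])
qed

text \<open>Change of measure: where the empirical mean of \<open>f\<close> is at most \<open>s\<close>, the density of the tilted
product is at most \<open>(e\<^sup>s / \<mu>(e\<^sup>f))\<^sup>n\<close>. It is used to bound the law of the untilted sample
from below.\<close>

lemma empirical_law_tilt_le:
  fixes \<mu> :: "'a :: polish_space borel_prob"
  assumes n: "n \<ge> 1" and A: "A \<in> sets borel" and f: "bcont f"
    and s: "\<And>\<nu>. \<nu> \<in> A \<Longrightarrow> expect \<nu> f \<le> s"
  shows "measure (empirical_law n (tilt \<mu> f)) A
    \<le> (exp s / expect \<mu> (\<lambda>x. exp (f x))) ^ n * measure (empirical_law n \<mu>) A"
proof -
  define Z where "Z = expect \<mu> (\<lambda>x. exp (f x))"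
  have Z: "0 < Z" using expect_exp_pos[OF f] by (simp add: Z_def)
  have [measurable]: "f \<in> borel_measurable borel" using bcont_borel f by auto
  define B where "B = empirical n -` A \<inter> space (iid n \<mu>)"
  have B [measurable]: "B \<in> sets (iid n \<mu>)" unfolding B_def using A by measurable
  have "space (iid n (tilt \<mu> f)) = space (iid n \<mu>)" by (simp add: iid_def space_PiM)
  then have "ennreal (measure (empirical_law n (tilt \<mu> f)) A) = emeasure (iid n (tilt \<mu> f)) B"
    using measure_empirical_law[OF A, of n "tilt \<mu> f"] by (simp add: B_def iid.emeasure_eq_measure)
  also have "\<dots> = (\<integral>\<^sup>+ x. (\<Prod>i\<in>{1..n}. ennreal (exp (f (x i)) / Z)) * indicator B x \<partial>iid n \<mu>)"
    unfolding iid_tilt[OF f] Z_def[symmetric]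
  proof (rule emeasure_density[OF _ B])
    have "(\<lambda>x. ennreal (exp (f (x i)) / Z)) \<in> borel_measurable (iid n \<mu>)" if "i \<in> {1..n}" for i
      by (rule measurable_compose[OF measurable_iid_component[OF that]]) measurable
    then show "(\<lambda>x. \<Prod>i\<in>{1..n}. ennreal (exp (f (x i)) / Z)) \<in> borel_measurable (iid n \<mu>)"
      by (rule borel_measurable_prod_ennreal)
  qed
  also have "\<dots> \<le> (\<integral>\<^sup>+ x. ennreal ((exp s / Z) ^ n) * indicator B x \<partial>iid n \<mu>)"
  proof (rule nn_integral_mono)
    fix x
    show "(\<Prod>i\<in>{1..n}. ennreal (exp (f (x i)) / Z)) * indicator B x \<le> ennreal ((exp s / Z) ^ n) * indicator B x"
    proof (cases "x \<in> B")
      case True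
      then have "(\<Sum>i=1..n. f (x i)) / real n \<le> s"
        using s[of "empirical n x"] expect_empirical[OF n, of f] by (simp add: B_def)
      then have "(\<Sum>i=1..n. f (x i)) \<le> real n * s" using n by (simp add: field_simps)
      then have "(\<Prod>i\<in>{1..n}. exp (f (x i))) \<le> exp s ^ n"
        by (simp add: exp_sum[symmetric] exp_of_nat_mult[symmetric])
      then have "(\<Prod>i\<in>{1..n}. exp (f (x i)) / Z) \<le> (exp s / Z) ^ n"
        using Z by (simp add: prod_dividef power_divide divide_right_mono)
      then show ?thesis using True Z by (simp add: prod_ennreal ennreal_leI)
    qed simp
  qed
  also have "\<dots> = ennreal ((exp s / Z) ^ n * measure (iid n \<mu>) B)"
    using Z by (simp add: nn_integral_cmult iid.emeasure_eq_measure ennreal_mult)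
  finally have "measure (empirical_law n (tilt \<mu> f)) A \<le> (exp s / Z) ^ n * measure (iid n \<mu>) B"
    using Z by (simp add: ennreal_le_iff)
  then show ?thesis using measure_empirical_law[OF A, of n \<mu>] by (simp add: B_def Z_def)
qed



section \<open>Large deviations by elementary estimates\<close>

text \<open>The convention \<open>log 0 = -\<infinity>\<close> makes the comparison of rates with probabilities exact, without
exception for null sets. This reduces all large deviation estimates to inequalities between reals.\<close>

lemma ext_ln_le_iff:
  assumes "0 < b"
  shows "ereal (1 / b) * ext_ln p \<le> ereal (- c) \<longleftrightarrow> p \<le> exp (- (b * c))"
proof (cases "p \<le> 0")
  case True
  then show ?thesis using assms exp_gt_zero[of "- (b * c)"] by (auto simp: ext_ln_def intro: order_trans)
next
  case False
  then have "p \<le> exp (- (b * c)) \<longleftrightarrow> ln p \<le> - (b * c)"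
    by (metis exp_le_cancel_iff exp_ln not_le)
  then show ?thesis using False assms by (simp add: ext_ln_def field_simps)
qed

lemma le_ext_ln_iff:
  assumes "0 < b"
  shows "ereal (- c) \<le> ereal (1 / b) * ext_ln p \<longleftrightarrow> exp (- (b * c)) \<le> p"
proof (cases "p \<le> 0")
  case True
  then have "p < exp (- (b * c))" using exp_gt_zero by (rule le_less_trans)
  then show ?thesis using True assms by (simp add: ext_ln_def not_le)
next
  case False
  then have "exp (- (b * c)) \<le> p \<longleftrightarrow> - (b * c) \<le> ln p"
    by (metis exp_le_cancel_iff exp_ln not_le)
  then show ?thesis using False assms by (simp add: ext_ln_def field_simps)
qed

lemma ennreal_less_iff_ereal: "0 \<le> c \<Longrightarrow> ennreal c < J \<longleftrightarrow> ereal c < enn2ereal J"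
  by (simp add: less_ennreal.rep_eq enn2ereal_ennreal)

lemma less_ennreal_iff_ereal: "0 \<le> c \<Longrightarrow> J < ennreal c \<longleftrightarrow> enn2ereal J < ereal c"
  by (simp add: less_ennreal.rep_eq enn2ereal_ennreal)

lemma limsup_ext_ln_leI:
  assumes b: "\<forall>\<^sub>F n in sequentially. 0 < b n" and p: "\<And>n. p n \<le> 1"
    and J: "\<And>c. 0 \<le> c \<Longrightarrow> ennreal c < J \<Longrightarrow> \<forall>\<^sub>F n in sequentially. p n \<le> exp (- (b n * c))"
  shows "limsup (\<lambda>n. ereal (1 / b n) * ext_ln (p n)) \<le> - enn2ereal J"
  unfolding Limsup_le_iff
proof (intro allI impI)
  fix y assume y: "- enn2ereal J < y"
  obtain c where c: "ereal (- c) < y" "0 \<le> c" "\<forall>\<^sub>F n in sequentially. p n \<le> exp (- (b n * c))"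
  \<comment> \<open>Levels above zero are attained trivially, since probabilities are at most one.\<close>
  proof (cases "0 < y")
    case True
    then show ?thesis using p that[of 0] by (simp add: zero_ereal_def)
  next
    case False
    have "- y < enn2ereal J" using y by (simp only: ereal_uminus_less_reorder[of "enn2ereal J"])
    then obtain c where c: "- y < ereal c" "ereal c < enn2ereal J" using ereal_dense2 by blast
    have "0 \<le> - y" using False by (simp add: not_less)
    then have "0 < ereal c" using c(1) by (rule le_less_trans)
    then have "0 \<le> c" by simp
    moreover have "ereal (- c) < y" using c(1) ereal_uminus_less_reorder[of y "ereal c"] by simp
    ultimately show ?thesis using that[of c] J[of c] c(2) ennreal_less_iff_ereal by blast
  qed
  show "\<forall>\<^sub>F n in sequentially. ereal (1 / b n) * ext_ln (p n) < y"
    using c(3) b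
  proof eventually_elim
    case (elim n)
    then have "ereal (1 / b n) * ext_ln (p n) \<le> ereal (- c)" by (simp only: ext_ln_le_iff)
    then show ?case using c(1) by (rule le_less_trans)
  qed
qed

lemma limsup_ext_ln_leD:
  assumes b: "\<forall>\<^sub>F n in sequentially. 0 < b n"
    and J: "limsup (\<lambda>n. ereal (1 / b n) * ext_ln (p n)) \<le> - enn2ereal J"
    and c: "0 \<le> c" "ennreal c < J"
  shows "\<forall>\<^sub>F n in sequentially. p n \<le> exp (- (b n * c))"
proof -
  have "- enn2ereal J < ereal (- c)"
    using c ennreal_less_iff_ereal[OF c(1)] by (metis ereal_minus_less_minus uminus_ereal.simps(1))
  with J have "limsup (\<lambda>n. ereal (1 / b n) * ext_ln (p n)) < ereal (- c)" by (rule le_less_trans)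
  from Limsup_lessD[OF this] b show ?thesis
  proof eventually_elim
    case (elim n)
    then show ?case using ext_ln_le_iff[OF elim(2), of "p n" c] less_imp_le by blast
  qed
qed

lemma liminf_ext_ln_geI:
  assumes b: "\<forall>\<^sub>F n in sequentially. 0 < b n"
    and J: "\<And>c. 0 \<le> c \<Longrightarrow> J < ennreal c \<Longrightarrow> \<forall>\<^sub>F n in sequentially. exp (- (b n * c)) \<le> p n"
  shows "- enn2ereal J \<le> liminf (\<lambda>n. ereal (1 / b n) * ext_ln (p n))"
  unfolding le_Liminf_iff
proof (intro allI impI)
  fix y assume "y < - enn2ereal J"
  then have "enn2ereal J < - y" using ereal_less_uminus_reorder by blast
  then obtain c where c: "enn2ereal J < ereal c" "ereal c < - y" using ereal_dense2 by blast
  have "0 < ereal c" using enn2ereal_nonneg c(1) by (rule le_less_trans)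
  then have "0 \<le> c" by simp
  have y: "y < ereal (- c)" using c(2) ereal_less_uminus_reorder by auto
  have "J < ennreal c" using c(1) \<open>0 \<le> c\<close> less_ennreal_iff_ereal by blast
  from J[OF \<open>0 \<le> c\<close> this] b
  show "\<forall>\<^sub>F n in sequentially. y < ereal (1 / b n) * ext_ln (p n)"
  proof eventually_elim
    case (elim n)
    then have "ereal (- c) \<le> ereal (1 / b n) * ext_ln (p n)" by (simp only: le_ext_ln_iff)
    with y show ?case by (rule less_le_trans)
  qed
qed

lemma liminf_ext_ln_geD:
  assumes b: "\<forall>\<^sub>F n in sequentially. 0 < b n"
    and J: "- enn2ereal J \<le> liminf (\<lambda>n. ereal (1 / b n) * ext_ln (p n))"
    and c: "0 \<le> c" "J < ennreal c"
  shows "\<forall>\<^sub>F n in sequentially. exp (- (b n * c)) \<le> p n"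
proof -
  have "ereal (- c) < - enn2ereal J"
    using c less_ennreal_iff_ereal[OF c(1)] by (metis ereal_minus_less_minus uminus_ereal.simps(1))
  then have "ereal (- c) < liminf (\<lambda>n. ereal (1 / b n) * ext_ln (p n))" using J by (rule less_le_trans)
  from less_LiminfD[OF this] b show ?thesis
  proof eventually_elim
    case (elim n)
    then show ?case using le_ext_ln_iff[OF elim(2), of c "p n"] less_imp_le by blast
  qed
qed

text \<open>The passage from local to closed upper bounds. A closed set is split into its part outside a
compact set, which has negligible probability, and a compact part, which finitely many of the good
neighbourhoods cover; the number of the latter is immaterial on the exponential scale.\<close>

theorem large_deviationsI:
  fixes F :: "'z :: topological_space \<Rightarrow> ennreal"
  assumes Q: "\<And>n. prob_space (Q n)" "\<And>n. sets (Q n) = sets borel"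
    and F: "lower_semicontinuous F" and b: "filterlim b at_top sequentially"
    and lower: "\<And>U z c. open U \<Longrightarrow> z \<in> U \<Longrightarrow> 0 \<le> c \<Longrightarrow> F z < ennreal c \<Longrightarrow>
      \<forall>\<^sub>F n in sequentially. exp (- (b n * c)) \<le> measure (Q n) U"
    and upper: "\<And>z c. 0 \<le> c \<Longrightarrow> ennreal c < F z \<Longrightarrow>
      \<exists>U. open U \<and> z \<in> U \<and> (\<forall>\<^sub>F n in sequentially. measure (Q n) U \<le> exp (- (b n * c)))"
    and exp_tight: "\<And>L. 0 \<le> L \<Longrightarrow> \<exists>K. compact K \<and> closed K \<and>
      (\<forall>\<^sub>F n in sequentially. measure (Q n) (- K) \<le> exp (- (b n * L)))"
  shows "large_deviations Q b F"
  unfolding large_deviations_def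
proof (intro conjI allI impI)
  have b_pos: "\<forall>\<^sub>F n in sequentially. 0 < b n" using b by (simp add: filterlim_at_top_dense)
  show "prob_space (Q n)" "sets (Q n) = sets borel" for n by (fact Q)+
  show "lower_semicontinuous F" by (fact F)
  show "- enn2ereal (INF z\<in>U. F z) \<le> liminf (\<lambda>n. ereal (1 / b n) * ext_ln (measure (Q n) U))"
    if "open U" for U
  proof (rule liminf_ext_ln_geI[OF b_pos])
    fix c :: real assume "0 \<le> c" "(INF z\<in>U. F z) < ennreal c"
    then obtain z where "z \<in> U" "F z < ennreal c" by (auto simp: INF_less_iff)
    then show "\<forall>\<^sub>F n in sequentially. exp (- (b n * c)) \<le> measure (Q n) U"
      using lower \<open>open U\<close> \<open>0 \<le> c\<close> by simp
  qed
  show "limsup (\<lambda>n. ereal (1 / b n) * ext_ln (measure (Q n) C)) \<le> - enn2ereal (INF z\<in>C. F z)"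
    if C: "closed C" for C
  proof (rule limsup_ext_ln_leI[OF b_pos])
    show "measure (Q n) C \<le> 1" for n using prob_space.prob_le_1[OF Q(1)] .
    fix c :: real assume c: "0 \<le> c" "ennreal c < (INF z\<in>C. F z)"
    \<comment> \<open>The room between \<open>c\<close> and \<open>c'\<close> absorbs the number of covering sets.\<close>
    obtain c' where "ennreal c < ennreal c'" "ennreal c' < (INF z\<in>C. F z)" "0 \<le> c'"
    proof -
      obtain d where "ereal c < ereal d" "ereal d < enn2ereal (INF z\<in>C. F z)"
        using c ennreal_less_iff_ereal ereal_dense2 by blast
      then show ?thesis using that[of d] c(1) by (simp add: ennreal_less_iff ennreal_less_iff_ereal)
    qed
    then have c': "c < c'" "0 \<le> c'" "\<And>z. z \<in> C \<Longrightarrow> ennreal c' < F z"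
      using c(1) by (auto simp: ennreal_less_iff dest: less_INF_D)
    have "\<forall>z\<in>C. \<exists>U. open U \<and> z \<in> U \<and> (\<forall>\<^sub>F n in sequentially. measure (Q n) U \<le> exp (- (b n * c')))"
      using upper c' by blast
    from bchoice[OF this] obtain W where W: "\<And>z. z \<in> C \<Longrightarrow> open (W z)" "\<And>z. z \<in> C \<Longrightarrow> z \<in> W z"
      "\<And>z. z \<in> C \<Longrightarrow> \<forall>\<^sub>F n in sequentially. measure (Q n) (W z) \<le> exp (- (b n * c'))" by blast
    obtain K where K: "compact K" "closed K"
      "\<forall>\<^sub>F n in sequentially. measure (Q n) (- K) \<le> exp (- (b n * c'))"
      using exp_tight[OF c'(2)] by blast
    have "compact (K \<inter> C)" using K(1) C by (rule compact_Int_closed)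
    then obtain D where D: "D \<subseteq> C" "finite D" "K \<inter> C \<subseteq> \<Union>(W ` D)"
    proof (rule compactE_image[of "K \<inter> C" C W])
      show "K \<inter> C \<subseteq> \<Union>(W ` C)" using W(2) by blast
    qed (use W(1) in auto)
    have "\<forall>\<^sub>F n in sequentially. \<forall>z\<in>D. measure (Q n) (W z) \<le> exp (- (b n * c'))"
      using D W(3) by (intro eventually_ball_finite) auto
    moreover have "\<forall>\<^sub>F n in sequentially. ln (real (card D) + 1) / (c' - c) \<le> b n"
      using b by (simp add: filterlim_at_top)
    ultimately show "\<forall>\<^sub>F n in sequentially. measure (Q n) C \<le> exp (- (b n * c))"
      using K(3)
    proof eventually_elim
      case (elim n)
      interpret prob_space "Q n" by (rule Q(1))
      have opn: "\<Union>(W ` D) \<in> sets (Q n)" "- K \<in> sets (Q n)" "\<And>z. z \<in> D \<Longrightarrow> W z \<in> sets (Q n)"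
        using W(1) D(1,2) K(2) by (auto simp: Q(2) subset_iff)
      have "prob C \<le> prob (\<Union>(W ` D) \<union> - K)"
        using D(3) opn by (intro finite_measure_mono) auto
      also have "\<dots> \<le> prob (\<Union>(W ` D)) + prob (- K)" using opn by (intro measure_Un_le)
      also have "prob (\<Union>(W ` D)) \<le> (\<Sum>z\<in>D. prob (W z))"
        using opn D(2) by (intro finite_measure_subadditive_finite) auto
      also have "\<dots> \<le> (\<Sum>z\<in>D. exp (- (b n * c')))" using elim(1) by (intro sum_mono) auto
      finally have "prob C \<le> (real (card D) + 1) * exp (- (b n * c'))"
        using elim(3) by (simp add: algebra_simps)
      also have "\<dots> = exp (ln (real (card D) + 1) - b n * (c' - c)) * exp (- (b n * c))"
        by (simp add: exp_diff exp_minus field_simps mult_exp_exp[symmetric])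
      also have "\<dots> \<le> 1 * exp (- (b n * c))"
        using elim(2) c'(1) by (intro mult_right_mono) (auto simp: field_simps)
      finally show ?case by simp
    qed
  qed
qed

section \<open>Exponential tightness\<close>

lemma finite_balls_cover_measure:
  fixes \<nu> :: "'a :: polish_space borel_prob"
  assumes "0 < \<eta>" "0 < \<delta>"
  obtains S where "finite S" "measure (meas_of \<nu>) (- (\<Union>x\<in>S. ball x \<delta>)) < \<eta>"
proof -
  have "(SUP K \<in> {K. K \<subseteq> UNIV \<and> compact K}. emeasure (meas_of \<nu>) K) = 1"
    using inner_regular[of "meas_of \<nu>" UNIV] by (simp add: meas_of.emeasure_eq_measure)
  moreover have "ennreal (1 - \<eta>) < 1" using \<open>0 < \<eta>\<close> by (simp add: ennreal_less_one_iff)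
  ultimately obtain K where K: "compact K" "ennreal (1 - \<eta>) < emeasure (meas_of \<nu>) K"
    by (metis (mono_tags, lifting) less_SUP_iff mem_Collect_eq)
  then have "1 - \<eta> < measure (meas_of \<nu>) K"
    unfolding meas_of.emeasure_eq_measure
    by (cases "0 \<le> 1 - \<eta>") (auto simp: ennreal_less_iff intro: less_le_trans[OF _ measure_nonneg])
  moreover obtain S where S: "finite S" "K \<subseteq> (\<Union>x\<in>S. ball x \<delta>)"
    using K(1) \<open>0 < \<delta>\<close> unfolding compact_eq_totally_bounded by blast
  moreover have "measure (meas_of \<nu>) K \<le> measure (meas_of \<nu>) (\<Union>x\<in>S. ball x \<delta>)"
    using S by (intro meas_of.finite_measure_mono) auto
  moreover have "measure (meas_of \<nu>) (- (\<Union>x\<in>S. ball x \<delta>)) = 1 - measure (meas_of \<nu>) (\<Union>x\<in>S. ball x \<delta>)"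
    using meas_of.prob_compl[of "\<Union>x\<in>S. ball x \<delta>" \<nu>] unfolding Compl_eq_Diff_UNIV space_meas_of
    by (auto intro!: borel_open open_UN)
  ultimately show ?thesis using that[OF S(1)] by simp
qed

lemma compl_balls_borel: "- (\<Union>x\<in>S. ball x \<delta>) \<in> sets borel"
  by (intro borel_comp borel_open open_UN) auto

lemma exp_neg_le_half_power:
  assumes "1 \<le> t"
  shows "exp (- (t * real (Suc k))) \<le> (1/2) ^ Suc k"
proof -
  have "2 \<le> exp (1 :: real)" using exp_ge_add_one_self[of 1] by simp
  also have "\<dots> \<le> exp t" using assms by simp
  finally have "exp (- t) \<le> 1/2" by (simp add: exp_minus field_simps)
  then have "exp (- t) ^ Suc k \<le> (1/2) ^ Suc k" by (rule power_mono) simp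
  then show ?thesis unfolding exp_of_nat_mult[symmetric] by (simp only: mult.commute mult_minus_left)
qed

lemma measure_UN_le_geometric:
  fixes M :: "'b measure"
  assumes "prob_space M" and A: "\<And>k. A k \<in> sets M" and c: "0 \<le> c"
    and le: "\<And>k. measure M (A k) \<le> c * (1/2) ^ Suc k"
  shows "measure M (\<Union>k. A k) \<le> c"
proof -
  interpret prob_space M by fact
  have s: "(\<lambda>k. c * (1/2) ^ Suc k) sums c" using sums_mult[OF power_half_series, of c] by simp
  have sm: "summable (\<lambda>k. measure M (A k))"
    using le by (intro summable_comparison_test'[OF sums_summable[OF s]]) auto
  have "measure M (\<Union>k. A k) \<le> (\<Sum>k. measure M (A k))"
    using A sm by (intro finite_measure_subadditive_countably) auto
  also have "\<dots> \<le> (\<Sum>k. c * (1/2) ^ Suc k)"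
    by (intro suminf_le le sm sums_summable[OF s])
  finally show ?thesis using sums_unique[OF s] by simp
qed

text \<open>The construction of compact sets as intersections of finite unions of balls with shrinking radii,
on an exponential scale. The hypothesis concerns large \<open>n\<close> only, depending on
the level and the radius; since a single measure is tight, finitely many more balls make each bound hold from
a common index on.\<close>

lemma uniform_compact_of_finite_balls:
  fixes \<mu>s :: "nat \<Rightarrow> 'a :: polish_space borel_prob"
  assumes b: "\<And>n. N \<le> n \<Longrightarrow> 1 \<le> b n"
    and balls: "\<And>L \<delta>. 0 \<le> L \<Longrightarrow> 0 < \<delta> \<Longrightarrow> \<exists>S. finite S \<and>
      (\<forall>\<^sub>F n in sequentially. measure (meas_of (\<mu>s n)) (- (\<Union>x\<in>S. ball x \<delta>)) \<le> exp (- (b n * L)))"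
    and "0 \<le> L"
  obtains K where "compact K" "\<And>n. N \<le> n \<Longrightarrow> measure (meas_of (\<mu>s n)) (- K) \<le> exp (- (b n * L))"
proof -
  have mono: "measure (meas_of \<nu>) (- (\<Union>x\<in>T. ball x \<delta>)) \<le> measure (meas_of \<nu>) (- (\<Union>x\<in>S. ball x \<delta>))"
    if "S \<subseteq> T" for S T \<delta> and \<nu> :: "'a borel_prob"
    using that compl_balls_borel by (intro meas_of.finite_measure_mono) auto
  have "\<exists>S. finite S \<and> (\<forall>n\<ge>N. measure (meas_of (\<mu>s n)) (- (\<Union>x\<in>S. ball x (1 / real (Suc k))))
      \<le> exp (- (b n * (L + real (Suc k)))))" for k
  proof -
    define \<delta> where "\<delta> = 1 / real (Suc k)"
    have "0 < \<delta>" by (simp add: \<delta>_def)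
    obtain S N' where S: "finite S"
      "\<And>n. N' \<le> n \<Longrightarrow> measure (meas_of (\<mu>s n)) (- (\<Union>x\<in>S. ball x \<delta>)) \<le> exp (- (b n * (L + real (Suc k))))"
      using balls[of "L + real (Suc k)" \<delta>] \<open>0 < \<delta>\<close> \<open>0 \<le> L\<close> unfolding eventually_sequentially by force
    have "\<exists>S. finite S \<and> measure (meas_of (\<mu>s n)) (- (\<Union>x\<in>S. ball x \<delta>)) < exp (- (b n * (L + real (Suc k))))" for n
      by (rule finite_balls_cover_measure[OF exp_gt_zero \<open>0 < \<delta>\<close>]) blast
    then have "\<forall>n. \<exists>S. finite S \<and> measure (meas_of (\<mu>s n)) (- (\<Union>x\<in>S. ball x \<delta>)) < exp (- (b n * (L + real (Suc k))))"
      by (rule allI)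
    from choice[OF this] obtain S' where S': "\<And>n. finite (S' n)"
      "\<And>n. measure (meas_of (\<mu>s n)) (- (\<Union>x\<in>S' n. ball x \<delta>)) < exp (- (b n * (L + real (Suc k))))" by blast
    define T where "T = S \<union> (\<Union>n<N'. S' n)"
    have "measure (meas_of (\<mu>s n)) (- (\<Union>x\<in>T. ball x \<delta>)) \<le> exp (- (b n * (L + real (Suc k))))" for n
    proof (cases "N' \<le> n")
      case True
      have "S \<subseteq> T" by (auto simp: T_def)
      from order_trans[OF mono[OF this] S(2)[OF True]] show ?thesis .
    next
      case False
      then have "S' n \<subseteq> T" by (auto simp: T_def)
      from order_trans[OF mono[OF this] less_imp_le[OF S'(2)]] show ?thesis .
    qed
    moreover have "finite T" using S(1) S'(1) by (simp add: T_def)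
    ultimately show ?thesis unfolding \<delta>_def by blast
  qed
  then have "\<forall>k. \<exists>S. finite S \<and> (\<forall>n\<ge>N. measure (meas_of (\<mu>s n)) (- (\<Union>x\<in>S. ball x (1 / real (Suc k))))
      \<le> exp (- (b n * (L + real (Suc k)))))" by (rule allI)
  from choice[OF this] obtain S where S: "\<And>k. finite (S k)"
    "\<And>k n. N \<le> n \<Longrightarrow> measure (meas_of (\<mu>s n)) (- (\<Union>x\<in>S k. ball x (1 / real (Suc k))))
      \<le> exp (- (b n * (L + real (Suc k))))" by blast
  define C where "C k = (\<Union>x\<in>S k. cball x (1 / real (Suc k)))" for k
  define K where "K = (\<Inter>k. C k)"
  have C: "closed (C k)" for k unfolding C_def using S(1) by (intro closed_UN) auto
  then have "closed K" unfolding K_def by (intro closed_INT) auto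
  have "compact K"
    unfolding compact_eq_totally_bounded complete_eq_closed
  proof (intro conjI allI impI)
    show "closed K" by fact
    fix e :: real assume "0 < e"
    then obtain k where k: "1 / real (Suc k) < e" using nat_approx_posE by metis
    have "K \<subseteq> C k" by (auto simp: K_def)
    also have "\<dots> \<subseteq> (\<Union>x\<in>S k. ball x e)" unfolding C_def using k by (force intro: le_less_trans)
    finally show "\<exists>T. finite T \<and> K \<subseteq> (\<Union>x\<in>T. ball x e)" using S(1) by blast
  qed
  moreover have "measure (meas_of (\<mu>s n)) (- K) \<le> exp (- (b n * L))" if "N \<le> n" for n
  proof -
    have "measure (meas_of (\<mu>s n)) (\<Union>k. - C k) \<le> exp (- (b n * L))"
    proof (rule measure_UN_le_geometric[OF prob_space_meas_of])
      show "- C k \<in> sets (meas_of (\<mu>s n))" for k using C by (simp add: borel_comp)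
      fix k
      have "measure (meas_of (\<mu>s n)) (- C k) \<le> measure (meas_of (\<mu>s n)) (- (\<Union>x\<in>S k. ball x (1 / real (Suc k))))"
        unfolding C_def using compl_balls_borel ball_subset_cball by (intro meas_of.finite_measure_mono) (auto, force)
      also have "\<dots> \<le> exp (- (b n * (L + real (Suc k))))" using S(2)[OF that] .
      also have "\<dots> = exp (- (b n * L)) * exp (- (b n * real (Suc k)))"
        by (simp add: mult_exp_exp algebra_simps)
      also have "\<dots> \<le> exp (- (b n * L)) * (1/2) ^ Suc k"
        using b[OF that] by (intro mult_left_mono exp_neg_le_half_power) auto
      finally show "measure (meas_of (\<mu>s n)) (- C k) \<le> exp (- (b n * L)) * (1/2) ^ Suc k" .
    qed simp
    then show ?thesis by (simp add: K_def Compl_INT)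
  qed
  ultimately show ?thesis using that by blast
qed

text \<open>The exponential Chebyshev inequality for the multiple \<open>\<theta>\<close> of the indicator of \<open>U\<close>, whose exponential
moment is at most \<open>1 + e\<^sup>\<theta> \<mu>(U) \<le> 2\<close>.\<close>

lemma empirical_law_mass_deviation:
  fixes \<mu> :: "'a :: polish_space borel_prob"
  assumes n: "1 \<le> n" and U: "open U" and \<theta>: "0 \<le> \<theta>" and mass: "measure (meas_of \<mu>) U \<le> exp (- \<theta>)"
  shows "measure (empirical_law n \<mu>) {\<nu>. r < measure (meas_of \<nu>) U} \<le> (2 * exp (- (\<theta> * r))) ^ n"
proof -
  have [measurable]: "U \<in> sets borel" using U by simp
  define g where "g x = \<theta> * indicator U x" for x :: 'a
  have g: "g \<in> borel_measurable borel" "bounded (range g)"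
    using U \<theta> unfolding g_def
    by (auto intro!: bounded_rangeI[of _ \<theta>] borel_measurable_times borel_measurable_indicator split: split_indicator)
  have Eg: "expect \<nu> g = \<theta> * measure (meas_of \<nu>) U" for \<nu> using U unfolding g_def by simp
  have "measure (empirical_law n \<mu>) {\<nu>. r < measure (meas_of \<nu>) U}
      \<le> (exp (- (\<theta> * r)) * expect \<mu> (\<lambda>x. exp (g x))) ^ n"
    using n g open_measure_gt[OF U] \<theta>
    by (intro empirical_law_chernoff) (auto simp: Eg intro!: mult_left_mono)
  also have "\<dots> \<le> (exp (- (\<theta> * r)) * 2) ^ n"
  proof (intro power_mono mult_left_mono mult_nonneg_nonneg)
    have "expect \<mu> (\<lambda>x. exp (g x)) \<le> expect \<mu> (\<lambda>x. 1 + exp \<theta> * indicator U x)"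
    proof (intro integral_mono integrable_meas_of bounded_rangeI[of _ "1 + exp \<theta>"])
      show "(\<lambda>x. exp (g x)) \<in> borel_measurable borel" "(\<lambda>x. 1 + exp \<theta> * indicator U x) \<in> borel_measurable borel"
        using g(1) by measurable
    qed (use \<theta> in \<open>auto simp: g_def indicator_def\<close>)
    also have "\<dots> = 1 + exp \<theta> * measure (meas_of \<mu>) U"
      using U by (subst Bochner_Integration.integral_add) (auto intro!: integrable_real_indicator simp: meas_of.emeasure_eq_measure)
    also have "\<dots> \<le> 1 + exp \<theta> * exp (- \<theta>)" using mass by simp
    finally show "expect \<mu> (\<lambda>x. exp (g x)) \<le> 2" by (simp add: mult_exp_exp)
  qed auto
  finally show ?thesis by (simp add: mult.commute)
qed

text \<open>Exponential tightness lifts from the points to the empirical measures: the compact sets of measures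
are those of \<open>compact_tight\<close>, built on compact sets \<open>K\<^sub>k\<close> whose complements have a mass so small that
a fraction \<open>1 / (k + 1)\<close> of the sample falls outside \<open>K\<^sub>k\<close> with a probability summable in \<open>k\<close>.\<close>

lemma empirical_law_exponentially_tight:
  fixes \<mu>s :: "nat \<Rightarrow> 'a :: polish_space borel_prob"
  assumes b: "\<And>n. N \<le> n \<Longrightarrow> 1 \<le> b n"
    and cpt: "\<And>L. 0 \<le> L \<Longrightarrow> \<exists>K. compact K \<and> (\<forall>n\<ge>N. measure (meas_of (\<mu>s n)) (- K) \<le> exp (- (b n * L)))"
    and L: "0 \<le> L"
  shows "\<exists>T. compact T \<and> closed T \<and>
    (\<forall>\<^sub>F n in sequentially. measure (empirical_law n (\<mu>s n)) (- T) \<le> exp (- (real n * b n * L)))"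
proof -
  \<comment> \<open>The factor \<open>Suc k\<close> compensates the threshold \<open>r k\<close>, the term \<open>real (Suc k)\<close> makes the bounds summable, and the last \<open>1\<close> absorbs the factor 2 in the bound on the deviation of the mass.\<close>
  define l where "l k = real (Suc k) * (L + real (Suc k) + 1)" for k
  have l0: "0 \<le> l k" for k using L by (simp add: l_def)
  have "\<forall>k. \<exists>K. compact K \<and> (\<forall>n\<ge>N. measure (meas_of (\<mu>s n)) (- K) \<le> exp (- (b n * l k)))"
    using cpt l0 by blast
  from choice[OF this] obtain K where K: "\<And>k. compact (K k)"
    "\<And>k n. N \<le> n \<Longrightarrow> measure (meas_of (\<mu>s n)) (- K k) \<le> exp (- (b n * l k))" by blast
  define r where "r k = 1 / real (Suc k)" for k
  define T where "T = {\<nu>. \<forall>k. measure (meas_of \<nu>) (- K k) \<le> r k}"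
  have "r \<longlonglongrightarrow> 0" unfolding r_def by (rule LIMSEQ_Suc[OF lim_1_over_n])
  then have "compact T" unfolding T_def using K(1) by (intro compact_tight)
  moreover have "closed T"
    unfolding T_def Collect_all_eq by (intro closed_INT ballI closed_measure_compl_le compact_imp_closed K)
  moreover have "measure (empirical_law n (\<mu>s n)) (- T) \<le> exp (- (real n * b n * L))" if n: "max N 1 \<le> n" for n
  proof -
    define A where "A k = {\<nu>. r k < measure (meas_of \<nu>) (- K k)}" for k
    have op: "open (- K k)" for k using compact_imp_closed[OF K(1)] by (simp add: open_Compl)
    have bn: "1 \<le> b n" using n b by simp
    have "measure (empirical_law n (\<mu>s n)) (\<Union>k. A k) \<le> exp (- (real n * b n * L))"
    proof (rule measure_UN_le_geometric[OF prob_space_empirical_law])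
      show "A k \<in> sets (empirical_law n (\<mu>s n))" for k
        using open_measure_gt[OF op] by (simp add: A_def)
      fix k
      have "measure (empirical_law n (\<mu>s n)) (A k) \<le> (2 * exp (- (b n * l k * r k))) ^ n"
        unfolding A_def using n bn l0[of k] K(2)[of n k]
        by (intro empirical_law_mass_deviation op) auto
      also have "\<dots> \<le> exp (- (b n * (L + real (Suc k)))) ^ n"
      proof (rule power_mono)
        have "l k * r k = L + real (Suc k) + 1" by (simp add: l_def r_def)
        then have "2 * exp (- (b n * l k * r k)) = (2 * exp (- b n)) * exp (- (b n * (L + real (Suc k))))"
          by (simp add: mult.assoc mult_exp_exp algebra_simps)
        also have "2 * exp (- b n) \<le> 1" using exp_neg_le_half_power[OF bn, of 0] by simp
        finally show "2 * exp (- (b n * l k * r k)) \<le> exp (- (b n * (L + real (Suc k))))" by simp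
      qed simp
      also have "\<dots> = exp (- (real n * b n * L)) * exp (- (real n * b n * real (Suc k)))"
        by (simp add: exp_of_nat_mult[symmetric] mult_exp_exp algebra_simps)
      also have "1 * 1 \<le> real n * b n" using n bn by (intro mult_mono) auto
      then have "exp (- (real n * b n * real (Suc k))) \<le> (1/2) ^ Suc k"
        by (intro exp_neg_le_half_power) simp
      finally show "measure (empirical_law n (\<mu>s n)) (A k) \<le> exp (- (real n * b n * L)) * (1/2) ^ Suc k" by simp
    qed simp
    moreover have "- T = (\<Union>k. A k)" unfolding T_def A_def by (simp add: set_eq_iff not_le)
    ultimately show ?thesis by simp
  qed
  ultimately show ?thesis unfolding eventually_sequentially by blast
qed



section \<open>Relative entropy\<close>

text \<open>Regularity of both measures gives a closed set inside \<open>A\<close> and an open set around it that differ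
little in mass; Urysohn's function between them is the approximation.\<close>

lemma bcont_approx_indicator:
  fixes \<nu> \<mu> :: "'a :: polish_space borel_prob"
  assumes A: "A \<in> sets borel" and "0 < \<epsilon>"
  shows "\<exists>f. bcont f \<and> expect \<nu> (\<lambda>x. \<bar>indicator A x - f x\<bar>) < \<epsilon> \<and> expect \<mu> (\<lambda>x. \<bar>indicator A x - f x\<bar>) < \<epsilon>"
proof -
  have reg: "\<exists>K U. compact K \<and> open U \<and> K \<subseteq> A \<and> A \<subseteq> U \<and> measure (meas_of \<kappa>) (U - K) < \<epsilon>"
    for \<kappa> :: "'a borel_prob"
  proof -
    have "(SUP K \<in> {K. K \<subseteq> A \<and> compact K}. emeasure (meas_of \<kappa>) K) = emeasure (meas_of \<kappa>) A"
      using inner_regular[of "meas_of \<kappa>" A] A by (simp add: meas_of.emeasure_eq_measure)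
    moreover have "0 \<in> emeasure (meas_of \<kappa>) ` {K. K \<subseteq> A \<and> compact K}" by (rule image_eqI[of _ _ "{}"]) auto
    ultimately obtain K where K: "K \<subseteq> A" "compact K"
      "emeasure (meas_of \<kappa>) A < emeasure (meas_of \<kappa>) K + ennreal (\<epsilon> / 2)"
      using SUP_approx_ennreal[of "\<epsilon> / 2" "{K. K \<subseteq> A \<and> compact K}" "emeasure (meas_of \<kappa>) A" "emeasure (meas_of \<kappa>)"]
        \<open>0 < \<epsilon>\<close> by (auto simp: meas_of.emeasure_eq_measure)
    have "(INF U \<in> {U. A \<subseteq> U \<and> open U}. emeasure (meas_of \<kappa>) U) = emeasure (meas_of \<kappa>) A"
      using outer_regular[of "meas_of \<kappa>" A] A by (simp add: meas_of.emeasure_eq_measure)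
    then obtain U where U: "A \<subseteq> U" "open U"
      "emeasure (meas_of \<kappa>) U < emeasure (meas_of \<kappa>) A + ennreal (\<epsilon> / 2)"
      using INF_approx_ennreal[of "\<epsilon> / 2" "emeasure (meas_of \<kappa>) A" "emeasure (meas_of \<kappa>)" "{U. A \<subseteq> U \<and> open U}"]
        \<open>0 < \<epsilon>\<close> by (auto simp: meas_of.emeasure_eq_measure)
    have "measure (meas_of \<kappa>) A < measure (meas_of \<kappa>) K + \<epsilon> / 2"
      "measure (meas_of \<kappa>) U < measure (meas_of \<kappa>) A + \<epsilon> / 2"
      using K(3) U(3) \<open>0 < \<epsilon>\<close>
      by (simp_all add: meas_of.emeasure_eq_measure ennreal_plus[symmetric] ennreal_less_iff del: ennreal_plus)
    moreover have "measure (meas_of \<kappa>) (U - K) = measure (meas_of \<kappa>) U - measure (meas_of \<kappa>) K"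
      using K U by (intro meas_of.finite_measure_Diff) (auto simp: borel_compact)
    ultimately show ?thesis using K U by (intro exI[of _ K] exI[of _ U]) auto
  qed
  obtain K1 U1 K2 U2 where KU: "compact K1" "open U1" "K1 \<subseteq> A" "A \<subseteq> U1" "measure (meas_of \<nu>) (U1 - K1) < \<epsilon>"
    "compact K2" "open U2" "K2 \<subseteq> A" "A \<subseteq> U2" "measure (meas_of \<mu>) (U2 - K2) < \<epsilon>"
    using reg[of \<nu>] reg[of \<mu>] by metis
  define K where "K = K1 \<union> K2"
  define U where "U = U1 \<inter> U2"
  have K: "closed K" "K \<subseteq> A" and U: "open U" "A \<subseteq> U"
    using KU by (auto simp: K_def U_def compact_imp_closed)
  have "normal_space (euclidean :: 'a topology)"
    by (intro metrizable_imp_normal_space metrizable_space_euclidean)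
  moreover have "disjnt K (- U)" using K U by (auto simp: disjnt_def)
  ultimately obtain g :: "'a \<Rightarrow> real" where g: "continuous_map euclidean euclideanreal g"
    "g ` K \<subseteq> {1}" "g ` (- U) \<subseteq> {0}"
    using Urysohn_lemma_alt[of euclidean K "- U" 1 0] K(1) U(1) by (metis closed_closedin closed_Compl)
  define f where "f x = max 0 (min 1 (g x))" for x
  have f: "continuous_on UNIV f" "\<And>x. x \<in> K \<Longrightarrow> f x = 1" "\<And>x. x \<in> - U \<Longrightarrow> f x = 0"
    using g by (auto simp: f_def intro!: continuous_intros)
  have f01: "0 \<le> f x" "f x \<le> 1" for x by (auto simp: f_def)
  have "bcont f" unfolding bcont_def using f01 by (auto intro!: f(1) bounded_rangeI[of _ 1])
  have le: "\<bar>indicator A x - f x\<bar> \<le> indicator (U - K) x" for x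
    using f(2)[of x] f(3)[of x] f01[of x] K(2) U(2) by (auto simp: indicator_def)
  have b: "expect \<kappa> (\<lambda>x. \<bar>indicator A x - f x\<bar>) \<le> measure (meas_of \<kappa>) (U - K)" for \<kappa>
  proof -
    have "expect \<kappa> (\<lambda>x. \<bar>indicator A x - f x\<bar>) \<le> expect \<kappa> (indicator (U - K))"
      using A K U \<open>bcont f\<close> by (intro integral_mono le integrable_abs Bochner_Integration.integrable_diff
          bcont_integrable integrable_real_indicator) (auto simp: meas_of.emeasure_eq_measure)
    then show ?thesis using K U by simp
  qed
  have "measure (meas_of \<nu>) (U - K) \<le> measure (meas_of \<nu>) (U1 - K1)"
    "measure (meas_of \<mu>) (U - K) \<le> measure (meas_of \<mu>) (U2 - K2)"
    using KU by (auto simp: U_def K_def borel_compact intro!: meas_of.finite_measure_mono)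
  then show ?thesis using b[of \<nu>] b[of \<mu>] KU(5,10) \<open>bcont f\<close> by (intro exI[of _ f]) auto
qed

lemma bcont_dense_nonneg:
  fixes \<nu> \<mu> :: "'a :: polish_space borel_prob" and \<phi> :: "'a \<Rightarrow> real"
  assumes "\<phi> \<in> borel_measurable borel" "\<And>x. 0 \<le> \<phi> x" "bounded (range \<phi>)" "0 < \<epsilon>"
  shows "\<exists>f. bcont f \<and> expect \<nu> (\<lambda>x. \<bar>\<phi> x - f x\<bar>) < \<epsilon> \<and> expect \<mu> (\<lambda>x. \<bar>\<phi> x - f x\<bar>) < \<epsilon>"
  using assms
proof (induction \<phi> arbitrary: \<epsilon> rule: borel_measurable_induct_real)
  case (set A)
  then show ?case by (intro bcont_approx_indicator) auto
next
  case (mult u c)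
  show ?case
  proof (cases "c = 0")
    case True
    then show ?thesis using mult by (intro exI[of _ "\<lambda>_. 0"]) auto
  next
    case False
    then have c: "0 < c" using mult by simp
    obtain M where M: "\<And>x. \<bar>c * u x\<bar> \<le> M" using mult.prems bounded_rangeE by metis
    have "bounded (range u)"
    proof (rule bounded_rangeI)
      show "\<bar>u x\<bar> \<le> M / c" for x using M[of x] c by (simp add: field_simps abs_mult)
    qed
    then obtain f where f: "bcont f" "expect \<nu> (\<lambda>x. \<bar>u x - f x\<bar>) < \<epsilon> / c" "expect \<mu> (\<lambda>x. \<bar>u x - f x\<bar>) < \<epsilon> / c"
      using mult.IH[of "\<epsilon> / c"] c mult.prems by auto
    have "\<bar>c * u x - c * f x\<bar> = c * \<bar>u x - f x\<bar>" for x
      using c by (simp add: abs_mult right_diff_distrib[symmetric])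
    then show ?thesis using f c by (intro exI[of _ "\<lambda>x. c * f x"]) (auto simp: bcont_scale field_simps)
  qed
next
  case (add u v)
  obtain M where M: "\<And>x. \<bar>v x + u x\<bar> \<le> M" using add.prems bounded_rangeE by metis
  have bd: "bounded (range u)" "bounded (range v)"
  proof -
    have "\<bar>u x\<bar> \<le> M" "\<bar>v x\<bar> \<le> M" for x using M[of x] add.hyps(2)[of x] add.hyps(4)[of x] by auto
    then show "bounded (range u)" "bounded (range v)" by (auto intro: bounded_rangeI)
  qed
  have "0 < \<epsilon> / 2" using add.prems by simp
  obtain f where f: "bcont f" "expect \<nu> (\<lambda>x. \<bar>u x - f x\<bar>) < \<epsilon> / 2" "expect \<mu> (\<lambda>x. \<bar>u x - f x\<bar>) < \<epsilon> / 2"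
    using add.IH(1)[OF bd(1) \<open>0 < \<epsilon> / 2\<close>] by blast
  obtain g where g: "bcont g" "expect \<nu> (\<lambda>x. \<bar>v x - g x\<bar>) < \<epsilon> / 2" "expect \<mu> (\<lambda>x. \<bar>v x - g x\<bar>) < \<epsilon> / 2"
    using add.IH(2)[OF bd(2) \<open>0 < \<epsilon> / 2\<close>] by blast
  have "expect \<kappa> (\<lambda>x. \<bar>v x + u x - (g x + f x)\<bar>) \<le> expect \<kappa> (\<lambda>x. \<bar>v x - g x\<bar>) + expect \<kappa> (\<lambda>x. \<bar>u x - f x\<bar>)"
    for \<kappa> :: "'a borel_prob"
  proof -
    have int: "integrable (meas_of \<kappa>) u" "integrable (meas_of \<kappa>) v"
      using add.hyps bd by (auto intro: integrable_meas_of)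
    have "expect \<kappa> (\<lambda>x. \<bar>v x + u x - (g x + f x)\<bar>) \<le> expect \<kappa> (\<lambda>x. \<bar>v x - g x\<bar> + \<bar>u x - f x\<bar>)"
      using int f(1) g(1) by (intro integral_mono) auto
    then show ?thesis using int f(1) g(1) by simp
  qed
  note this[of \<nu>] this[of \<mu>]
  then show ?case using f g by (intro exI[of _ "\<lambda>x. g x + f x"]) (auto simp: bcont_add)
next
  case (seq U)
  obtain M where M: "\<And>x. \<bar>\<phi> x\<bar> \<le> M" using seq.prems bounded_rangeE by metis
  have U_le: "U i x \<le> \<phi> x" for i x
    using seq.hyps(3) seq.hyps(4)[of x] by (intro incseq_le) (auto simp: incseq_def le_fun_def)
  have bd: "\<bar>U i x\<bar> \<le> M" for i x using U_le[of i x] seq.hyps(2)[of i x] M[of x] by simp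
  have int: "integrable (meas_of \<kappa>) \<phi>" "integrable (meas_of \<kappa>) (U i)" for i and \<kappa> :: "'a borel_prob"
    using assms(1) seq.hyps(1) seq.prems bd by (auto intro!: integrable_meas_of bounded_rangeI[of _ M])
  have "(\<lambda>i. expect \<kappa> (\<lambda>x. \<bar>\<phi> x - U i x\<bar>)) \<longlonglongrightarrow> expect \<kappa> (\<lambda>_. 0)" for \<kappa> :: "'a borel_prob"
  proof (rule integral_dominated_convergence[where w = "\<lambda>_. 2 * M"])
    show "AE x in meas_of \<kappa>. (\<lambda>i. \<bar>\<phi> x - U i x\<bar>) \<longlonglongrightarrow> 0"
    proof (rule AE_I2)
      fix x
      have "(\<lambda>i. \<bar>\<phi> x - U i x\<bar>) \<longlonglongrightarrow> \<bar>\<phi> x - \<phi> x\<bar>"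
        using seq.hyps(4)[of x] by (intro tendsto_intros) auto
      then show "(\<lambda>i. \<bar>\<phi> x - U i x\<bar>) \<longlonglongrightarrow> 0" by simp
    qed
    show "AE x in meas_of \<kappa>. norm \<bar>\<phi> x - U i x\<bar> \<le> 2 * M" for i
    proof (rule AE_I2)
      show "norm \<bar>\<phi> x - U i x\<bar> \<le> 2 * M" for x using M[of x] bd[of i x] by simp
    qed
  qed (use assms(1) seq.hyps(1) in auto)
  then have lim: "(\<lambda>i. expect \<kappa> (\<lambda>x. \<bar>\<phi> x - U i x\<bar>)) \<longlonglongrightarrow> 0" for \<kappa> :: "'a borel_prob" by simp
  have "0 < \<epsilon> / 2" using seq.prems by simp
  have "\<forall>\<^sub>F i in sequentially. expect \<nu> (\<lambda>x. \<bar>\<phi> x - U i x\<bar>) < \<epsilon> / 2 \<and> expect \<mu> (\<lambda>x. \<bar>\<phi> x - U i x\<bar>) < \<epsilon> / 2"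
    using order_tendstoD(2)[OF lim \<open>0 < \<epsilon> / 2\<close>] by (intro eventually_conj) auto
  then obtain i where i: "expect \<nu> (\<lambda>x. \<bar>\<phi> x - U i x\<bar>) < \<epsilon> / 2" "expect \<mu> (\<lambda>x. \<bar>\<phi> x - U i x\<bar>) < \<epsilon> / 2"
    using eventually_happens'[OF sequentially_bot] by blast
  have "bounded (range (U i))" using bd by (rule bounded_rangeI)
  then obtain f where f: "bcont f" "expect \<nu> (\<lambda>x. \<bar>U i x - f x\<bar>) < \<epsilon> / 2" "expect \<mu> (\<lambda>x. \<bar>U i x - f x\<bar>) < \<epsilon> / 2"
    using seq.IH[OF _ \<open>0 < \<epsilon> / 2\<close>] by blast
  have "expect \<kappa> (\<lambda>x. \<bar>\<phi> x - f x\<bar>) \<le> expect \<kappa> (\<lambda>x. \<bar>\<phi> x - U i x\<bar>) + expect \<kappa> (\<lambda>x. \<bar>U i x - f x\<bar>)"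
    for \<kappa> :: "'a borel_prob"
  proof -
    have "expect \<kappa> (\<lambda>x. \<bar>\<phi> x - f x\<bar>) \<le> expect \<kappa> (\<lambda>x. \<bar>\<phi> x - U i x\<bar> + \<bar>U i x - f x\<bar>)"
      using int f(1) by (intro integral_mono) auto
    then show ?thesis using int f(1) by simp
  qed
  note this[of \<nu>] this[of \<mu>]
  then show ?case using f i by (intro exI[of _ f]) auto
qed

text \<open>Bounded continuous functions are dense in \<open>L\<^sup>1\<close>, for two measures at once. Keeping the bound \<open>M\<close> is what
makes the exponentials converge as well.\<close>

lemma bcont_dense:
  fixes \<nu> \<mu> :: "'a :: polish_space borel_prob" and \<phi> :: "'a \<Rightarrow> real"
  assumes \<phi>: "\<phi> \<in> borel_measurable borel" and M: "\<And>x. \<bar>\<phi> x\<bar> \<le> M" and "0 < \<epsilon>"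
  obtains f where "bcont f" "\<And>x. \<bar>f x\<bar> \<le> M" "expect \<nu> (\<lambda>x. \<bar>\<phi> x - f x\<bar>) < \<epsilon>" "expect \<mu> (\<lambda>x. \<bar>\<phi> x - f x\<bar>) < \<epsilon>"
proof -
  have nn: "0 \<le> \<phi> x + M" for x using M[of x] by (simp add: abs_le_iff)
  have bd: "bounded (range (\<lambda>x. \<phi> x + M))"
  proof (rule bounded_rangeI)
    show "\<bar>\<phi> x + M\<bar> \<le> 2 * M" for x using M[of x] by (simp add: abs_le_iff)
  qed
  obtain g where g: "bcont g" "expect \<nu> (\<lambda>x. \<bar>\<phi> x + M - g x\<bar>) < \<epsilon>" "expect \<mu> (\<lambda>x. \<bar>\<phi> x + M - g x\<bar>) < \<epsilon>"
    using bcont_dense_nonneg[of "\<lambda>x. \<phi> x + M", OF _ nn bd \<open>0 < \<epsilon>\<close>] \<phi> by auto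
  define f where "f x = max (- M) (min M (g x - M))" for x
  have "0 \<le> M" using M abs_ge_zero order_trans by blast
  have fM: "\<bar>f x\<bar> \<le> M" for x using \<open>0 \<le> M\<close> by (simp add: f_def abs_le_iff)
  have "continuous_on UNIV f"
    using g(1) unfolding f_def bcont_def by (auto intro!: continuous_intros)
  then have f: "bcont f" unfolding bcont_def using fM by (auto intro: bounded_rangeI)
  have le: "\<bar>\<phi> x - f x\<bar> \<le> \<bar>\<phi> x + M - g x\<bar>" for x
    using M[of x] \<open>0 \<le> M\<close> unfolding f_def by (auto simp: max_def min_def)
  have "expect \<kappa> (\<lambda>x. \<bar>\<phi> x - f x\<bar>) \<le> expect \<kappa> (\<lambda>x. \<bar>\<phi> x + M - g x\<bar>)" for \<kappa>
    using f g(1) integrable_meas_of[OF \<phi> bounded_rangeI[OF M]] by (intro integral_mono le) auto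
  from this[of \<nu>] this[of \<mu>] show ?thesis using that[OF f fM] g by auto
qed

lemma abs_exp_diff_le:
  fixes a b :: real
  assumes "a \<le> M" "b \<le> M"
  shows "\<bar>exp a - exp b\<bar> \<le> exp M * \<bar>a - b\<bar>"
proof -
  have *: "exp a - exp b \<le> exp M * (a - b)" if "b \<le> a" "a \<le> M" for a b :: real
  proof -
    have "1 + (b - a) \<le> exp (b - a)" by (rule exp_ge_add_one_self)
    then have "1 - exp (b - a) \<le> a - b" by linarith
    then have "exp a * (1 - exp (b - a)) \<le> exp a * (a - b)" by (intro mult_left_mono) auto
    also have "\<dots> \<le> exp M * (a - b)" using that by (intro mult_right_mono) auto
    finally show ?thesis by (simp add: right_diff_distrib mult_exp_exp)
  qed
  show ?thesis using *[of b a] *[of a b] assms by (cases "b \<le> a") auto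
qed

text \<open>In the variational formula, continuous test functions suffice. Hence the relative entropy is lower
semicontinuous, and every strict lower bound on it holds throughout a neighbourhood given by a single test function.\<close>

lemma relative_entropy_bcont:
  fixes \<nu> \<mu> :: "'a :: polish_space borel_prob"
  assumes "ereal c < relative_entropy \<nu> \<mu>"
  obtains f where "bcont f" "c < expect \<nu> f - ln (expect \<mu> (\<lambda>x. exp (f x)))"
proof -
  obtain \<phi> :: "'a \<Rightarrow> real" where \<phi>: "\<phi> \<in> borel_measurable borel" "bounded (range \<phi>)"
    "c < expect \<nu> \<phi> - ln (expect \<mu> (\<lambda>x. exp (\<phi> x)))"
    using assms unfolding relative_entropy_def less_SUP_iff by auto
  obtain M where M: "\<And>x. \<bar>\<phi> x\<bar> \<le> M" using bounded_rangeE[OF \<phi>(2)] by metis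
  have "\<exists>f. bcont f \<and> (\<forall>x. \<bar>f x\<bar> \<le> M) \<and> expect \<nu> (\<lambda>x. \<bar>\<phi> x - f x\<bar>) < 1 / real (Suc k) \<and>
      expect \<mu> (\<lambda>x. \<bar>\<phi> x - f x\<bar>) < 1 / real (Suc k)" for k
    by (rule bcont_dense[OF \<phi>(1) M, of "1 / real (Suc k)" \<nu> \<mu>]) auto
  then have "\<forall>k. \<exists>f. bcont f \<and> (\<forall>x. \<bar>f x\<bar> \<le> M) \<and> expect \<nu> (\<lambda>x. \<bar>\<phi> x - f x\<bar>) < 1 / real (Suc k) \<and>
      expect \<mu> (\<lambda>x. \<bar>\<phi> x - f x\<bar>) < 1 / real (Suc k)" by (rule allI)
  from choice[OF this] obtain f where f: "\<And>k. bcont (f k)" "\<And>k x. \<bar>f k x\<bar> \<le> M"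
    "\<And>k. expect \<nu> (\<lambda>x. \<bar>\<phi> x - f k x\<bar>) < 1 / real (Suc k)"
    "\<And>k. expect \<mu> (\<lambda>x. \<bar>\<phi> x - f k x\<bar>) < 1 / real (Suc k)" by blast
  have inv0: "(\<lambda>k. C * (1 / real (Suc k))) \<longlonglongrightarrow> 0" for C :: real
    using tendsto_mult_left[OF LIMSEQ_Suc[OF lim_1_over_n], of C] by simp
  have int: "integrable (meas_of \<kappa>) \<phi>" for \<kappa> using \<phi> by (intro integrable_meas_of)
  have inte: "integrable (meas_of \<kappa>) (\<lambda>x. exp (\<phi> x))" for \<kappa>
    using \<phi>(1) M by (intro integrable_meas_of bounded_rangeI[of _ "exp M"]) (auto simp: abs_le_iff)
  have "(\<lambda>k. expect \<nu> (f k)) \<longlonglongrightarrow> expect \<nu> \<phi>"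
  proof (rule Lim_null[THEN iffD2], rule Lim_null_comparison[OF _ inv0[of 1]], rule always_eventually, rule allI)
    fix k
    have "\<bar>expect \<nu> (\<lambda>x. \<phi> x - f k x)\<bar> \<le> expect \<nu> (\<lambda>x. \<bar>\<phi> x - f k x\<bar>)" by (rule integral_abs_bound)
    then show "norm (expect \<nu> (f k) - expect \<nu> \<phi>) \<le> 1 * (1 / real (Suc k))"
      using f(1,3)[of k] int by (simp add: abs_minus_commute)
  qed
  moreover have "(\<lambda>k. expect \<mu> (\<lambda>x. exp (f k x))) \<longlonglongrightarrow> expect \<mu> (\<lambda>x. exp (\<phi> x))"
  proof (rule Lim_null[THEN iffD2], rule Lim_null_comparison[OF _ inv0[of "exp M"]], rule always_eventually, rule allI)
    fix k
    have "\<bar>expect \<mu> (\<lambda>x. exp (f k x)) - expect \<mu> (\<lambda>x. exp (\<phi> x))\<bar> = \<bar>expect \<mu> (\<lambda>x. exp (\<phi> x) - exp (f k x))\<bar>"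
      using inte f(1)[of k] by (simp add: bcont_exp abs_minus_commute)
    also have "\<dots> \<le> expect \<mu> (\<lambda>x. \<bar>exp (\<phi> x) - exp (f k x)\<bar>)" by (rule integral_abs_bound)
    also have "\<dots> \<le> expect \<mu> (\<lambda>x. exp M * \<bar>\<phi> x - f k x\<bar>)"
    proof (rule integral_mono)
      show "\<bar>exp (\<phi> x) - exp (f k x)\<bar> \<le> exp M * \<bar>\<phi> x - f k x\<bar>" for x
        using M[of x] f(2)[of k x] by (intro abs_exp_diff_le) (auto simp: abs_le_iff)
    qed (use inte int f(1)[of k] in \<open>auto simp: bcont_exp\<close>)
    also have "\<dots> = exp M * expect \<mu> (\<lambda>x. \<bar>\<phi> x - f k x\<bar>)" by simp
    also have "\<dots> \<le> exp M * (1 / real (Suc k))" using f(4)[of k] by (intro mult_left_mono) auto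
    finally show "norm (expect \<mu> (\<lambda>x. exp (f k x)) - expect \<mu> (\<lambda>x. exp (\<phi> x))) \<le> exp M * (1 / real (Suc k))"
      by simp
  qed
  moreover have "exp (- M) \<le> expect \<mu> (\<lambda>x. exp (\<phi> x))"
    using inte M by (intro expect_mono_ge) (auto simp: abs_le_iff minus_le_iff)
  then have "expect \<mu> (\<lambda>x. exp (\<phi> x)) \<noteq> 0" using exp_gt_zero[of "- M"] by linarith
  ultimately have "(\<lambda>k. expect \<nu> (f k) - ln (expect \<mu> (\<lambda>x. exp (f k x)))) \<longlonglongrightarrow> expect \<nu> \<phi> - ln (expect \<mu> (\<lambda>x. exp (\<phi> x)))"
    by (intro tendsto_diff tendsto_ln)
  from order_tendstoD(1)[OF this \<phi>(3)]
  obtain k where "c < expect \<nu> (f k) - ln (expect \<mu> (\<lambda>x. exp (f k x)))"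
    using eventually_happens'[OF sequentially_bot] by blast
  then show ?thesis using that f(1) by blast
qed

lemma relative_entropy_ge:
  assumes "bcont f"
  shows "ereal (expect \<nu> f - ln (expect \<mu> (\<lambda>x. exp (f x)))) \<le> relative_entropy \<nu> \<mu>"
  unfolding relative_entropy_def using assms bcont_borel[OF assms]
  by (intro SUP_upper) (auto simp: bcont_def)

lemma enn2ereal_relative_entropy [simp]:
  "enn2ereal (e2ennreal (relative_entropy \<nu> \<mu>)) = relative_entropy \<nu> \<mu>"
  by (rule enn2ereal_e2ennreal) (rule relative_entropy_nonneg)

lemma lower_semicontinuous_relative_entropy:
  fixes \<mu> :: "'a :: polish_space borel_prob"
  shows "lower_semicontinuous (\<lambda>\<nu>. e2ennreal (relative_entropy \<nu> \<mu>))"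
  unfolding lower_semicontinuous_def
proof
  fix c
  have eq: "{\<nu>. c < e2ennreal (relative_entropy \<nu> \<mu>)} = (\<Union>f\<in>Collect bcont.
      {\<nu>. expect \<nu> f \<in> {y. enn2ereal c < ereal (y - ln (expect \<mu> (\<lambda>x. exp (f x))))}})" (is "?L = ?R")
  proof
    show "?R \<subseteq> ?L" using relative_entropy_ge by (auto simp: less_ennreal.rep_eq intro: less_le_trans)
    show "?L \<subseteq> ?R"
    proof
      fix \<nu> assume "\<nu> \<in> ?L"
      then have "enn2ereal c < relative_entropy \<nu> \<mu>" by (simp add: less_ennreal.rep_eq)
      then obtain d where d: "enn2ereal c < ereal d" "ereal d < relative_entropy \<nu> \<mu>"
        using ereal_dense2 by blast
      obtain f where "bcont f" "d < expect \<nu> f - ln (expect \<mu> (\<lambda>x. exp (f x)))"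
        using relative_entropy_bcont[OF d(2)] by blast
      then show "\<nu> \<in> ?R" using d(1) by (auto intro!: exI[of _ f] intro: less_trans)
    qed
  qed
  have op: "open {y. enn2ereal c < ereal (y - l)}" for l :: real
    by (intro open_Collect_less continuous_intros continuous_on_ereal)
  have "open ?R"
    by (rule open_UN, rule ballI, rule open_expect_vimage) (simp, rule op)
  then show "open {\<nu>. c < e2ennreal (relative_entropy \<nu> \<mu>)}" using eq by simp
qed

text \<open>The derivative of \<open>log \<mu>(e\<^sup>f)\<close> in the direction \<open>k\<close> is the integral of \<open>k\<close> against the tilted measure;
here as an inequality with a quadratic error.\<close>

lemma ln_expect_exp_perturb:
  assumes f: "bcont f" and k: "bcont k" "\<And>x. \<bar>k x\<bar> \<le> M" and t: "0 \<le> t" "t * M \<le> 1"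
  shows "ln (expect \<mu> (\<lambda>x. exp (f x + t * k x)))
    \<le> ln (expect \<mu> (\<lambda>x. exp (f x))) + t * expect (tilt \<mu> f) k + t\<^sup>2 * M\<^sup>2"
proof -
  have tk: "bcont (\<lambda>x. t * k x)" using k(1) by (rule bcont_scale)
  have Z: "0 < expect \<mu> (\<lambda>x. exp (f x))" using expect_exp_pos[OF f] .
  have T: "0 < expect (tilt \<mu> f) (\<lambda>x. exp (t * k x))" using expect_exp_pos[OF tk] .
  have "expect \<mu> (\<lambda>x. exp (f x + t * k x)) = expect \<mu> (\<lambda>x. exp (f x)) * expect (tilt \<mu> f) (\<lambda>x. exp (t * k x))"
    unfolding expect_tilt[OF f bcont_exp[OF tk]] using Z by (simp add: exp_add)
  then have "ln (expect \<mu> (\<lambda>x. exp (f x + t * k x)))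
      = ln (expect \<mu> (\<lambda>x. exp (f x))) + ln (expect (tilt \<mu> f) (\<lambda>x. exp (t * k x)))"
    using Z T by (simp add: ln_mult)
  also have "ln (expect (tilt \<mu> f) (\<lambda>x. exp (t * k x))) \<le> ln (exp (t * expect (tilt \<mu> f) k + t\<^sup>2 * M\<^sup>2))"
    using expect_exp_le[OF k t] T by (subst ln_le_cancel_iff) auto
  finally show ?thesis by simp
qed

lemma continuous_log_moment:
  fixes \<mu> :: "'a :: topological_space borel_prob"
  assumes f: "bcont f"
  shows "continuous_on S (\<lambda>s. ln (expect \<mu> (\<lambda>x. exp (s * f x))))"
proof -
  obtain M where M: "0 < M" "\<And>x. \<bar>f x\<bar> \<le> M" using bcontE[OF f] by metis
  define \<Lambda> where "\<Lambda> s = ln (expect \<mu> (\<lambda>x. exp (s * f x)))" for s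
  have le: "\<Lambda> s \<le> \<Lambda> t + M * \<bar>s - t\<bar>" for s t
  proof -
    have pos: "0 < expect \<mu> (\<lambda>x. exp (s * f x))" for s using f by (intro expect_exp_pos bcont_scale)
    have "exp (s * f x) \<le> exp (M * \<bar>s - t\<bar>) * exp (t * f x)" for x
    proof -
      have "\<bar>(s - t) * f x\<bar> \<le> \<bar>s - t\<bar> * M" unfolding abs_mult by (intro mult_left_mono M) auto
      then show ?thesis by (simp add: mult_exp_exp algebra_simps abs_le_iff)
    qed
    then have "expect \<mu> (\<lambda>x. exp (s * f x)) \<le> expect \<mu> (\<lambda>x. exp (M * \<bar>s - t\<bar>) * exp (t * f x))"
      using f by (intro integral_mono bcont_integrable bcont_exp bcont_scale) auto
    also have "\<dots> = exp (M * \<bar>s - t\<bar>) * expect \<mu> (\<lambda>x. exp (t * f x))" by simp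
    finally have "\<Lambda> s \<le> ln (exp (M * \<bar>s - t\<bar>) * expect \<mu> (\<lambda>x. exp (t * f x)))"
      unfolding \<Lambda>_def using pos by (subst ln_le_cancel_iff) auto
    also have "\<dots> = \<Lambda> t + M * \<bar>s - t\<bar>" using pos[of t] by (simp add: \<Lambda>_def ln_mult)
    finally show ?thesis .
  qed
  have "M-lipschitz_on S \<Lambda>"
  proof (rule lipschitz_onI)
    show "dist (\<Lambda> s) (\<Lambda> t) \<le> M * dist s t" for s t
      using le[of s t] le[of t s] by (simp add: dist_real_def abs_le_iff abs_minus_commute)
  qed (use M in simp)
  then show ?thesis unfolding \<Lambda>_def by (rule lipschitz_on_continuous_on)
qed

text \<open>If \<open>s\<close> maximises \<open>r \<nu>(f) - log \<mu>(exp (r f))\<close> on \<open>[0, s]\<close>, the left derivative at \<open>s\<close>,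
which is \<open>\<nu>(f)\<close> minus the integral of \<open>f\<close> against the tilted measure, is nonnegative.\<close>

lemma optimal_scaling_entropy_le:
  fixes \<nu> \<mu> :: "'a :: topological_space borel_prob"
  assumes f: "bcont f" and s: "0 \<le> s"
    and max: "\<And>r. 0 \<le> r \<Longrightarrow> r \<le> s \<Longrightarrow>
      r * expect \<nu> f - ln (expect \<mu> (\<lambda>x. exp (r * f x))) \<le> s * expect \<nu> f - ln (expect \<mu> (\<lambda>x. exp (s * f x)))"
  shows "s * expect (tilt \<mu> (\<lambda>x. s * f x)) f \<le> s * expect \<nu> f"
proof (cases "s = 0")
  case False
  then have "0 < s" using s by simp
  obtain M where M: "0 < M" "\<And>x. \<bar>f x\<bar> \<le> M" using bcontE[OF f] by metis
  define T where "T = expect (tilt \<mu> (\<lambda>x. s * f x)) f"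
  have "T \<le> expect \<nu> f"
  proof (rule field_le_epsilon)
    fix e :: real assume "0 < e"
    define h where "h = min (min s (1 / M)) (e / M\<^sup>2)"
    have h: "0 < h" "h \<le> s" using \<open>0 < s\<close> \<open>0 < e\<close> M(1) by (auto simp: h_def)
    have "h \<le> 1 / M" "h \<le> e / M\<^sup>2" by (auto simp: h_def)
    then have h': "h * M \<le> 1" "h * M\<^sup>2 \<le> e" using M(1) by (simp_all add: pos_le_divide_eq)
    have "ln (expect \<mu> (\<lambda>x. exp (s * f x + h * - f x)))
        \<le> ln (expect \<mu> (\<lambda>x. exp (s * f x))) + h * expect (tilt \<mu> (\<lambda>x. s * f x)) (\<lambda>x. - f x) + h\<^sup>2 * M\<^sup>2"
      using f M h h' bcont_scale[OF f, of "-1"] by (intro ln_expect_exp_perturb bcont_scale) auto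
    moreover have "s * f x + h * - f x = (s - h) * f x" for x by (simp add: algebra_simps)
    ultimately have "ln (expect \<mu> (\<lambda>x. exp ((s - h) * f x)))
        \<le> ln (expect \<mu> (\<lambda>x. exp (s * f x))) - h * T + h\<^sup>2 * M\<^sup>2" by (simp add: T_def)
    moreover have "(s - h) * expect \<nu> f - ln (expect \<mu> (\<lambda>x. exp ((s - h) * f x)))
        \<le> s * expect \<nu> f - ln (expect \<mu> (\<lambda>x. exp (s * f x)))"
      using h by (intro max) auto
    ultimately have "h * T \<le> h * (expect \<nu> f + h * M\<^sup>2)" by (simp add: algebra_simps power2_eq_square)
    then have "T \<le> expect \<nu> f + h * M\<^sup>2" using h(1) by simp
    then show "T \<le> expect \<nu> f + e" using h'(2) by simp
  qed
  then show ?thesis using s by (simp add: T_def mult_left_mono)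
qed simp

text \<open>Let \<open>f\<^sub>0\<close> be nearly optimal in the variational formula for the entropy \<open>h\<close> of \<open>\<nu>\<close>, and let \<open>f\<close> be its
multiple by the best factor in \<open>[0, 1]\<close>, which is at least as good. Optimality of the factor
bounds the entropy of the tilt, namely its integral of \<open>f\<close> minus \<open>log \<mu>(e\<^sup>f)\<close>, by
\<open>\<nu>(f) - log \<mu>(e\<^sup>f) \<le> h\<close>. Near optimality makes the tilt close to \<open>\<nu>\<close>, as in Pinsker's
inequality: perturbing \<open>f\<close> by \<open>t g\<close> gains \<open>t\<close> times the difference of the integrals of \<open>g\<close>
up to a quadratic error, while the total gain cannot exceed the deficit \<open>\<delta>\<close>.\<close>

lemma entropy_tilt_approx:
  fixes \<nu> \<mu> :: "'a :: polish_space borel_prob"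
  assumes W: "open W" "\<nu> \<in> W" and c: "relative_entropy \<nu> \<mu> < ereal c"
  obtains f where "bcont f" "tilt \<mu> f \<in> W" "expect (tilt \<mu> f) f - ln (expect \<mu> (\<lambda>x. exp (f x))) < c"
proof -
  obtain h where h: "relative_entropy \<nu> \<mu> = ereal h" "h < c"
    using c relative_entropy_nonneg[of \<nu> \<mu>] by (cases "relative_entropy \<nu> \<mu>") auto
  obtain F \<epsilon> where F: "finite F" "\<And>g. g \<in> F \<Longrightarrow> bcont g" "0 < \<epsilon>"
    and FW: "\<And>\<nu>'. (\<And>g. g \<in> F \<Longrightarrow> \<bar>expect \<nu>' g - expect \<nu> g\<bar> < \<epsilon>) \<Longrightarrow> \<nu>' \<in> W"
    using W by (rule narrow_nbhd_basis) blast
  obtain M where M: "0 < M" "\<And>g x. g \<in> F \<Longrightarrow> \<bar>g x\<bar> \<le> M"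
  proof -
    have "bounded (\<Union>g\<in>F. range g)" using F by (intro bounded_UN) (auto simp: bcont_def)
    then show ?thesis using that unfolding bounded_pos by (metis UN_I rangeI real_norm_def)
  qed
  \<comment> \<open>With these choices the deficit \<open>\<delta> / t\<close> and the quadratic error \<open>t M\<^sup>2\<close> add up to at most \<open>3 \<epsilon> / 4\<close>.\<close>
  define t where "t = min (1 / M) (\<epsilon> / (2 * M\<^sup>2))"
  have t: "0 < t" "t * M \<le> 1" "t * M\<^sup>2 \<le> \<epsilon> / 2"
    using M(1) F(3) by (auto simp: t_def min_def field_simps power2_eq_square)
  define \<delta> where "\<delta> = t * \<epsilon> / 4"
  have "0 < \<delta>" using t(1) F(3) by (simp add: \<delta>_def)
  then have "ereal (h - \<delta>) < relative_entropy \<nu> \<mu>" using h by simp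
  then obtain f0 where f0: "bcont f0" "h - \<delta> < expect \<nu> f0 - ln (expect \<mu> (\<lambda>x. exp (f0 x)))"
    by (rule relative_entropy_bcont)
  define G where "G s = s * expect \<nu> f0 - ln (expect \<mu> (\<lambda>x. exp (s * f0 x)))" for s
  have "continuous_on {0..1} G"
    unfolding G_def using f0(1) by (intro continuous_intros continuous_log_moment)
  then obtain s where s: "s \<in> {0..1}" "\<And>r. r \<in> {0..1} \<Longrightarrow> G r \<le> G s"
    using continuous_attains_sup[of "{0..1::real}" G] by auto
  define f where "f x = s * f0 x" for x
  have f: "bcont f" unfolding f_def using f0(1) by (rule bcont_scale)
  have test: "expect \<nu> k - ln (expect \<mu> (\<lambda>x. exp (k x))) \<le> h" if "bcont k" for k
    using relative_entropy_ge[OF that, of \<nu> \<mu>] h(1) by simp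
  have Ef: "expect \<kappa> f = s * expect \<kappa> f0" for \<kappa> unfolding f_def[abs_def] by simp
  have Gs: "G s = expect \<nu> f - ln (expect \<mu> (\<lambda>x. exp (f x)))" unfolding G_def Ef by (simp add: f_def)
  have "h - \<delta> < G s" using f0(2) s(2)[of 1] by (simp add: G_def)
  have close: "expect \<nu> g - expect (tilt \<mu> f) g < \<epsilon>" if g: "bcont g" "\<And>x. \<bar>g x\<bar> \<le> M" for g
  proof -
    have "expect \<nu> (\<lambda>x. f x + t * g x) - ln (expect \<mu> (\<lambda>x. exp (f x + t * g x))) \<le> h"
      using f g(1) by (intro test bcont_add bcont_scale)
    moreover have "expect \<nu> (\<lambda>x. f x + t * g x) = expect \<nu> f + t * expect \<nu> g"
      using f g(1) by (simp add: bcont_scale)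
    moreover have "ln (expect \<mu> (\<lambda>x. exp (f x + t * g x)))
        \<le> ln (expect \<mu> (\<lambda>x. exp (f x))) + t * expect (tilt \<mu> f) g + t\<^sup>2 * M\<^sup>2"
      using t by (intro ln_expect_exp_perturb f g) auto
    ultimately have "t * (expect \<nu> g - expect (tilt \<mu> f) g) < \<delta> + t * (t * M\<^sup>2)"
      using \<open>h - \<delta> < G s\<close> unfolding Gs by (simp add: algebra_simps power2_eq_square)
    also have "\<dots> \<le> t * (\<epsilon> / 4 + \<epsilon> / 2)"
      using t by (simp add: \<delta>_def algebra_simps)
    finally have "expect \<nu> g - expect (tilt \<mu> f) g < \<epsilon> / 4 + \<epsilon> / 2" using t(1) by simp
    then show ?thesis using F(3) by simp
  qed
  have "tilt \<mu> f \<in> W"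
  proof (rule FW)
    fix g assume g: "g \<in> F"
    have "expect \<nu> (\<lambda>x. - g x) - expect (tilt \<mu> f) (\<lambda>x. - g x) < \<epsilon>"
      using F(2)[OF g] M(2)[OF g] bcont_scale[of g "-1"] by (intro close) auto
    moreover have "expect \<nu> g - expect (tilt \<mu> f) g < \<epsilon>" using g F(2) M(2) by (intro close) auto
    ultimately show "\<bar>expect (tilt \<mu> f) g - expect \<nu> g\<bar> < \<epsilon>" by (simp add: abs_less_iff)
  qed
  moreover have "expect (tilt \<mu> f) f - ln (expect \<mu> (\<lambda>x. exp (f x))) < c"
  proof -
    have "s * expect (tilt \<mu> (\<lambda>x. s * f0 x)) f0 \<le> s * expect \<nu> f0"
      using s f0(1) by (intro optimal_scaling_entropy_le) (auto simp: G_def)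
    then have "expect (tilt \<mu> f) f \<le> expect \<nu> f" unfolding Ef by (simp add: f_def[abs_def])
    then show ?thesis using test[OF f] h(2) by simp
  qed
  ultimately show ?thesis using that f by blast
qed

section \<open>Sanov's theorem\<close>

text \<open>For the lower bound the law of large numbers is applied to the tilts of \<open>\<mu>\<^sub>n\<close> by one fixed function,
which converge to the tilt of \<open>\<mu>\<close>.\<close>

theorem sanov_varying:
  fixes \<mu>s :: "nat \<Rightarrow> 'a :: polish_space borel_prob"
  assumes \<mu>: "\<mu>s \<longlonglongrightarrow> \<mu>"
  shows "large_deviations (\<lambda>n. empirical_law n (\<mu>s n)) (\<lambda>n. real n) (\<lambda>\<nu>. e2ennreal (relative_entropy \<nu> \<mu>))"
proof (rule large_deviationsI)
  show "prob_space (empirical_law n (\<mu>s n))" for n by (rule prob_space_empirical_law)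
  show "sets (empirical_law n (\<mu>s n)) = sets borel" for n by simp
  show "lower_semicontinuous (\<lambda>\<nu>. e2ennreal (relative_entropy \<nu> \<mu>))"
    by (rule lower_semicontinuous_relative_entropy)
  show "filterlim real at_top sequentially" by (rule filterlim_real_sequentially)
next
  fix W and \<nu> :: "'a borel_prob" and c :: real
  assume W: "open W" "\<nu> \<in> W" and c: "0 \<le> c" "e2ennreal (relative_entropy \<nu> \<mu>) < ennreal c"
  have moment: "(\<lambda>n. expect (\<mu>s n) (\<lambda>x. exp (f x))) \<longlonglongrightarrow> expect \<mu> (\<lambda>x. exp (f x))" if "bcont f" for f
    using \<mu> that unfolding tendsto_narrow_iff by (simp add: bcont_exp)
  have "relative_entropy \<nu> \<mu> < ereal c" using c by (simp add: less_ennreal_iff_ereal)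
  with W obtain f where f: "bcont f" "tilt \<mu> f \<in> W"
    "expect (tilt \<mu> f) f - ln (expect \<mu> (\<lambda>x. exp (f x))) < c" by (rule entropy_tilt_approx)
  define Z where "Z = expect \<mu> (\<lambda>x. exp (f x))"
  have "0 < Z" using expect_exp_pos[OF f(1)] by (simp add: Z_def)
  obtain s where s: "expect (tilt \<mu> f) f < s" "s < c + ln Z" using f(3) dense[of "expect (tilt \<mu> f) f" "c + ln Z"] by (auto simp: Z_def)
  define W' where "W' = W \<inter> {\<nu>. expect \<nu> f < s}"
  have W': "open W'" "tilt \<mu> f \<in> W'"
    using W(1) f s(1) open_expect_less[OF f(1)] by (auto simp: W'_def)
  have "exp (s - c) < Z" using s(2) \<open>0 < Z\<close> by (metis diff_less_eq add.commute exp_ln exp_less_cancel_iff)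
  then have "1 < exp (c - s) * Z" by (simp add: exp_diff field_simps)
  \<comment> \<open>The excess of \<open>\<rho>\<close> over one pays for the factor \<open>1 / 2\<close> that the law of large numbers leaves.\<close>
  then obtain \<rho> where \<rho>: "1 < \<rho>" "\<rho> < exp (c - s) * Z" using dense by blast
  have "(\<lambda>n. exp (c - s) * expect (\<mu>s n) (\<lambda>x. exp (f x))) \<longlonglongrightarrow> exp (c - s) * Z"
    unfolding Z_def by (intro tendsto_intros moment f(1))
  then have "\<forall>\<^sub>F n in sequentially. \<rho> < exp (c - s) * expect (\<mu>s n) (\<lambda>x. exp (f x))"
    using \<rho>(2) by (rule order_tendstoD)
  moreover have "\<forall>\<^sub>F n in sequentially. 1 / 2 < measure (empirical_law n (tilt (\<mu>s n) f)) W'"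
    by (rule order_tendstoD(1)[OF empirical_law_weak_law[OF tilt_tendsto[OF \<mu> f(1)] W']]) simp
  moreover have "\<forall>\<^sub>F n in sequentially. 2 \<le> \<rho> ^ n"
    using filterlim_realpow_sequentially_gt1[of \<rho>] \<rho>(1)
    by (auto dest: filterlim_at_infinity_imp_norm_at_top simp: filterlim_at_top norm_power)
  ultimately show "\<forall>\<^sub>F n in sequentially. exp (- (real n * c)) \<le> measure (empirical_law n (\<mu>s n)) W"
    using eventually_ge_at_top[of 1]
  proof eventually_elim
    case (elim n)
    interpret P: prob_space "empirical_law n (\<mu>s n)" by (rule prob_space_empirical_law)
    define z where "z = expect (\<mu>s n) (\<lambda>x. exp (f x))"
    have "0 < z" using expect_exp_pos[OF f(1)] by (simp add: z_def)
    have "1 / 2 < (exp s / z) ^ n * P.prob W'"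
    proof (rule less_le_trans[OF elim(2)])
      show "measure (empirical_law n (tilt (\<mu>s n) f)) W' \<le> (exp s / z) ^ n * P.prob W'"
        unfolding z_def using W'(1) elim(4) f(1)
        by (intro empirical_law_tilt_le) (auto simp: W'_def)
    qed
    then have "(exp (c - s) * z) ^ n * (1 / 2) < (exp (c - s) * z) ^ n * ((exp s / z) ^ n * P.prob W')"
      using \<open>0 < z\<close> by (intro mult_strict_left_mono) auto
    also have "\<dots> = exp c ^ n * P.prob W'"
      using \<open>0 < z\<close> by (simp add: power_mult_distrib[symmetric] mult.assoc[symmetric] exp_diff)
    finally have "(exp (c - s) * z) ^ n * (1 / 2) < exp c ^ n * P.prob W'" .
    moreover have "\<rho> ^ n \<le> (exp (c - s) * z) ^ n"
      using elim(1) \<rho>(1) by (intro power_mono) (auto simp: z_def)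
    ultimately have "1 < exp c ^ n * P.prob W'" using elim(3) by linarith
    then have "1 < exp (real n * c) * P.prob W'" by (simp add: exp_of_nat_mult)
    then have "exp (- (real n * c)) \<le> P.prob W'" by (simp add: exp_minus field_simps)
    also have "\<dots> \<le> P.prob W" using W(1) by (intro P.finite_measure_mono) (auto simp: W'_def)
    finally show ?case .
  qed
next
  fix \<nu> :: "'a borel_prob" and c :: real
  assume c: "0 \<le> c" "ennreal c < e2ennreal (relative_entropy \<nu> \<mu>)"
  then have "ereal c < relative_entropy \<nu> \<mu>" by (simp add: ennreal_less_iff_ereal)
  then obtain f where f: "bcont f" "c < expect \<nu> f - ln (expect \<mu> (\<lambda>x. exp (f x)))"
    by (rule relative_entropy_bcont)
  define Z where "Z = expect \<mu> (\<lambda>x. exp (f x))"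
  have "0 < Z" using expect_exp_pos[OF f(1)] by (simp add: Z_def)
  obtain s where s: "c + ln Z < s" "s < expect \<nu> f" using f(2) dense[of "c + ln Z" "expect \<nu> f"] by (auto simp: Z_def)
  have "Z < exp (s - c)" using s(1) \<open>0 < Z\<close> by (metis less_diff_eq add.commute exp_ln exp_less_cancel_iff)
  have "(\<lambda>n. expect (\<mu>s n) (\<lambda>x. exp (f x))) \<longlonglongrightarrow> Z"
    using \<mu> f(1) unfolding tendsto_narrow_iff Z_def by (simp add: bcont_exp)
  then have "\<forall>\<^sub>F n in sequentially. expect (\<mu>s n) (\<lambda>x. exp (f x)) < exp (s - c)"
    using \<open>Z < exp (s - c)\<close> by (rule order_tendstoD)
  then have "\<forall>\<^sub>F n in sequentially. measure (empirical_law n (\<mu>s n)) {\<nu>. s < expect \<nu> f} \<le> exp (- (real n * c))"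
    using eventually_ge_at_top[of 1]
  proof eventually_elim
    case (elim n)
    have "measure (empirical_law n (\<mu>s n)) {\<nu>. s < expect \<nu> f} \<le> (exp (- s) * expect (\<mu>s n) (\<lambda>x. exp (f x))) ^ n"
      using elim(2) f(1) bcont_borel[OF f(1)] open_expect_greater[OF f(1)]
      by (intro empirical_law_chernoff) (auto simp: bcont_def)
    also have "\<dots> \<le> (exp (- s) * exp (s - c)) ^ n"
      using elim(1) expect_exp_pos[OF f(1), of "\<mu>s n"]
      by (intro power_mono mult_left_mono mult_nonneg_nonneg) auto
    also have "\<dots> = exp (- (real n * c))" by (simp add: mult_exp_exp exp_of_nat_mult[symmetric])
    finally show ?case .
  qed
  then show "\<exists>U. open U \<and> \<nu> \<in> U \<and>
      (\<forall>\<^sub>F n in sequentially. measure (empirical_law n (\<mu>s n)) U \<le> exp (- (real n * c)))"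
    using s(2) f(1) by (intro exI[of _ "{\<nu>. s < expect \<nu> f}"]) (auto intro: open_expect_greater)
next
  fix L :: real assume "0 \<le> L"
  have balls: "\<exists>S. finite S \<and> (\<forall>\<^sub>F n in sequentially.
      measure (meas_of (\<mu>s n)) (- (\<Union>x\<in>S. ball x \<delta>)) \<le> exp (- (1 * L)))" if "0 < \<delta>" for L \<delta> :: real
  proof -
    obtain S where S: "finite S" "measure (meas_of \<mu>) (- (\<Union>x\<in>S. ball x \<delta>)) < exp (- L)"
      by (rule finite_balls_cover_measure[OF exp_gt_zero \<open>0 < \<delta>\<close>])
    define U where "U = (\<Union>x\<in>S. ball x \<delta>)"
    have U: "open U" unfolding U_def by (intro open_UN) auto
    have compl: "measure (meas_of \<nu>) (- U) = 1 - measure (meas_of \<nu>) U" for \<nu>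
      using meas_of.prob_compl[of U \<nu>] U by (simp add: Compl_eq_Diff_UNIV)
    \<comment> \<open>Finitely many balls carry most of the mass of the limit, hence, being open, of almost all terms of the sequence.\<close>
    have "\<mu> \<in> {\<nu>. 1 - exp (- L) < measure (meas_of \<nu>) U}" using S(2) compl[of \<mu>] by (simp add: U_def)
    from topological_tendstoD[OF \<mu> open_measure_gt[OF U] this]
    have "\<forall>\<^sub>F n in sequentially. measure (meas_of (\<mu>s n)) (- U) \<le> exp (- (1 * L))"
      by (rule eventually_mono) (simp add: compl)
    then show ?thesis using S(1) unfolding U_def by blast
  qed
  have cpt: "\<exists>K. compact K \<and> (\<forall>n\<ge>0. measure (meas_of (\<mu>s n)) (- K) \<le> exp (- (1 * L)))" if "0 \<le> L" for L
    by (rule uniform_compact_of_finite_balls[where b = "\<lambda>_. 1" and N = 0, OF _ balls that]) auto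
  show "\<exists>K. compact K \<and> closed K \<and>
      (\<forall>\<^sub>F n in sequentially. measure (empirical_law n (\<mu>s n)) (- K) \<le> exp (- (real n * L)))"
    using empirical_law_exponentially_tight[where b = "\<lambda>_. 1" and N = 0, OF _ cpt \<open>0 \<le> L\<close>] by simp
qed



section \<open>Coercive rates\<close>

lemma compact_sublevel:
  assumes "lower_semicontinuous I" "coercive I" "0 \<le> l"
  shows "compact {x. I x \<le> ennreal l}"
proof -
  have "- {x. I x \<le> ennreal l} = {x. ennreal l < I x}" by auto
  then have "closed {x. I x \<le> ennreal l}"
    using assms(1) unfolding lower_semicontinuous_def closed_def by simp
  then show ?thesis using assms(2,3) unfolding coercive_def by (metis closure_closed)
qed

text \<open>By Markov's inequality a bound on \<open>\<nu>(I)\<close> makes \<open>\<nu>\<close> tight, with the sublevel sets of \<open>I\<close> as compact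
sets.\<close>

lemma coercive_nn_integral:
  fixes I :: "'a :: polish_space \<Rightarrow> ennreal"
  assumes lsc: "lower_semicontinuous I" and co: "coercive I"
  shows "coercive (\<lambda>\<nu>. \<integral>\<^sup>+ x. I x \<partial>meas_of \<nu>)"
  unfolding coercive_def
proof (intro allI impI)
  fix l :: real assume "0 \<le> l"
  \<comment> \<open>\<open>l + 1\<close> instead of \<open>l\<close>, so that the case \<open>l = 0\<close> needs no separate treatment.\<close>
  define K where "K k = {x. I x \<le> ennreal ((l + 1) * real (Suc k))}" for k
  have K: "compact (K k)" for k unfolding K_def using \<open>0 \<le> l\<close> by (intro compact_sublevel lsc co) simp
  define r where "r k = 1 / real (Suc k)" for k
  define T where "T = {\<nu> :: 'a borel_prob. \<forall>k. measure (meas_of \<nu>) (- K k) \<le> r k}"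
  have "r \<longlonglongrightarrow> 0" unfolding r_def by (rule LIMSEQ_Suc[OF lim_1_over_n])
  then have "compact T" unfolding T_def using K by (intro compact_tight)
  have "closed T"
    unfolding T_def Collect_all_eq by (intro closed_INT ballI closed_measure_compl_le compact_imp_closed K)
  have "{\<nu>. (\<integral>\<^sup>+ x. I x \<partial>meas_of \<nu>) \<le> ennreal l} \<subseteq> T"
  proof
    fix \<nu> assume "\<nu> \<in> {\<nu>. (\<integral>\<^sup>+ x. I x \<partial>meas_of \<nu>) \<le> ennreal l}"
    then have le: "(\<integral>\<^sup>+ x. I x \<partial>meas_of \<nu>) \<le> ennreal l" by simp
    have "measure (meas_of \<nu>) (- K k) \<le> r k" for k
    proof -
      have "ennreal ((l + 1) * real (Suc k) * measure (meas_of \<nu>) (- K k))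
          = (\<integral>\<^sup>+ x. ennreal ((l + 1) * real (Suc k)) * indicator (- K k) x \<partial>meas_of \<nu>)"
        using \<open>0 \<le> l\<close> compact_imp_closed[OF K]
        by (subst nn_integral_cmult_indicator) (auto simp: meas_of.emeasure_eq_measure ennreal_mult borel_comp)
      also have "\<dots> \<le> (\<integral>\<^sup>+ x. I x \<partial>meas_of \<nu>)"
        by (intro nn_integral_mono) (auto simp: K_def indicator_def)
      also note le
      finally have "(l + 1) * (real (Suc k) * measure (meas_of \<nu>) (- K k)) \<le> l"
        using \<open>0 \<le> l\<close> by (simp add: ennreal_le_iff mult.assoc)
      also have "\<dots> \<le> (l + 1) * 1" by simp
      finally have "real (Suc k) * measure (meas_of \<nu>) (- K k) \<le> 1"
        using \<open>0 \<le> l\<close> by (subst (asm) mult_le_cancel_left_pos) auto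
      then show ?thesis by (simp add: r_def field_simps)
    qed
    then show "\<nu> \<in> T" by (simp add: T_def)
  qed
  then have "closure {\<nu>. (\<integral>\<^sup>+ x. I x \<partial>meas_of \<nu>) \<le> ennreal l} \<subseteq> T"
    using \<open>closed T\<close> by (rule closure_minimal)
  then have "closure {\<nu>. (\<integral>\<^sup>+ x. I x \<partial>meas_of \<nu>) \<le> ennreal l}
      = T \<inter> closure {\<nu>. (\<integral>\<^sup>+ x. I x \<partial>meas_of \<nu>) \<le> ennreal l}" by auto
  then show "compact (closure {\<nu>. (\<integral>\<^sup>+ x. I x \<partial>meas_of \<nu>) \<le> ennreal l})"
    using compact_Int_closed[OF \<open>compact T\<close> closed_closure] by metis
qed

section \<open>Cyclic averages and sampling\<close>

text \<open>The difference between the sum and \<open>n\<close> times the mean over a period is periodic, hence bounded.\<close>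

lemma cyclic_average_tendsto:
  fixes h :: "nat \<Rightarrow> real"
  assumes m: "1 \<le> m"
  shows "(\<lambda>n. (\<Sum>i<n. h (i mod m)) / real n) \<longlonglongrightarrow> (\<Sum>j<m. h j) / real m"
proof -
  define V where "V = (\<Sum>j<m. h j) / real m"
  define S where "S n = (\<Sum>i<n. h (i mod m))" for n
  define D where "D n = S n - real n * V" for n
  have "S (n + m) - S n = real m * V" for n
  proof (induction n)
    case 0
    have "S m = (\<Sum>j<m. h j)" unfolding S_def by (intro sum.cong) auto
    then show ?case using m by (simp add: V_def) (simp add: S_def)
  next
    case (Suc n)
    then show ?case by (simp add: S_def)
  qed
  then have step: "D (n + m) = D n" for n
    unfolding D_def by (smt (verit) of_nat_add distrib_right)
  have "D (r + q * m) = D r" for r q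
  proof (induction q)
    case (Suc q)
    then show ?case using step[of "r + q * m"] by (simp add: algebra_simps)
  qed simp
  then have "D n = D (n mod m)" for n by (metis add.commute div_mult_mod_eq)
  moreover have "\<bar>D (n mod m)\<bar> \<le> (\<Sum>r<m. \<bar>D r\<bar>)" for n
    using m by (intro member_le_sum) auto
  ultimately have D: "\<bar>D n\<bar> \<le> (\<Sum>r<m. \<bar>D r\<bar>)" for n by metis
  have "(\<lambda>n. (\<Sum>i<n. h (i mod m)) / real n - V) \<longlonglongrightarrow> 0"
  proof (rule Lim_null_comparison)
    show "\<forall>\<^sub>F n in sequentially. norm ((\<Sum>i<n. h (i mod m)) / real n - V) \<le> (\<Sum>r<m. \<bar>D r\<bar>) * (1 / real n)"
      using eventually_gt_at_top[of 0]
    proof eventually_elim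
      case (elim n)
      then have "(\<Sum>i<n. h (i mod m)) / real n - V = D n / real n"
        by (simp add: D_def S_def field_simps)
      then show ?case using D[of n] elim by (simp add: divide_right_mono)
    qed
    show "(\<lambda>n. (\<Sum>r<m. \<bar>D r\<bar>) * (1 / real n)) \<longlonglongrightarrow> 0"
      using tendsto_mult_left[OF lim_1_over_n, of "\<Sum>r<m. \<bar>D r\<bar>"] by simp
  qed
  then show ?thesis unfolding V_def by (simp add: LIM_zero_iff)
qed

lemma nn_integral_iid_component:
  assumes "I \<in> borel_measurable borel" "i \<in> {1..n}"
  shows "(\<integral>\<^sup>+ x. I (x i) \<partial>iid n \<nu>) = (\<integral>\<^sup>+ x. I x \<partial>meas_of \<nu>)"
proof -
  have "distr (iid n \<nu>) (meas_of \<nu>) (\<lambda>x. x i) = meas_of \<nu>"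
    unfolding iid_def by (rule distr_PiM_component) (use assms prob_space_meas_of in auto)
  then have "(\<integral>\<^sup>+ x. I x \<partial>meas_of \<nu>) = (\<integral>\<^sup>+ x. I x \<partial>distr (iid n \<nu>) (meas_of \<nu>) (\<lambda>x. x i))" by simp
  also have "\<dots> = (\<integral>\<^sup>+ x. I (x i) \<partial>iid n \<nu>)"
    using measurable_iid_component[OF assms(2), of \<nu>] assms(1)
    by (intro nn_integral_distr) (auto cong: measurable_cong_sets)
  finally show ?thesis by simp
qed

text \<open>A sample from \<open>\<nu>\<close> has an empirical measure in \<open>W\<close> with probability tending to one, while by Markov's
inequality its cost exceeds \<open>m c\<close> with probability at most \<open>\<nu>(I) / c < 1\<close>. For large \<open>m\<close> both
requirements are met by some sample.\<close>

lemma sample_with_small_cost: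
  fixes \<nu> :: "'a :: polish_space borel_prob"
  assumes W: "open W" "\<nu> \<in> W" and I: "I \<in> borel_measurable borel"
    and c: "0 \<le> c" "(\<integral>\<^sup>+ x. I x \<partial>meas_of \<nu>) < ennreal c"
  obtains m y where "1 \<le> m" "empirical m y \<in> W" "(\<Sum>i=1..m. I (y i)) < ennreal (real m * c)"
proof -
  define v where "v = enn2real (\<integral>\<^sup>+ x. I x \<partial>meas_of \<nu>)"
  have v: "(\<integral>\<^sup>+ x. I x \<partial>meas_of \<nu>) = ennreal v" "0 \<le> v"
    using c(2) unfolding v_def by (auto intro!: ennreal_enn2real[symmetric] simp: less_top[symmetric])
  have "v < c" using c v by (simp add: ennreal_less_iff)
  have "\<forall>\<^sub>F m in sequentially. v / c < measure (empirical_law m \<nu>) W"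
    by (rule order_tendstoD(1)[OF empirical_law_weak_law[OF tendsto_const W]])
      (use \<open>v < c\<close> v in simp)
  then obtain m where m: "1 \<le> m" "v / c < measure (empirical_law m \<nu>) W"
    using eventually_happens'[OF sequentially_bot eventually_conj[OF eventually_ge_at_top[of 1]]] by blast
  define B where "B = empirical m -` W \<inter> space (iid m \<nu>)"
  have B [measurable]: "B \<in> sets (iid m \<nu>)" unfolding B_def using W(1) by measurable
  have PB: "v / c < measure (iid m \<nu>) B"
    using m(2) W(1) by (simp add: measure_empirical_law B_def)
  have "\<exists>y\<in>B. (\<Sum>i=1..m. I (y i)) < ennreal (real m * c)"
  proof (rule ccontr)
    assume "\<not> ?thesis"
    then have big: "ennreal (real m * c) \<le> (\<Sum>i=1..m. I (y i))" if "y \<in> B" for y using that by (auto simp: not_less)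
    have "ennreal (real m * c * measure (iid m \<nu>) B) = (\<integral>\<^sup>+ y. ennreal (real m * c) * indicator B y \<partial>iid m \<nu>)"
      using B c(1) by (simp add: nn_integral_cmult_indicator iid.emeasure_eq_measure ennreal_mult)
    also have "\<dots> \<le> (\<integral>\<^sup>+ y. (\<Sum>i=1..m. I (y i)) \<partial>iid m \<nu>)"
      using big by (intro nn_integral_mono) (auto simp: indicator_def)
    also have "\<dots> = (\<Sum>i=1..m. \<integral>\<^sup>+ y. I (y i) \<partial>iid m \<nu>)"
      by (intro nn_integral_sum measurable_compose[OF measurable_iid_component] I)
    also have "\<dots> = (\<Sum>i=1..m. ennreal v)"
      by (intro sum.cong refl) (simp add: nn_integral_iid_component[OF I] v(1))
    also have "\<dots> = ennreal (real m * v)"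
      using v(2) by (simp add: ennreal_mult ennreal_of_nat_eq_real_of_nat)
    finally have "real m * (c * measure (iid m \<nu>) B) \<le> real m * v"
      using v(2) by (simp add: ennreal_le_iff mult.assoc)
    then have "c * measure (iid m \<nu>) B \<le> v" using m(1) by simp
    then show False using PB \<open>v < c\<close> v(2) by (simp add: field_simps)
  qed
  then show ?thesis using that m(1) by (auto simp: B_def)
qed

section \<open>Empirical measures of variables that satisfy a large deviations principle\<close>

locale ldp_variables =
  fixes \<mu>s :: "nat \<Rightarrow> 'a :: polish_space borel_prob" and a :: "nat \<Rightarrow> real" and I :: "'a \<Rightarrow> ennreal"
  assumes a: "filterlim a at_top sequentially"
    and ldp: "large_deviations (\<lambda>n. meas_of (\<mu>s n)) a I"
    and coercive: "coercive I"
begin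

lemma lsc: "lower_semicontinuous I"
  using ldp by (simp add: large_deviations_def)

lemma a_pos: "\<forall>\<^sub>F n in sequentially. 0 < a n"
  using a by (simp add: filterlim_at_top_dense)

lemma closed_upper:
  assumes "closed C" "0 \<le> c" "ennreal c < (INF x\<in>C. I x)"
  shows "\<forall>\<^sub>F n in sequentially. measure (meas_of (\<mu>s n)) C \<le> exp (- (a n * c))"
  by (rule limsup_ext_ln_leD[OF a_pos _ assms(2,3)]) (use ldp assms(1) in \<open>simp add: large_deviations_def\<close>)

lemma open_lower:
  assumes "open U" "x \<in> U" "0 \<le> c" "I x < ennreal c"
  shows "\<forall>\<^sub>F n in sequentially. exp (- (a n * c)) \<le> measure (meas_of (\<mu>s n)) U"
proof (rule liminf_ext_ln_geD[OF a_pos _ assms(3)])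
  show "- enn2ereal (INF x\<in>U. I x) \<le> liminf (\<lambda>n. ereal (1 / a n) * ext_ln (measure (meas_of (\<mu>s n)) U))"
    using ldp assms(1) by (simp add: large_deviations_def)
  show "(INF x\<in>U. I x) < ennreal c" using assms(2,4) by (auto simp: INF_less_iff)
qed

text \<open>Varadhan's upper estimate in the case \<open>g \<le> I\<close>, where the limit is at most \<open>sup (g - I) \<le> 0\<close>. The range
of \<open>g\<close> is cut into finitely many slices; on \<open>{g \<ge> j \<eta>}\<close> the rate is at least \<open>j \<eta>\<close>, which cancels the
exponential up to a bounded number of steps \<open>\<eta>\<close>.\<close>

lemma varadhan_upper:
  assumes g: "bcont g" "\<And>x. 0 \<le> g x" "\<And>x. ennreal (g x) \<le> I x" and "0 < \<delta>"
  shows "\<forall>\<^sub>F n in sequentially. expect (\<mu>s n) (\<lambda>x. exp (a n * g x)) \<le> exp (a n * \<delta>)"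
proof -
  obtain M where M: "0 < M" "\<And>x. \<bar>g x\<bar> \<le> M" using bcontE[OF g(1)] by metis
  define \<eta> where "\<eta> = \<delta> / 3"
  have \<eta>: "0 < \<eta>" using \<open>0 < \<delta>\<close> by (simp add: \<eta>_def)
  obtain N :: nat where "M / \<eta> < real N" using reals_Archimedean2 by blast
  then have N: "M < real N * \<eta>" using \<eta> by (simp add: field_simps)
  then have "0 < N" using M(1) by (cases N) auto
  define C where "C j = {x. real j * \<eta> \<le> g x}" for j :: nat
  have C: "closed (C j)" for j
    using g(1) unfolding C_def bcont_def by (intro closed_Collect_le continuous_intros) auto
  \<comment> \<open>One step is given away, because the upper bound needs a level strictly below the infimum of the rate.\<close>
  have slice: "\<forall>\<^sub>F n in sequentially. measure (meas_of (\<mu>s n)) (C j) \<le> exp (- (a n * ((real j - 1) * \<eta>)))" for j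
  proof (cases j)
    case 0
    show ?thesis using a_pos
    proof eventually_elim
      case (elim n)
      have "measure (meas_of (\<mu>s n)) (C j) \<le> 1" by simp
      also have "1 \<le> exp (- (a n * ((real j - 1) * \<eta>)))" using elim \<eta> 0 by simp
      finally show ?case .
    qed
  next
    case (Suc k)
    have "ennreal (real k * \<eta>) < ennreal (real j * \<eta>)" using \<eta> Suc by (simp add: ennreal_less_iff)
    also have "\<dots> \<le> (INF x\<in>C j. I x)"
      using g(3) by (intro INF_greatest) (auto simp: C_def intro: order_trans[OF ennreal_leI])
    finally show ?thesis using closed_upper[OF C, of "real k * \<eta>" j] \<eta> Suc by simp
  qed
  have "\<forall>\<^sub>F n in sequentially. \<forall>j\<in>{..<N}. measure (meas_of (\<mu>s n)) (C j) \<le> exp (- (a n * ((real j - 1) * \<eta>)))"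
    using slice by (intro eventually_ball_finite) auto
  moreover have "\<forall>\<^sub>F n in sequentially. ln (real N) / \<eta> \<le> a n" using a by (simp add: filterlim_at_top)
  ultimately show ?thesis using a_pos
  proof eventually_elim
    case (elim n)
    have pt: "exp (a n * g x) \<le> (\<Sum>j<N. exp (a n * (real (Suc j) * \<eta>)) * indicator (C j) x)" for x
    proof -
      define j where "j = nat \<lfloor>g x / \<eta>\<rfloor>"
      have "real j \<le> g x / \<eta>" "g x / \<eta> < real (Suc j)"
        using g(2)[of x] \<eta> unfolding j_def by (simp_all add: of_nat_nat) linarith
      then have j: "real j * \<eta> \<le> g x" "g x \<le> real (Suc j) * \<eta>" using \<eta> by (simp_all add: field_simps)
      have "real j * \<eta> < real N * \<eta>" using j(1) M(2)[of x] N by (simp add: abs_le_iff)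
      then have "j < N" using \<eta> by simp
      have "exp (a n * g x) \<le> exp (a n * (real (Suc j) * \<eta>)) * indicator (C j) x"
        using j elim(3) by (simp add: C_def)
      also have "\<dots> \<le> (\<Sum>j<N. exp (a n * (real (Suc j) * \<eta>)) * indicator (C j) x)"
        using \<open>j < N\<close> by (intro member_le_sum) auto
      finally show ?thesis .
    qed
    have ind: "integrable (meas_of (\<mu>s n)) (\<lambda>x. exp (a n * (real (Suc j) * \<eta>)) * indicator (C j) x)" for j
      using C by (intro integrable_mult_right integrable_real_indicator) (auto simp: meas_of.emeasure_eq_measure)
    have "expect (\<mu>s n) (\<lambda>x. exp (a n * g x))
        \<le> expect (\<mu>s n) (\<lambda>x. \<Sum>j<N. exp (a n * (real (Suc j) * \<eta>)) * indicator (C j) x)"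
      using g(1) by (intro integral_mono pt bcont_integrable bcont_exp bcont_scale Bochner_Integration.integrable_sum ind)
    also have "\<dots> = (\<Sum>j<N. expect (\<mu>s n) (\<lambda>x. exp (a n * (real (Suc j) * \<eta>)) * indicator (C j) x))"
      by (intro Bochner_Integration.integral_sum ind)
    also have "\<dots> = (\<Sum>j<N. exp (a n * (real (Suc j) * \<eta>)) * measure (meas_of (\<mu>s n)) (C j))"
      using C by simp
    also have "\<dots> \<le> (\<Sum>j<N. exp (a n * (real (Suc j) * \<eta>)) * exp (- (a n * ((real j - 1) * \<eta>))))"
      using elim(1) by (intro sum_mono mult_left_mono) auto
    also have "\<dots> = (\<Sum>j<N. exp (a n * (2 * \<eta>)))"
      by (intro sum.cong refl) (simp add: mult_exp_exp algebra_simps)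
    also have "\<dots> = real N * exp (a n * (2 * \<eta>))" by simp
    \<comment> \<open>The third \<open>\<eta>\<close> absorbs the number of slices.\<close>
    also have "ln (real N) \<le> a n * \<eta>" using elim(2) \<eta> by (simp add: field_simps)
    then have "real N \<le> exp (a n * \<eta>)" using \<open>0 < N\<close> by (metis exp_le_cancel_iff exp_ln of_nat_0_less_iff)
    then have "real N * exp (a n * (2 * \<eta>)) \<le> exp (a n * \<eta>) * exp (a n * (2 * \<eta>))" by (rule mult_right_mono) simp
    also have "\<dots> = exp (a n * \<delta>)" by (simp add: mult_exp_exp \<eta>_def algebra_simps)
    finally show ?case .
  qed
qed

text \<open>The witness is a continuous minorant \<open>g\<close> of \<open>I\<close> with \<open>\<nu>(g) > c\<close>; the exponential Chebyshev
inequality is applied to \<open>a\<^sub>n g\<close>.\<close>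

lemma empirical_local_upper:
  assumes c: "0 \<le> c" "ennreal c < (\<integral>\<^sup>+ x. I x \<partial>meas_of \<nu>)"
  shows "\<exists>U. open U \<and> \<nu> \<in> U \<and>
    (\<forall>\<^sub>F n in sequentially. measure (empirical_law n (\<mu>s n)) U \<le> exp (- (real n * a n * c)))"
proof -
  obtain gs where gs: "\<And>k :: nat. bcont (gs k)" "\<And>k x. 0 \<le> gs k x" "\<And>x. incseq (\<lambda>k. gs k x)"
    "\<And>x. (SUP k. ennreal (gs k x)) = I x"
    using lower_semicontinuous_approx[OF lsc] by metis
  have "ennreal c < (SUP k. ennreal (expect \<nu> (gs k)))" using c(2) nn_integral_approx[OF gs, of \<nu>] by simp
  then obtain k where k: "ennreal c < ennreal (expect \<nu> (gs k))" by (auto simp: less_SUP_iff)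
  define g where "g = gs k"
  have g: "bcont g" "\<And>x. 0 \<le> g x" "\<And>x. ennreal (g x) \<le> I x"
    using gs(1,2) gs(4)[symmetric] by (auto simp: g_def intro: SUP_upper)
  have "c < expect \<nu> g" using k c(1) by (simp add: g_def ennreal_less_iff)
  then obtain s where s: "c < s" "s < expect \<nu> g" using dense by blast
  have "\<forall>\<^sub>F n in sequentially. measure (empirical_law n (\<mu>s n)) {\<nu>. s < expect \<nu> g} \<le> exp (- (real n * a n * c))"
    using varadhan_upper[OF g diff_gt_0_iff_gt[THEN iffD2, OF s(1)]] a_pos eventually_ge_at_top[of 1]
  proof eventually_elim
    case (elim n)
    have ag: "bcont (\<lambda>x. a n * g x)" using g(1) by (rule bcont_scale)
    have "measure (empirical_law n (\<mu>s n)) {\<nu>. s < expect \<nu> g}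
        \<le> (exp (- (a n * s)) * expect (\<mu>s n) (\<lambda>x. exp (a n * g x))) ^ n"
      using elim ag bcont_borel[OF ag] open_expect_greater[OF g(1)]
      by (intro empirical_law_chernoff) (auto simp: bcont_def)
    also have "\<dots> \<le> (exp (- (a n * s)) * exp (a n * (s - c))) ^ n"
      using elim expect_exp_pos[OF ag, of "\<mu>s n"]
      by (intro power_mono mult_left_mono mult_nonneg_nonneg) auto
    also have "exp (- (a n * s)) * exp (a n * (s - c)) = exp (- (a n * c))"
      by (simp add: mult_exp_exp algebra_simps)
    also have "\<dots> ^ n = exp (- (real n * a n * c))" by (simp add: exp_of_nat_mult[symmetric])
    finally show ?case .
  qed
  then show ?thesis using s(2) g(1) by (intro exI[of _ "{\<nu>. s < expect \<nu> g}"]) (auto intro: open_expect_greater)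
qed

text \<open>The samples are forced to follow cyclically a finite list of points \<open>y\<close> whose empirical measure is
near \<open>\<nu>\<close> and whose cost is near \<open>\<nu>(I)\<close>, each staying in a small open neighbourhood \<open>B j\<close> of its point.
The tolerance \<open>\<epsilon>\<close> is spent in three parts: a quarter on the neighbourhoods, a quarter on incomplete
cycles, one half on the distance between the empirical measure of \<open>y\<close> and \<open>\<nu>\<close>.\<close>

lemma empirical_lower:
  assumes W: "open W" "\<nu> \<in> W" and c: "0 \<le> c" "(\<integral>\<^sup>+ x. I x \<partial>meas_of \<nu>) < ennreal c"
  shows "\<forall>\<^sub>F n in sequentially. exp (- (real n * a n * c)) \<le> measure (empirical_law n (\<mu>s n)) W"
proof -
  obtain F \<epsilon> where F: "finite F" "\<And>f. f \<in> F \<Longrightarrow> bcont f" "0 < \<epsilon>"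
    and FW: "\<And>\<nu>'. (\<And>f. f \<in> F \<Longrightarrow> \<bar>expect \<nu>' f - expect \<nu> f\<bar> < \<epsilon>) \<Longrightarrow> \<nu>' \<in> W"
    using W by (rule narrow_nbhd_basis) blast
  define W' where "W' = (\<Inter>f\<in>F. {\<nu>'. expect \<nu>' f \<in> ball (expect \<nu> f) (\<epsilon> / 2)})"
  have W': "open W'" "\<nu> \<in> W'"
    unfolding W'_def using F by (auto intro!: open_INT open_expect_vimage simp del: mem_ball)
  obtain c' where c': "(\<integral>\<^sup>+ x. I x \<partial>meas_of \<nu>) < ennreal c'" "0 \<le> c'" "c' < c"
  proof -
    obtain d where d: "enn2ereal (\<integral>\<^sup>+ x. I x \<partial>meas_of \<nu>) < ereal d" "ereal d < ereal c"
      using c less_ennreal_iff_ereal ereal_dense2 by blast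
    have "0 < ereal d" using enn2ereal_nonneg d(1) by (rule le_less_trans)
    then show ?thesis using that[of d] d less_ennreal_iff_ereal[of d] by simp
  qed
  obtain m y where m: "1 \<le> m" and yW: "empirical m y \<in> W'" and yI: "(\<Sum>i=1..m. I (y i)) < ennreal (real m * c')"
    by (rule sample_with_small_cost[OF W' lower_semicontinuous_borel[OF lsc] c'(2,1)])
  define v where "v i = enn2real (I (y i))" for i
  have v: "I (y i) = ennreal (v i)" if "i \<in> {1..m}" for i
  proof -
    have "I (y i) \<le> (\<Sum>i=1..m. I (y i))" using that by (intro member_le_sum) auto
    also have "\<dots> < \<top>" using yI by (rule less_trans) simp
    finally show ?thesis by (simp add: v_def)
  qed
  have v0: "0 \<le> v i" for i by (simp add: v_def)
  have "(\<Sum>i=1..m. I (y i)) = ennreal (\<Sum>i=1..m. v i)"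
    using v v0 by (subst sum_ennreal[symmetric]) (auto intro!: sum.cong)
  then have "(\<Sum>i=1..m. v i) < real m * c'" using yI v0 by (simp add: ennreal_less_iff sum_nonneg)
  then have Vc': "(\<Sum>j<m. v (Suc j)) / real m < c'"
    using m by (simp add: field_simps sum.atLeast1_atMost_eq)
  define \<eta> where "\<eta> = c - c'"
  have \<eta>: "0 < \<eta>" using c'(3) by (simp add: \<eta>_def)
  define \<tau> where "\<tau> i = Suc ((i - 1) mod m)" for i
  have \<tau>: "\<tau> i \<in> {1..m}" for i using m by (simp add: \<tau>_def Suc_le_eq)
  have \<tau>_sum: "(\<Sum>i=1..n. h (\<tau> i)) = (\<Sum>i<n. h (Suc (i mod m)))" for n and h :: "nat \<Rightarrow> real"
    by (simp add: sum.atLeast1_atMost_eq \<tau>_def)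
  define B where "B j = (\<Inter>f\<in>F. {x. \<bar>f x - f (y j)\<bar> < \<epsilon> / 4})" for j
  have B: "open (B j)" "y j \<in> B j" for j
    using F unfolding B_def bcont_def
    by (auto intro!: open_INT open_Collect_less continuous_intros)
  have "\<forall>\<^sub>F n in sequentially. \<forall>j\<in>{1..m}. exp (- (a n * (v j + \<eta>))) \<le> measure (meas_of (\<mu>s n)) (B j)"
  proof (intro eventually_ball_finite ballI)
    fix j assume j: "j \<in> {1..m}"
    show "\<forall>\<^sub>F n in sequentially. exp (- (a n * (v j + \<eta>))) \<le> measure (meas_of (\<mu>s n)) (B j)"
      by (rule open_lower[OF B]) (use v[OF j] v0[of j] \<eta> in \<open>auto simp: ennreal_less_iff\<close>)
  qed simp
  moreover have "\<forall>\<^sub>F n in sequentially. (\<Sum>i<n. v (Suc (i mod m))) / real n < c'"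
    using cyclic_average_tendsto[OF m, of "\<lambda>i. v (Suc i)"] Vc' by (rule order_tendstoD)
  moreover have "\<forall>\<^sub>F n in sequentially. \<forall>f\<in>F.
      \<bar>(\<Sum>i<n. f (y (Suc (i mod m)))) / real n - (\<Sum>j<m. f (y (Suc j))) / real m\<bar> < \<epsilon> / 4"
    using F(1,3) tendstoD[OF cyclic_average_tendsto[OF m], of "\<epsilon> / 4"]
    by (intro eventually_ball_finite) (auto simp: dist_real_def)
  ultimately show ?thesis using a_pos eventually_ge_at_top[of 1]
  proof eventually_elim
    case (elim n)
    define P where "P = Pi\<^sub>E {1..n} (\<lambda>i. B (\<tau> i))"
    have "P \<subseteq> empirical n -` W \<inter> space (iid n (\<mu>s n))"
    proof
      fix x assume x: "x \<in> P"
      have "empirical n x \<in> W"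
      proof (rule FW)
        fix f assume f: "f \<in> F"
        have E1: "expect (empirical n x) f = (\<Sum>i=1..n. f (x i)) / real n"
          by (rule expect_empirical[OF elim(5) bcont_borel[OF F(2)[OF f]]])
        have E2: "expect (empirical m y) f = (\<Sum>j<m. f (y (Suc j))) / real m"
          using expect_empirical[OF m bcont_borel[OF F(2)[OF f]], of y] by (simp add: sum.atLeast1_atMost_eq)
        have "\<bar>(\<Sum>i=1..n. f (x i)) - (\<Sum>i=1..n. f (y (\<tau> i)))\<bar> \<le> (\<Sum>i=1..n. \<bar>f (x i) - f (y (\<tau> i))\<bar>)"
          unfolding sum_subtractf[symmetric] by (rule sum_abs)
        also have "\<dots> \<le> (\<Sum>i=1..n. \<epsilon> / 4)"
          using x f by (intro sum_mono less_imp_le) (auto simp: P_def B_def PiE_iff)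
        finally have "\<bar>(\<Sum>i=1..n. f (x i)) / real n - (\<Sum>i=1..n. f (y (\<tau> i))) / real n\<bar> \<le> \<epsilon> / 4"
          using elim(5) by (simp add: diff_divide_distrib[symmetric] field_simps)
        moreover have "\<bar>(\<Sum>i=1..n. f (y (\<tau> i))) / real n - expect (empirical m y) f\<bar> < \<epsilon> / 4"
          using elim(3) f unfolding E2 \<tau>_sum[of "\<lambda>j. f (y j)"] by blast
        moreover have "\<bar>expect (empirical m y) f - expect \<nu> f\<bar> < \<epsilon> / 2"
          using yW f by (auto simp: W'_def dist_real_def abs_minus_commute)
        ultimately show "\<bar>expect (empirical n x) f - expect \<nu> f\<bar> < \<epsilon>" unfolding E1 by linarith
      qed
      moreover have "x \<in> space (iid n (\<mu>s n))" using x by (auto simp: P_def iid_def space_PiM PiE_iff)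
      ultimately show "x \<in> empirical n -` W \<inter> space (iid n (\<mu>s n))" by simp
    qed
    moreover have "empirical n -` W \<inter> space (iid n (\<mu>s n)) \<in> sets (iid n (\<mu>s n))"
      using W(1) by measurable
    ultimately have "measure (iid n (\<mu>s n)) P \<le> measure (empirical_law n (\<mu>s n)) W"
      using W(1) by (simp add: measure_empirical_law iid.finite_measure_mono)
    moreover have "measure (iid n (\<mu>s n)) P = (\<Prod>i\<in>{1..n}. measure (meas_of (\<mu>s n)) (B (\<tau> i)))"
    proof -
      have "emeasure (iid n (\<mu>s n)) P = (\<Prod>i\<in>{1..n}. emeasure (meas_of (\<mu>s n)) (B (\<tau> i)))"
        unfolding P_def iid_def using B by (intro coord.emeasure_PiM) auto
      then show ?thesis
        by (simp add: iid.emeasure_eq_measure meas_of.emeasure_eq_measure prod_ennreal prod_nonneg)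
    qed
    moreover have "(\<Prod>i\<in>{1..n}. exp (- (a n * (v (\<tau> i) + \<eta>)))) \<le> (\<Prod>i\<in>{1..n}. measure (meas_of (\<mu>s n)) (B (\<tau> i)))"
      using elim(1) \<tau> by (intro prod_mono) auto
    moreover have "exp (- (real n * a n * c)) \<le> (\<Prod>i\<in>{1..n}. exp (- (a n * (v (\<tau> i) + \<eta>))))"
    proof -
      have "(\<Sum>i=1..n. v (\<tau> i)) \<le> real n * c'"
        using elim(2,5) unfolding \<tau>_sum by (simp add: field_simps)
      moreover have "(\<Sum>i=1..n. v (\<tau> i) + \<eta>) = (\<Sum>i=1..n. v (\<tau> i)) + real n * \<eta>"
        by (simp add: sum.distrib)
      moreover have "real n * c' + real n * \<eta> = real n * c" by (simp add: \<eta>_def algebra_simps)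
      ultimately have "(\<Sum>i=1..n. v (\<tau> i) + \<eta>) \<le> real n * c" by linarith
      then have "a n * (\<Sum>i=1..n. v (\<tau> i) + \<eta>) \<le> a n * (real n * c)"
        using elim(4) by (intro mult_left_mono) auto
      then have "- (real n * a n * c) \<le> (\<Sum>i=1..n. - (a n * (v (\<tau> i) + \<eta>)))"
        by (simp add: sum_negf sum_distrib_left[symmetric] mult_ac)
      then show ?thesis by (simp add: exp_sum[symmetric])
    qed
    ultimately show ?case by linarith
  qed
qed

text \<open>Sublevel sets of the coercive rate are compact, so finitely many balls cover them; outside these
balls the rate is large.\<close>

lemma empirical_exponentially_tight:
  assumes L: "0 \<le> L"
  shows "\<exists>T. compact T \<and> closed T \<and>
    (\<forall>\<^sub>F n in sequentially. measure (empirical_law n (\<mu>s n)) (- T) \<le> exp (- (real n * a n * L)))"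
proof -
  have "\<forall>\<^sub>F n in sequentially. 1 \<le> a n" using a by (simp add: filterlim_at_top)
  then obtain N where N: "\<And>n. N \<le> n \<Longrightarrow> 1 \<le> a n" unfolding eventually_sequentially by blast
  have balls: "\<exists>S. finite S \<and> (\<forall>\<^sub>F n in sequentially.
      measure (meas_of (\<mu>s n)) (- (\<Union>x\<in>S. ball x \<delta>)) \<le> exp (- (a n * L)))"
    if "0 \<le> L" "0 < \<delta>" for L \<delta> :: real
  proof -
    have "compact {x. I x \<le> ennreal (L + 1)}" using that(1) by (intro compact_sublevel lsc coercive) simp
    then obtain S where S: "finite S" "{x. I x \<le> ennreal (L + 1)} \<subseteq> (\<Union>x\<in>S. ball x \<delta>)"
      using \<open>0 < \<delta>\<close> unfolding compact_eq_totally_bounded by blast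
    have "ennreal L < ennreal (L + 1)" using that(1) by (simp add: ennreal_less_iff)
    also have "\<dots> \<le> (INF x\<in>- (\<Union>x\<in>S. ball x \<delta>). I x)"
    proof (rule INF_greatest)
      fix x assume "x \<in> - (\<Union>x\<in>S. ball x \<delta>)"
      then have "\<not> I x \<le> ennreal (L + 1)" using S(2) by blast
      then show "ennreal (L + 1) \<le> I x" by simp
    qed
    finally have "\<forall>\<^sub>F n in sequentially. measure (meas_of (\<mu>s n)) (- (\<Union>x\<in>S. ball x \<delta>)) \<le> exp (- (a n * L))"
      using that(1) by (intro closed_upper) (auto intro!: closed_INT)
    then show ?thesis using S(1) by blast
  qed
  have "\<exists>K. compact K \<and> (\<forall>n\<ge>N. measure (meas_of (\<mu>s n)) (- K) \<le> exp (- (a n * L)))" if "0 \<le> L" for L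
    by (rule uniform_compact_of_finite_balls[OF N balls that]) auto
  from empirical_law_exponentially_tight[OF N this L] show ?thesis .
qed

theorem large_deviations_empirical:
  "large_deviations (\<lambda>n. empirical_law n (\<mu>s n)) (\<lambda>n. real n * a n) (\<lambda>\<nu>. \<integral>\<^sup>+ x. I x \<partial>meas_of \<nu>)"
proof (rule large_deviationsI)
  show "filterlim (\<lambda>n. real n * a n) at_top sequentially"
    by (rule filterlim_at_top_mult_at_top[OF filterlim_real_sequentially a])
qed (simp_all add: prob_space_empirical_law lower_semicontinuous_nn_integral lsc
    empirical_lower empirical_local_upper empirical_exponentially_tight)

end

theorem theorem6p1:
  fixes \<mu>s :: "nat \<Rightarrow> ('a :: polish_space) borel_prob" and \<mu> :: "'a borel_prob"
  assumes "\<mu>s \<longlonglongrightarrow> \<mu>"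
  shows "large_deviations (\<lambda>n. empirical_law n (\<mu>s n)) (\<lambda>n. real n)
           (\<lambda>\<nu>. e2ennreal (relative_entropy \<nu> \<mu>)) \<and>
    (\<forall>(a :: nat \<Rightarrow> real) (I :: 'a \<Rightarrow> ennreal).
       (\<forall>n\<ge>1. 0 < a n) \<longrightarrow> filterlim a at_top sequentially \<longrightarrow>
       large_deviations (\<lambda>n. meas_of (\<mu>s n)) a I \<longrightarrow> coercive I \<longrightarrow>
       large_deviations (\<lambda>n. empirical_law n (\<mu>s n)) (\<lambda>n. real n * a n)
           (\<lambda>\<nu>. \<integral>\<^sup>+ x. I x \<partial>meas_of \<nu>) \<and>
       coercive (\<lambda>\<nu> :: 'a borel_prob. \<integral>\<^sup>+ x. I x \<partial>meas_of \<nu>))"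
proof (intro conjI allI impI)
  show "large_deviations (\<lambda>n. empirical_law n (\<mu>s n)) (\<lambda>n. real n) (\<lambda>\<nu>. e2ennreal (relative_entropy \<nu> \<mu>))"
    using assms by (rule sanov_varying)
  fix a :: "nat \<Rightarrow> real" and I :: "'a \<Rightarrow> ennreal"
  assume "filterlim a at_top sequentially" "large_deviations (\<lambda>n. meas_of (\<mu>s n)) a I" "coercive I"
  then interpret ldp_variables \<mu>s a I by unfold_locales
  show "large_deviations (\<lambda>n. empirical_law n (\<mu>s n)) (\<lambda>n. real n * a n) (\<lambda>\<nu>. \<integral>\<^sup>+ x. I x \<partial>meas_of \<nu>)"
    by (rule large_deviations_empirical)
  show "coercive (\<lambda>\<nu> :: 'a borel_prob. \<integral>\<^sup>+ x. I x \<partial>meas_of \<nu>)"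
    using lsc coercive by (rule coercive_nn_integral)
qed


end
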